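(* Fix a set $\tilde\Omega$ with $\Omega\subseteq\tilde\Omega\subseteq C([0,T],H)$. Let $u$ be a minimax subsolution and let $v$ be a minimax supersolution of (TVP) on $[0,T]\times\tilde\Omega$. Then $u\le v$ on $[0,T]\times\tilde\Omega$.
   Context: Spaces. Let $T>0$. $H$ is a real Hilbert space with inner product $(\cdot,\cdot)$ and norm $|\cdot|$; $V$ is a separable reflexive Banach space with norm $\|\cdot\|$, continuously, densely and compactly embedded into $H$; $V^\ast$ is its dual with norm $\|\cdot\|_\ast$ and duality pairing $\langle x^\ast,x\rangle=x^\ast(x)$. With the usual identifications, $V\subseteq H\subseteq V^\ast$ and $\langle x,y\rangle=(x,y)$ for $x\in H$, $y\in V$. Fix $p\ge 2$, $q>1$ with $1/p+1/q=1$. For $t_0\in[0,T)$, $W_{pq}(t_0,T)$ is the space of all $\mathbf{x}\in L^p(t_0,T;V)$ possessing a generalized derivative $\mathbf{x}'\in L^q(t_0,T;V^\ast)$. Operator. $A:[0,T]\times V\to V^\ast$ is fixed and satisfies: (i) $t\mapsto\langle A(t,x),v\rangle$ is measurable for all $x,v\in V$; (ii) for a.e. $t$ and all $x,y\in V$, $\langle A(t,x)-A(t,y),x-y\rangle\ge 0$; (iii) for a.e. $t$ and all $x,y,v\in V$, $s\mapsto\langle A(t,x+sy),v\rangle$ is continuous on $[0,1]$; (iv) there are $a_1\in L^q(0,T)$, $c_1\ge0$ with $\|A(t,x)\|_\ast\le a_1(t)+c_1\|x\|^{p-1}$ for all $x\in V$ and a.e. $t$; (v) there is $c_2>0$ with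 $\langle A(t,x),x\rangle\ge c_2\|x\|^p$ for all $x\in V$ and a.e. $t$. Paths and continuity. $C([0,T],H)$ carries the sup norm. On $[0,T]\times C([0,T],H)$ and its subsets use the pseudo-metric $\mathbf{d}_\infty((t,x),(s,y))=|t-s|+\sup_{r\in[0,T]}|x(r\wedge t)-y(r\wedge s)|$; (semi-)continuity in $(t,x)$ is meant with respect to $\mathbf{d}_\infty$ (so such functions are non-anticipating, i.e. their value at time $t$ depends only on the path up to time $t$). USC and LSC denote real-valued upper and lower semicontinuous functions. Trajectories. For $L\ge 0$ and $(t_0,x_0)\in[0,T)\times C([0,T],H)$, $\mathcal{X}^L(t_0,x_0)$ is the set of all $x\in C([0,T],H)$ with $x=x_0$ on $[0,t_0]$ for which there exist $\mathbf{x}\in W_{pq}(t_0,T)$ and $f^x\in L^2(t_0,T;H)$ with $x=\mathbf{x}$ a.e. on $(t_0,T)$, $\mathbf{x}'(t)+A(t,\mathbf{x}(t))=f^x(t)$ a.e. on $(t_0,T)$, and $|f^x(t)|\le L(1+\sup_{0\le s\le t}|x(s)|)$ a.e. on $(t_0,T)$ ($\mathbf{x}$, $f^x$ are uniquely determined by $x$). Fix $x_\ast\in H$, regarded as a constant path, and put $\Omega^L:=\mathcal{X}^L(0,x_\ast)$, $\Omega:=\bigcup_{L\ge0}\Omega^L$. Data. $h:C([0,T],H)\to\mathbb{R}$ is continuous. $F:[0,T]\times C([0,T],H)\times H\to\mathbb{R}$ satisfies: (i) $F$ is continuous; (ii) there is $L_0\ge0$ with $|F(t,x,z)-F(t,x,\tilde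 z)|\le L_0(1+\sup_{0\le s\le t}|x(s)|)|z-\tilde z|$ for all $t,x,z,\tilde z$; (iii) for every $L\ge0$ and $(t_0,x_0)\in[0,T)\times C([0,T],H)$ there is a modulus of continuity $m_{L,t_0,x_0}$ such that for all $\varepsilon>0$, $t\in[t_0,T]$, $x,y\in\mathcal{X}^L(t_0,x_0)$: $F(t,x,\varepsilon^{-1}[x(t)-y(t)])-F(t,y,\varepsilon^{-1}[x(t)-y(t)])\le m_{L,t_0,x_0}(\varepsilon^{-1}|x(t)-y(t)|^2+\sup_{s\le t}|x(s)-y(s)|)$. (TVP) denotes the terminal-value problem $\partial_tu-\langle A(t,x(t)),\partial_xu\rangle+F(t,x,\partial_xu)=0$ on $[0,T)\times C([0,T],H)$, $u(T,x)=h(x)$. Minimax semisolutions. For $L\ge0$, $u:[0,T]\times\tilde\Omega\to\mathbb{R}$ is a minimax $L$-subsolution (resp. $L$-supersolution) of (TVP) on $[0,T]\times\tilde\Omega$ if $u\in\mathrm{USC}([0,T]\times\tilde\Omega)$ (resp. $\mathrm{LSC}$), $u(T,\cdot)\le h$ (resp. $\ge h$) on $\tilde\Omega$, and for every $(t_0,x_0,z)\in[0,T)\times\tilde\Omega\times H$ there is $x\in\mathcal{X}^L(t_0,x_0)\cap\tilde\Omega$ such that for every $t\in[t_0,T]$: $u(t_0,x_0)\le$ (resp. $\ge$) $\int_{t_0}^t[(-f^x(s),z)+F(s,x,z)]\,ds+u(t,x)$. $u$ is a minimax subsolution (resp. supersolution) of (TVP) on $[0,T]\times\tilde\Omega$ if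 it is a minimax $L$-subsolution (resp. $L$-supersolution) for some $L\ge0$. *)

theory Defs
  imports "HOL-Analysis.Analysis"
begin

section \<open>Spaces\<close>

text \<open>
  \<open>V\<close> is a type of sort \<open>{banach, second_countable_topology}\<close> (for a metric space, second
  countable means separable), \<open>H\<close> a type of sort \<open>{real_inner, complete_space}\<close>, the dual of
  \<open>V\<close> is the type \<open>'v \<Rightarrow>\<^sub>L real\<close> with the operator norm, and the inclusion of \<open>V\<close> into \<open>H\<close> is an
  explicit map \<open>\<iota>\<close>.
\<close>

definition reflexive_space :: "'v::real_normed_vector itself \<Rightarrow> bool" where
  "reflexive_space _ \<longleftrightarrow>
     (\<forall>\<Phi> :: ('v \<Rightarrow>\<^sub>L real) \<Rightarrow>\<^sub>L real. \<exists>x :: 'v. \<forall>g. blinfun_apply \<Phi> g = blinfun_apply g x)"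

definition compact_dense_embedding ::
    "('v::real_normed_vector \<Rightarrow>\<^sub>L 'h::real_normed_vector) \<Rightarrow> bool" where
  "compact_dense_embedding \<iota> \<longleftrightarrow>
     inj (blinfun_apply \<iota>) \<and>
     closure (range (blinfun_apply \<iota>)) = UNIV \<and>
     (\<forall>B. bounded B \<longrightarrow> compact (closure (blinfun_apply \<iota> ` B)))"

text \<open>The inclusion of \<open>H\<close> into the dual of \<open>V\<close>: \<open>y\<close> is sent to the functional \<open>v \<mapsto> (y, v)\<close>.\<close>

definition to_dual ::
    "('v::real_normed_vector \<Rightarrow>\<^sub>L 'h::real_inner) \<Rightarrow> 'h \<Rightarrow> ('v \<Rightarrow>\<^sub>L real)" where
  "to_dual \<iota> y = blinfun_inner_right y o\<^sub>L \<iota>"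

text \<open>
  \<open>L\<^sup>p(a,b;X)\<close>, by representatives. The spaces \<open>X\<close> used below (\<open>real\<close>, \<open>V\<close>, its dual and \<open>H\<close>)
  are separable: the dual of \<open>V\<close> because \<open>V\<close> is reflexive and separable, \<open>H\<close> because \<open>V\<close> is
  separable and dense in it. Hence Borel measurability is the same as strong measurability.
\<close>

definition Lp_space :: "real \<Rightarrow> real \<Rightarrow> real \<Rightarrow> (real \<Rightarrow> 'b::real_normed_vector) set" where
  "Lp_space p a b = {f. f \<in> borel_measurable (lebesgue_on {a<..<b}) \<and>
     integrable (lebesgue_on {a<..<b}) (\<lambda>t. norm (f t) powr p)}"

text \<open>
  The Bochner integral, with the defining clauses of \<^const>\<open>has_bochner_integral\<close>. The library
  constant asks for a second countable value type, and the function type \<open>'v \<Rightarrow>\<^sub>L real\<close> has no such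
  class instance, although for separable reflexive \<open>V\<close> it is second countable.
\<close>

definition has_bochner_int ::
    "'a measure \<Rightarrow> ('a \<Rightarrow> 'b::real_normed_vector) \<Rightarrow> 'b \<Rightarrow> bool" where
  "has_bochner_int M f I \<longleftrightarrow> f \<in> borel_measurable M \<and>
     (\<exists>s. (\<forall>i. Bochner_Integration.simple_bochner_integrable M (s i)) \<and>
          (\<lambda>i. \<integral>\<^sup>+x. ennreal (norm (f x - s i x)) \<partial>M) \<longlonglongrightarrow> 0 \<and>
          (\<lambda>i. Bochner_Integration.simple_bochner_integral M (s i :: 'a \<Rightarrow> 'b)) \<longlonglongrightarrow> I)"

text \<open>\<open>C\<^sub>c\<^sup>\<infinity>(a,b)\<close>, extended by zero to the real line.\<close>

definition test_functions :: "real \<Rightarrow> real \<Rightarrow> (real \<Rightarrow> real) set" where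
  "test_functions a b = {\<phi>.
     (\<forall>n. (deriv ^^ n) \<phi> differentiable_on UNIV) \<and>
     (\<exists>c d. a < c \<and> c \<le> d \<and> d < b \<and> (\<forall>t. t \<notin> {c..d} \<longrightarrow> \<phi> t = 0))}"

definition generalized_derivative ::
    "('v::real_normed_vector \<Rightarrow>\<^sub>L 'h::real_inner) \<Rightarrow> real \<Rightarrow> real \<Rightarrow>
     (real \<Rightarrow> 'v) \<Rightarrow> (real \<Rightarrow> ('v \<Rightarrow>\<^sub>L real)) \<Rightarrow> bool" where
  "generalized_derivative \<iota> a b X X' \<longleftrightarrow>
     (\<forall>\<phi> \<in> test_functions a b. \<exists>I.
        has_bochner_int (lebesgue_on {a<..<b})
          (\<lambda>t. deriv \<phi> t *\<^sub>R to_dual \<iota> (blinfun_apply \<iota> (X t))) I \<and>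
        has_bochner_int (lebesgue_on {a<..<b}) (\<lambda>t. \<phi> t *\<^sub>R X' t) (- I))"

text \<open>\<open>X \<in> W\<^sub>p\<^sub>q(a,b)\<close> with generalized derivative \<open>X'\<close>.\<close>

definition Wpq ::
    "('v::real_normed_vector \<Rightarrow>\<^sub>L 'h::real_inner) \<Rightarrow> real \<Rightarrow> real \<Rightarrow> real \<Rightarrow> real \<Rightarrow>
     (real \<Rightarrow> 'v) \<Rightarrow> (real \<Rightarrow> ('v \<Rightarrow>\<^sub>L real)) \<Rightarrow> bool" where
  "Wpq \<iota> p q a b X X' \<longleftrightarrow>
     X \<in> Lp_space p a b \<and> X' \<in> Lp_space q a b \<and> generalized_derivative \<iota> a b X X'"


section \<open>The operator\<close>

definition monotone_coercive_operator ::
    "real \<Rightarrow> real \<Rightarrow> real \<Rightarrow> (real \<Rightarrow> 'v::real_normed_vector \<Rightarrow> ('v \<Rightarrow>\<^sub>L real)) \<Rightarrow> bool" where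
  "monotone_coercive_operator T p q A \<longleftrightarrow>
     (\<forall>x v. (\<lambda>t. blinfun_apply (A t x) v) \<in> borel_measurable (lebesgue_on {0..T})) \<and>
     (AE t in lebesgue_on {0..T}. \<forall>x y. blinfun_apply (A t x - A t y) (x - y) \<ge> 0) \<and>
     (AE t in lebesgue_on {0..T}. \<forall>x y v.
        continuous_on {0..1} (\<lambda>s. blinfun_apply (A t (x + s *\<^sub>R y)) v)) \<and>
     (\<exists>a\<^sub>1 \<in> Lp_space q 0 T. \<exists>c\<^sub>1\<ge>0. AE t in lebesgue_on {0..T}. \<forall>x.
        norm (A t x) \<le> a\<^sub>1 t + c\<^sub>1 * norm x powr (p - 1)) \<and>
     (\<exists>c\<^sub>2>0. AE t in lebesgue_on {0..T}. \<forall>x. blinfun_apply (A t x) x \<ge> c\<^sub>2 * norm x powr p)"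


section \<open>Paths and continuity\<close>

text \<open>
  \<open>C([0,T],H)\<close>. Paths are \<^const>\<open>extensional\<close>, so that an element is determined by its values
  on \<open>[0,T]\<close>.
\<close>

definition paths :: "real \<Rightarrow> (real \<Rightarrow> 'h::real_normed_vector) set" where
  "paths T = {x \<in> extensional {0..T}. continuous_on {0..T} x}"

definition const_path :: "real \<Rightarrow> 'h \<Rightarrow> real \<Rightarrow> 'h" where
  "const_path T y = restrict (\<lambda>_. y) {0..T}"

definition sup_norm :: "real \<Rightarrow> (real \<Rightarrow> 'h::real_normed_vector) \<Rightarrow> real" where
  "sup_norm t x = (SUP s\<in>{0..t}. norm (x s))"

definition d_inf ::
    "real \<Rightarrow> real \<times> (real \<Rightarrow> 'h::real_normed_vector) \<Rightarrow> real \<times> (real \<Rightarrow> 'h) \<Rightarrow> real" where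
  "d_inf T = (\<lambda>(t, x) (s, y).
     \<bar>t - s\<bar> + (SUP r\<in>{0..T}. norm (x (min r t) - y (min r s))))"

definition USC ::
    "real \<Rightarrow> (real \<Rightarrow> 'h::real_normed_vector) set \<Rightarrow> (real \<Rightarrow> (real \<Rightarrow> 'h) \<Rightarrow> real) \<Rightarrow> bool" where
  "USC T S u \<longleftrightarrow> (\<forall>t\<in>{0..T}. \<forall>x\<in>S. \<forall>\<epsilon>>0. \<exists>\<delta>>0. \<forall>s\<in>{0..T}. \<forall>y\<in>S.
     d_inf T (t, x) (s, y) < \<delta> \<longrightarrow> u s y < u t x + \<epsilon>)"

definition LSC ::
    "real \<Rightarrow> (real \<Rightarrow> 'h::real_normed_vector) set \<Rightarrow> (real \<Rightarrow> (real \<Rightarrow> 'h) \<Rightarrow> real) \<Rightarrow> bool" where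
  "LSC T S u \<longleftrightarrow> (\<forall>t\<in>{0..T}. \<forall>x\<in>S. \<forall>\<epsilon>>0. \<exists>\<delta>>0. \<forall>s\<in>{0..T}. \<forall>y\<in>S.
     d_inf T (t, x) (s, y) < \<delta> \<longrightarrow> u s y > u t x - \<epsilon>)"


section \<open>Trajectories\<close>

text \<open>\<open>x\<close> belongs to \<open>\<X>\<^sup>L(t\<^sub>0,x\<^sub>0)\<close>, and \<open>f\<close> is (a representative of) \<open>f\<^sup>x\<close>.\<close>

definition trajectory_rhs ::
    "('v::real_normed_vector \<Rightarrow>\<^sub>L 'h::real_inner) \<Rightarrow> (real \<Rightarrow> 'v \<Rightarrow> ('v \<Rightarrow>\<^sub>L real)) \<Rightarrow>
     real \<Rightarrow> real \<Rightarrow> real \<Rightarrow> real \<Rightarrow> real \<Rightarrow> (real \<Rightarrow> 'h) \<Rightarrow> (real \<Rightarrow> 'h) \<Rightarrow> (real \<Rightarrow> 'h) \<Rightarrow> bool" where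
  "trajectory_rhs \<iota> A p q T L t\<^sub>0 x\<^sub>0 x f \<longleftrightarrow>
     x \<in> paths T \<and> (\<forall>t\<in>{0..t\<^sub>0}. x t = x\<^sub>0 t) \<and> f \<in> Lp_space 2 t\<^sub>0 T \<and>
     (\<exists>X X'. Wpq \<iota> p q t\<^sub>0 T X X' \<and>
        (AE t in lebesgue_on {t\<^sub>0<..<T}. x t = blinfun_apply \<iota> (X t)) \<and>
        (AE t in lebesgue_on {t\<^sub>0<..<T}. X' t + A t (X t) = to_dual \<iota> (f t))) \<and>
     (AE t in lebesgue_on {t\<^sub>0<..<T}. norm (f t) \<le> L * (1 + sup_norm t x))"

definition trajectories ::
    "('v::real_normed_vector \<Rightarrow>\<^sub>L 'h::real_inner) \<Rightarrow> (real \<Rightarrow> 'v \<Rightarrow> ('v \<Rightarrow>\<^sub>L real)) \<Rightarrow>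
     real \<Rightarrow> real \<Rightarrow> real \<Rightarrow> real \<Rightarrow> real \<Rightarrow> (real \<Rightarrow> 'h) \<Rightarrow> (real \<Rightarrow> 'h) set" where
  "trajectories \<iota> A p q T L t\<^sub>0 x\<^sub>0 = {x. \<exists>f. trajectory_rhs \<iota> A p q T L t\<^sub>0 x\<^sub>0 x f}"

definition Omega ::
    "('v::real_normed_vector \<Rightarrow>\<^sub>L 'h::real_inner) \<Rightarrow> (real \<Rightarrow> 'v \<Rightarrow> ('v \<Rightarrow>\<^sub>L real)) \<Rightarrow>
     real \<Rightarrow> real \<Rightarrow> real \<Rightarrow> 'h \<Rightarrow> (real \<Rightarrow> 'h) set" where
  "Omega \<iota> A p q T xstar = (\<Union>L\<in>{0..}. trajectories \<iota> A p q T L 0 (const_path T xstar))"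


section \<open>Data of the terminal-value problem\<close>

definition continuous_terminal :: "real \<Rightarrow> ((real \<Rightarrow> 'h::real_normed_vector) \<Rightarrow> real) \<Rightarrow> bool" where
  "continuous_terminal T h \<longleftrightarrow> (\<forall>x\<in>paths T. \<forall>\<epsilon>>0. \<exists>\<delta>>0. \<forall>y\<in>paths T.
     sup_norm T (\<lambda>r. x r - y r) < \<delta> \<longrightarrow> \<bar>h x - h y\<bar> < \<epsilon>)"

definition modulus_of_continuity :: "(real \<Rightarrow> real) \<Rightarrow> bool" where
  "modulus_of_continuity m \<longleftrightarrow> m 0 = 0 \<and> mono_on {0..} m \<and> (m \<longlongrightarrow> 0) (at_right 0)"

definition admissible_hamiltonian ::
    "('v::real_normed_vector \<Rightarrow>\<^sub>L 'h::real_inner) \<Rightarrow> (real \<Rightarrow> 'v \<Rightarrow> ('v \<Rightarrow>\<^sub>L real)) \<Rightarrow>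
     real \<Rightarrow> real \<Rightarrow> real \<Rightarrow> (real \<Rightarrow> (real \<Rightarrow> 'h) \<Rightarrow> 'h \<Rightarrow> real) \<Rightarrow> bool" where
  "admissible_hamiltonian \<iota> A p q T F \<longleftrightarrow>
     (\<forall>t\<in>{0..T}. \<forall>x\<in>paths T. \<forall>z. \<forall>\<epsilon>>0. \<exists>\<delta>>0. \<forall>s\<in>{0..T}. \<forall>y\<in>paths T. \<forall>z'.
        d_inf T (t, x) (s, y) < \<delta> \<and> norm (z - z') < \<delta> \<longrightarrow> \<bar>F t x z - F s y z'\<bar> < \<epsilon>) \<and>
     (\<exists>L\<^sub>0\<ge>0. \<forall>t\<in>{0..T}. \<forall>x\<in>paths T. \<forall>z z'.
        \<bar>F t x z - F t x z'\<bar> \<le> L\<^sub>0 * (1 + sup_norm t x) * norm (z - z')) \<and>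
     (\<forall>L\<ge>0. \<forall>t\<^sub>0\<in>{0..<T}. \<forall>x\<^sub>0\<in>paths T. \<exists>m. modulus_of_continuity m \<and>
        (\<forall>\<epsilon>>0. \<forall>t\<in>{t\<^sub>0..T}. \<forall>x\<in>trajectories \<iota> A p q T L t\<^sub>0 x\<^sub>0.
           \<forall>y\<in>trajectories \<iota> A p q T L t\<^sub>0 x\<^sub>0.
             F t x ((1 / \<epsilon>) *\<^sub>R (x t - y t)) - F t y ((1 / \<epsilon>) *\<^sub>R (x t - y t))
               \<le> m ((1 / \<epsilon>) * (norm (x t - y t))\<^sup>2 + sup_norm t (\<lambda>s. x s - y s))))"


section \<open>Minimax semisolutions\<close>

definition minimax_L_subsolution ::
    "('v::real_normed_vector \<Rightarrow>\<^sub>L 'h::real_inner) \<Rightarrow> (real \<Rightarrow> 'v \<Rightarrow> ('v \<Rightarrow>\<^sub>L real)) \<Rightarrow>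
     real \<Rightarrow> real \<Rightarrow> real \<Rightarrow> ((real \<Rightarrow> 'h) \<Rightarrow> real) \<Rightarrow> (real \<Rightarrow> (real \<Rightarrow> 'h) \<Rightarrow> 'h \<Rightarrow> real) \<Rightarrow>
     real \<Rightarrow> (real \<Rightarrow> 'h) set \<Rightarrow> (real \<Rightarrow> (real \<Rightarrow> 'h) \<Rightarrow> real) \<Rightarrow> bool" where
  "minimax_L_subsolution \<iota> A p q T h F L S u \<longleftrightarrow>
     USC T S u \<and> (\<forall>x\<in>S. u T x \<le> h x) \<and>
     (\<forall>t\<^sub>0\<in>{0..<T}. \<forall>x\<^sub>0\<in>S. \<forall>z. \<exists>x\<in>S. \<exists>f. trajectory_rhs \<iota> A p q T L t\<^sub>0 x\<^sub>0 x f \<and>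
        (\<forall>t\<in>{t\<^sub>0..T}. u t\<^sub>0 x\<^sub>0 \<le>
           integral\<^sup>L (lebesgue_on {t\<^sub>0..t}) (\<lambda>s. inner (- f s) z + F s x z) + u t x))"

definition minimax_L_supersolution ::
    "('v::real_normed_vector \<Rightarrow>\<^sub>L 'h::real_inner) \<Rightarrow> (real \<Rightarrow> 'v \<Rightarrow> ('v \<Rightarrow>\<^sub>L real)) \<Rightarrow>
     real \<Rightarrow> real \<Rightarrow> real \<Rightarrow> ((real \<Rightarrow> 'h) \<Rightarrow> real) \<Rightarrow> (real \<Rightarrow> (real \<Rightarrow> 'h) \<Rightarrow> 'h \<Rightarrow> real) \<Rightarrow>
     real \<Rightarrow> (real \<Rightarrow> 'h) set \<Rightarrow> (real \<Rightarrow> (real \<Rightarrow> 'h) \<Rightarrow> real) \<Rightarrow> bool" where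
  "minimax_L_supersolution \<iota> A p q T h F L S u \<longleftrightarrow>
     LSC T S u \<and> (\<forall>x\<in>S. u T x \<ge> h x) \<and>
     (\<forall>t\<^sub>0\<in>{0..<T}. \<forall>x\<^sub>0\<in>S. \<forall>z. \<exists>x\<in>S. \<exists>f. trajectory_rhs \<iota> A p q T L t\<^sub>0 x\<^sub>0 x f \<and>
        (\<forall>t\<in>{t\<^sub>0..T}. u t\<^sub>0 x\<^sub>0 \<ge>
           integral\<^sup>L (lebesgue_on {t\<^sub>0..t}) (\<lambda>s. inner (- f s) z + F s x z) + u t x))"

definition minimax_subsolution ::
    "('v::real_normed_vector \<Rightarrow>\<^sub>L 'h::real_inner) \<Rightarrow> (real \<Rightarrow> 'v \<Rightarrow> ('v \<Rightarrow>\<^sub>L real)) \<Rightarrow>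
     real \<Rightarrow> real \<Rightarrow> real \<Rightarrow> ((real \<Rightarrow> 'h) \<Rightarrow> real) \<Rightarrow> (real \<Rightarrow> (real \<Rightarrow> 'h) \<Rightarrow> 'h \<Rightarrow> real) \<Rightarrow>
     (real \<Rightarrow> 'h) set \<Rightarrow> (real \<Rightarrow> (real \<Rightarrow> 'h) \<Rightarrow> real) \<Rightarrow> bool" where
  "minimax_subsolution \<iota> A p q T h F S u \<longleftrightarrow>
     (\<exists>L\<ge>0. minimax_L_subsolution \<iota> A p q T h F L S u)"

definition minimax_supersolution ::
    "('v::real_normed_vector \<Rightarrow>\<^sub>L 'h::real_inner) \<Rightarrow> (real \<Rightarrow> 'v \<Rightarrow> ('v \<Rightarrow>\<^sub>L real)) \<Rightarrow>
     real \<Rightarrow> real \<Rightarrow> real \<Rightarrow> ((real \<Rightarrow> 'h) \<Rightarrow> real) \<Rightarrow> (real \<Rightarrow> (real \<Rightarrow> 'h) \<Rightarrow> 'h \<Rightarrow> real) \<Rightarrow>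
     (real \<Rightarrow> 'h) set \<Rightarrow> (real \<Rightarrow> (real \<Rightarrow> 'h) \<Rightarrow> real) \<Rightarrow> bool" where
  "minimax_supersolution \<iota> A p q T h F S u \<longleftrightarrow>
     (\<exists>L\<ge>0. minimax_L_supersolution \<iota> A p q T h F L S u)"

end

theory Submission
  imports Defs "HOL-Real_Asymp.Real_Asymp"
begin

text \<open>
  Suppose \<open>u(t\<^sub>0,x\<^sub>0) - v(t\<^sub>0,x\<^sub>0) = \<kappa> > 0\<close>, and let \<open>L\<close> serve both semisolutions. As \<open>\<Omega>'\<close> need not be closed, the
  maximum that the doubling of variables calls for need not be attained. It is replaced by the limit
  \<open>\<kappa>' \<ge> \<kappa>\<close>, as \<open>\<rho>\<close> tends to 0, of the suprema of \<open>u(t,x) - v(t,y) + \<theta> (t - t\<^sub>0)\<close> over all times \<open>t\<close> and all pairs of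
  trajectories in \<open>\<Omega>'\<close> starting at \<open>(t\<^sub>0,x\<^sub>0)\<close> that are \<open>\<rho>\<close>-close on \<open>[0,t]\<close>; here \<open>\<theta> > 0\<close> is small.

  Start from an almost maximal, very close pair \<open>(x\<^sub>1,y\<^sub>1)\<close> at a time \<open>t\<^sub>1\<close> and extend it by Euler steps,
  on each of which the semisolution properties are used with the frozen momentum \<open>z = (x - y) / \<epsilon>\<close>.
  By monotonicity of \<open>A\<close> and the energy inequality,
  \<open>E = u(t,x) - v(t,y) - \<bar>x(t) - y(t)\<bar>\<^sup>2 / (2 \<epsilon>)\<close> decreases at rate at most \<open>\<theta> / 2\<close>
  as long as \<open>x\<close> and \<open>y\<close> stay close. Almost maximality then bounds \<open>\<bar>x(t) - y(t)\<bar>\<^sup>2 / (2 \<epsilon>)\<close> by a small constant minus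
  \<open>\<theta> / 2 (t - t\<^sub>1)\<close>, so the pair does stay close up to time \<open>T\<close>, where this bound is negative because
  \<open>t\<^sub>1\<close> is bounded away from \<open>T\<close>.

  Compactness of the set of trajectories in \<open>C([0,T],H)\<close> enters only through the boundedness of \<open>F\<close> and the uniform
  continuity of \<open>h\<close> and of the paths. It rests on two facts: the coercivity bound makes \<open>x\<^sub>n(s)\<close> relatively compact in \<open>H\<close> for
  almost every \<open>s\<close>, and the energy inequality for differences propagates smallness at time \<open>s\<close> to later times.
\<close>

section \<open>Smooth cutoff functions\<close>

text \<open>The penalty sees only the present distance of \<open>x\<close> and \<open>y\<close>,
  while the modulus of \<open>F\<close> also sees the distance of their histories. The history is
  carried along by induction: \<open>\<epsilon> * \<eta> = \<rho>\<^sub>1\<^sup>2\<close> keeps the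
  argument of the modulus below \<open>2 * \<eta>\<close> for every pair that is
  \<open>\<rho>\<^sub>1\<close>-close on its past, and almost maximality returns a present distance
  of at most \<open>3 / 4 * \<rho>\<^sub>1\<close> at each grid time, which leaves room for the next
  step. Euler steps restart at later times, whereas the modulus and compactness refer to one
  starting point; hence elements of \<open>Wpq\<close> have to be glued. The generalized derivative
  of a glued function comes from integration by parts on both sides of the junction, where the
  boundary terms cancel. The energy inequality rests on backward difference quotients and
  \<open>\<bar>a\<bar>\<^sup>2 - \<bar>b\<bar>\<^sup>2 \<le> 2 (a - b, a)\<close>: the quotients
  converge weakly against indicators of half-lines, and this survives dominated limits.\<close>

coinductive smooth :: "(real \<Rightarrow> real) \<Rightarrow> bool" where
  smoothI: "(\<And>x. (f has_real_derivative f' x) (at x)) \<Longrightarrow> smooth f' \<Longrightarrow> smooth f"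

lemma smooth_deriv:
  assumes "smooth f"
  shows "(f has_real_derivative deriv f x) (at x)" "smooth (deriv f)"
proof -
  obtain f' where f': "\<And>x. (f has_real_derivative f' x) (at x)" "smooth f'"
    using assms by (cases rule: smooth.cases) auto
  have "deriv f = f'"
    using DERIV_imp_deriv[OF f'(1)] by auto
  with f' show "(f has_real_derivative deriv f x) (at x)" "smooth (deriv f)"
    by auto
qed

lemma smooth_funpow_deriv: "smooth f \<Longrightarrow> smooth ((deriv ^^ n) f)"
  by (induction n) (auto intro: smooth_deriv)

lemma smooth_imp_differentiable_on: "smooth f \<Longrightarrow> f differentiable_on S"
  unfolding differentiable_on_def
  by (auto intro: differentiable_at_withinI real_differentiable_def[THEN iffD2] smooth_deriv(1))

lemma smooth_imp_continuous_on: "smooth f \<Longrightarrow> continuous_on S f"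
  by (meson smooth_imp_differentiable_on differentiable_imp_continuous_on)

text \<open>Coinduction asks for a class of functions that contains the given one and is closed
  under differentiation; here the constants form that class.\<close>

lemma smooth_const: "smooth (\<lambda>x. c)"
proof -
  have "\<exists>c. f = (\<lambda>x. c) \<Longrightarrow> smooth f" for f :: "real \<Rightarrow> real"
    by (coinduction arbitrary: f rule: smooth.coinduct) (force intro!: derivative_eq_intros)
  then show ?thesis by auto
qed

lemma smooth_affine: "smooth f \<Longrightarrow> smooth (\<lambda>x. c * f (a * x + b))"
proof -
  have "\<exists>c f. g = (\<lambda>x. c * f (a * x + b)) \<and> smooth f \<Longrightarrow> smooth g" for g
  proof (coinduction arbitrary: g rule: smooth.coinduct)
    case (smooth g)
    then obtain c f where g: "g = (\<lambda>x. c * f (a * x + b))" and f: "smooth f" by auto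
    show ?case
      using smooth_deriv(2)[OF f]
      by (intro exI[of _ g] exI[of _ "\<lambda>x. (c * a) * deriv f (a * x + b)"])
         (auto simp: g intro!: derivative_eq_intros DERIV_chain2[OF smooth_deriv(1)[OF f]])
  qed
  then show "smooth f \<Longrightarrow> smooth (\<lambda>x. c * f (a * x + b))" by blast
qed

text \<open>The derivative of a product is no longer a single product, but finite sums of products
  are closed under differentiation by the Leibniz rule; they form the coinduction invariant for
  \<open>smooth_mult\<close> and \<open>smooth_add\<close>.\<close>

inductive smooth_products :: "(real \<Rightarrow> real) \<Rightarrow> bool" where
  base: "smooth f \<Longrightarrow> smooth g \<Longrightarrow> smooth_products (\<lambda>x. f x * g x)"
| add: "smooth_products f \<Longrightarrow> smooth_products g \<Longrightarrow> smooth_products (\<lambda>x. f x + g x)"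

lemma smooth_products_imp_smooth: "smooth_products f \<Longrightarrow> smooth f"
proof (coinduction arbitrary: f rule: smooth.coinduct)
  case smooth
  have "\<exists>f'. (\<forall>x. (f has_real_derivative f' x) (at x)) \<and> smooth_products f'"
    using smooth
  proof induction
    case (base f g)
    then have "smooth_products (\<lambda>x. deriv f x * g x + f x * deriv g x)"
      by (intro smooth_products.intros smooth_deriv(2))
    moreover have "((\<lambda>x. f x * g x) has_real_derivative (deriv f x * g x + f x * deriv g x)) (at x)" for x
      using smooth_deriv(1)[OF base(1), of x] smooth_deriv(1)[OF base(2), of x]
      by (auto intro!: derivative_eq_intros)
    ultimately show ?case by (intro exI[of _ "\<lambda>x. deriv f x * g x + f x * deriv g x"]) blast
  next
    case (add f g)
    then obtain f' g' where "\<forall>x. (f has_real_derivative f' x) (at x)" "smooth_products f'"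
      "\<forall>x. (g has_real_derivative g' x) (at x)" "smooth_products g'" by auto
    then show ?case
      by (intro exI[of _ "\<lambda>x. f' x + g' x"]) (auto intro!: smooth_products.intros derivative_eq_intros)
  qed
  then show ?case by blast
qed

lemma smooth_mult: "smooth f \<Longrightarrow> smooth g \<Longrightarrow> smooth (\<lambda>x. f x * g x)"
  by (rule smooth_products_imp_smooth[OF smooth_products.base])

lemma smooth_add: "smooth f \<Longrightarrow> smooth g \<Longrightarrow> smooth (\<lambda>x. f x + g x)"
proof -
  assume "smooth f" "smooth g"
  \<comment> \<open>A sum is the degenerate case in which every product has the constant factor
    1.\<close>
  then have "smooth_products (\<lambda>x. f x * 1 + g x * 1)"
    by (intro smooth_products.intros smooth_const)
  then show ?thesis using smooth_products_imp_smooth by simp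
qed

lemma smooth_diff: "smooth f \<Longrightarrow> smooth g \<Longrightarrow> smooth (\<lambda>x. f x - g x)"
  using smooth_add[of f "\<lambda>x. (-1) * g (1 * x + 0)"] smooth_affine[of g "-1" 1 0] by simp

section \<open>A flat function and a smooth step\<close>

definition flat_exp :: "nat \<Rightarrow> real \<Rightarrow> real" where
  "flat_exp k x = (if x > 0 then exp (- 1 / x) / x ^ k else 0)"

text \<open>Only the term of index \<open>k + 2\<close> of the series of \<open>exp (1/x)\<close> is
  kept, and \<open>exp (1/x)\<close> is at least that term. The quadratic bound is what makes the
  difference quotient at 0 vanish.\<close>

lemma flat_exp_bound: "\<bar>flat_exp k x\<bar> \<le> fact (k + 2) * x\<^sup>2"
proof (cases "x > 0")
  case True
  have "(\<Sum>i\<in>{k+2}. (1/x) ^ i /\<^sub>R fact i) \<le> exp (1/x)"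
    unfolding exp_def by (intro sum_le_suminf summable_exp_generic) (use True in auto)
  then have "(1/x) ^ (k+2) / fact (k+2) \<le> exp (1/x)" by (simp add: divide_inverse mult.commute)
  then have "1 / (fact (k+2) * x ^ (k+2)) \<le> exp (1/x)"
    by (simp add: power_divide mult.commute del: power_Suc fact_Suc add_2_eq_Suc')
  then have "1 \<le> exp (1/x) * (fact (k+2) * x ^ (k+2))"
    using True by (subst (asm) pos_divide_le_eq) auto
  then have "exp (- 1/x) \<le> exp (-1/x) * (exp (1/x) * (fact (k+2) * x ^ (k+2)))" by simp
  also have "\<dots> = (exp (-1/x) * exp (1/x)) * (fact (k+2) * x ^ (k+2))" by (simp only: mult.assoc)
  also have "exp (-1/x) * exp (1/x) = 1" by (simp flip: exp_add)
  finally show ?thesis using True by (simp add: flat_exp_def field_simps power_add power2_eq_square)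
qed (auto simp: flat_exp_def)

text \<open>Differentiation raises the exponent by 2 through the exponential and by 1 through the
  power, so the family stays within its own linear combinations. At 0 the quadratic bound of
  \<open>flat_exp_bound\<close> gives the derivative 0.\<close>

lemma has_real_derivative_flat_exp:
  "(flat_exp k has_real_derivative flat_exp (k + 2) x - k * flat_exp (k + 1) x) (at x)"
proof -
  consider "x > 0" | "x < 0" | "x = 0" by linarith
  then show ?thesis
  proof cases
    case 1
    have "x ^ k \<noteq> 0" using 1 by simp
    have "((\<lambda>x. exp (- 1 / x) / x ^ k) has_real_derivative
        ((exp (- 1 / x) * (1 / x\<^sup>2)) * x ^ k - exp (- 1 / x) * (k * x ^ (k - 1))) / (x ^ k * x ^ k)) (at x)"
      using 1 by (intro DERIV_divide \<open>x ^ k \<noteq> 0\<close>) (auto intro!: derivative_eq_intros simp: power2_eq_square)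
    moreover have "((exp (- 1 / x) * (1 / x\<^sup>2)) * x ^ k - exp (- 1 / x) * (k * x ^ (k - 1))) / (x ^ k * x ^ k)
        = flat_exp (k + 2) x - k * flat_exp (k + 1) x"
    \<comment> \<open>The exponent \<open>k - 1\<close> is truncated at \<open>k = 0\<close>, hence
      the case distinction.\<close>
    proof (cases k)
      case (Suc m)
      have "x ^ m \<noteq> 0" "x \<noteq> 0" using 1 by auto
      then show ?thesis
        using 1 unfolding flat_exp_def Suc by (simp add: field_simps power2_eq_square)
    qed (use 1 in \<open>auto simp: flat_exp_def field_simps power2_eq_square\<close>)
    ultimately have "((\<lambda>x. exp (- 1 / x) / x ^ k) has_real_derivative
        flat_exp (k + 2) x - k * flat_exp (k + 1) x) (at x)" by simp
    then show ?thesis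
      by (rule has_field_derivative_transform_within_open[where S="{0<..}"])
         (use 1 in \<open>auto simp: flat_exp_def\<close>)
  next
    case 2
    have "((\<lambda>x. 0) has_real_derivative flat_exp (k + 2) x - k * flat_exp (k + 1) x) (at x)"
      using 2 by (auto simp: flat_exp_def)
    then show ?thesis
      by (rule has_field_derivative_transform_within_open[where S="{..<0}"])
         (use 2 in \<open>auto simp: flat_exp_def\<close>)
  next
    case 3
    have "((\<lambda>h. flat_exp k h / h) \<longlongrightarrow> 0) (at 0)"
    proof (rule Lim_null_comparison)
      have "norm (flat_exp k h / h) \<le> fact (k+2) * \<bar>h\<bar>" if "h \<noteq> 0" for h
        using flat_exp_bound[of k h] that
        by (simp add: abs_divide divide_le_eq power2_eq_square mult.assoc flip: abs_mult)
      then show "\<forall>\<^sub>F h in at 0. norm (flat_exp k h / h) \<le> fact (k+2) * \<bar>h\<bar>"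
        by (auto simp: eventually_at_filter)
      show "((\<lambda>h. fact (k+2) * \<bar>h::real\<bar>) \<longlongrightarrow> 0) (at 0)"
        by (rule tendsto_eq_intros tendsto_rabs_zero refl | simp)+
    qed
    moreover have "flat_exp j 0 = 0" for j by (simp add: flat_exp_def)
    ultimately show ?thesis by (simp add: 3 DERIV_def)
  qed
qed

text \<open>The coinduction invariant for smoothness of each \<open>flat_exp k\<close>.\<close>

inductive flat_exp_span :: "(real \<Rightarrow> real) \<Rightarrow> bool" where
  base: "flat_exp_span (\<lambda>x. c * flat_exp k x)"
| add: "flat_exp_span f \<Longrightarrow> flat_exp_span g \<Longrightarrow> flat_exp_span (\<lambda>x. f x + g x)"

lemma flat_exp_span_imp_smooth: "flat_exp_span f \<Longrightarrow> smooth f"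
proof (coinduction arbitrary: f rule: smooth.coinduct)
  case smooth
  have "\<exists>f'. (\<forall>x. (f has_real_derivative f' x) (at x)) \<and> flat_exp_span f'"
    using smooth
  proof induction
    case (base c k)
    have "flat_exp_span (\<lambda>x. c * flat_exp (k+2) x + (- c * k) * flat_exp (k+1) x)"
      by (intro flat_exp_span.intros)
    moreover have "((\<lambda>x. c * flat_exp k x) has_real_derivative
        c * flat_exp (k+2) x + (- c * k) * flat_exp (k+1) x) (at x)" for x
      by (rule DERIV_cong[OF DERIV_cmult[OF has_real_derivative_flat_exp]]) (simp add: algebra_simps)
    ultimately show ?case
      by (intro exI[of _ "\<lambda>x. c * flat_exp (k+2) x + (- c * k) * flat_exp (k+1) x"]) blast
  next
    case (add f g)
    then obtain f' g' where "\<forall>x. (f has_real_derivative f' x) (at x)" "flat_exp_span f'"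
      "\<forall>x. (g has_real_derivative g' x) (at x)" "flat_exp_span g'" by auto
    then show ?case
      by (intro exI[of _ "\<lambda>x. f' x + g' x"]) (auto intro!: flat_exp_span.intros derivative_eq_intros)
  qed
  then show ?case by blast
qed

lemma smooth_flat_exp: "smooth (flat_exp k)"
  using flat_exp_span_imp_smooth[OF flat_exp_span.base[of 1 k]] by simp

text \<open>The step is the normalized antiderivative of the bump
  \<open>flat_exp 0 x * flat_exp 0 (1 - x)\<close>. Its derivative is nonnegative, so the ramps of
  the cutoffs built from it act as mollifiers.\<close>

lemma ex_smooth_step:
  "\<exists>\<theta> :: real \<Rightarrow> real. smooth \<theta> \<and> (\<forall>x\<le>0. \<theta> x = 0) \<and> (\<forall>x\<ge>1. \<theta> x = 1) \<and>
     (\<forall>x. 0 \<le> \<theta> x \<and> \<theta> x \<le> 1) \<and> (\<forall>x. 0 \<le> deriv \<theta> x)"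
proof -
  define \<beta> where "\<beta> x = flat_exp 0 x * flat_exp 0 (1 - x)" for x
  have "smooth (\<lambda>x. 1 * flat_exp 0 (-1 * x + 1))"
    by (intro smooth_affine smooth_flat_exp)
  then have "smooth \<beta>"
    unfolding \<beta>_def by (intro smooth_mult smooth_flat_exp) simp
  have \<beta>0: "\<beta> x = 0" if "x \<le> 0 \<or> x \<ge> 1" for x
    using that by (auto simp: \<beta>_def flat_exp_def)
  have \<beta>_pos: "\<beta> x > 0" if "0 < x" "x < 1" for x
    using that by (auto simp: \<beta>_def flat_exp_def)
  have \<beta>_nonneg: "\<beta> x \<ge> 0" for x
    using \<beta>0 \<beta>_pos by (metis linorder_not_less order.refl order.strict_implies_order)
  note cont = smooth_imp_continuous_on[OF \<open>smooth \<beta>\<close>]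
  \<comment> \<open>The lower limit -1 lies to the left of the support of \<beta>, so that 0 is an
    interior point for the fundamental theorem; at points up to -1 the function is locally
    0.\<close>
  define B where "B x = integral {-1..x} \<beta>" for x
  have DB: "(B has_real_derivative \<beta> x) (at x)" for x
  proof (cases "x > -1")
    case True
    have "(B has_real_derivative \<beta> x) (at x within {-1..x+1})"
      unfolding B_def by (rule integral_has_real_derivative[OF cont]) (use True in auto)
    then show ?thesis
      using True by (subst (asm) at_within_interior) auto
  next
    case False
    have "B y = 0" if "y < 0" for y
      unfolding B_def using that \<beta>0 by (intro integral_unique has_integral_is_0) auto
    then show ?thesis
      using False \<beta>0 by (auto intro!: has_field_derivative_transform_within_open[of "\<lambda>x. 0" 0 x "{..<0}" B])
  qed
  have B_mono: "B x \<le> B y" if "x \<le> y" for x y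
    using DERIV_nonneg_imp_nondecreasing[OF that] DB \<beta>_nonneg by blast
  have B0: "B x = 0" if "x \<le> 0" for x
    unfolding B_def using that \<beta>0 by (intro integral_unique has_integral_is_0) auto
  have B1: "B x = B 1" if "x \<ge> 1" for x
  proof -
    have "B x = B 1 + integral {1..x} \<beta>"
      unfolding B_def using that
      by (intro Henstock_Kurzweil_Integration.integral_combine[symmetric] integrable_continuous_real cont) auto
    also have "integral {1..x} \<beta> = 0" using \<beta>0 by (intro integral_unique has_integral_is_0) auto
    finally show ?thesis by simp
  qed
  have "B 0 < B 1"
  proof (rule DERIV_pos_imp_increasing_open[where f=B and a=0 and b=1])
    show "continuous_on {0..1} B"
      by (intro continuous_at_imp_continuous_on ballI DERIV_isCont[OF DB])
  qed (use DB \<beta>_pos in auto)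
  then have pos: "B 1 > 0" using B0 by simp
  define \<theta> where "\<theta> x = B x / B 1" for x
  have D\<theta>: "(\<theta> has_real_derivative (1 / B 1) * \<beta> (1 * x + 0)) (at x)" for x
    unfolding \<theta>_def using DB[of x] pos by (auto intro!: derivative_eq_intros)
  have "smooth \<theta>"
    by (rule smoothI[OF D\<theta>]) (rule smooth_affine[OF \<open>smooth \<beta>\<close>])
  moreover have "deriv \<theta> x \<ge> 0" for x
    using DERIV_imp_deriv[OF D\<theta>, of x] \<beta>_nonneg[of x] pos by simp
  moreover have "0 \<le> \<theta> x \<and> \<theta> x \<le> 1" for x
  proof -
    have "0 \<le> B x" using B_mono[of "min 0 x" x] B0[of "min 0 x"] by simp
    moreover have "B x \<le> B 1" using B_mono[of x "max 1 x"] B1[of "max 1 x"] by simp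
    ultimately show ?thesis using pos by (simp add: \<theta>_def)
  qed
  moreover have "\<theta> x = 0" if "x \<le> 0" for x using B0[OF that] by (simp add: \<theta>_def)
  moreover have "\<theta> x = 1" if "x \<ge> 1" for x using B1[OF that] pos by (simp add: \<theta>_def)
  ultimately show ?thesis by blast
qed

section \<open>Bochner integrals without second countability\<close>

text \<open>The dual of \<open>V\<close> carries no second countability as a type, so measurability
  of a function of two measurable maps cannot be read off from pairs. If one of the maps is simple,
  the space splits into finitely many pieces on which its value is a constant
  \<open>c\<close>.\<close>

lemma borel_measurable_simple_combine:
  assumes "simple_function M s" "\<And>c. (\<lambda>x. g c (f x)) \<in> borel_measurable M"
  shows "(\<lambda>x. g (s x) (f x)) \<in> borel_measurable M"
proof -
  have "s \<in> measurable M (count_space (s ` space M))"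
    using assms(1) by (auto simp: measurable_count_space_eq2 simple_function_def)
  moreover have "countable (s ` space M)"
    using assms(1) by (auto simp: simple_function_def countable_finite)
  ultimately show ?thesis
    by (rule measurable_compose_countable'[where f="\<lambda>c x. g c (f x)", OF assms(2)])
qed

lemma borel_measurable_norm_diff_simple:
  fixes f :: "'a \<Rightarrow> 'b::real_normed_vector"
  assumes "f \<in> borel_measurable M" "simple_function M s"
  shows "(\<lambda>x. ennreal (norm (f x - s x))) \<in> borel_measurable M"
proof -
  have "(\<lambda>x. norm (f x - s x)) \<in> borel_measurable M"
    by (rule borel_measurable_simple_combine[OF assms(2), where g="\<lambda>c y. norm (y - c)"])
       (intro measurable_compose[OF assms(1)] borel_measurable_continuous_onI continuous_intros)
  then show ?thesis by simp
qed

text \<open>The scalar factor is real valued and hence a pointwise limit of simple functions;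
  products with these are covered by \<open>borel_measurable_simple_combine\<close>.\<close>

lemma borel_measurable_scaleR':
  fixes f :: "'a \<Rightarrow> 'b::real_normed_vector" and g :: "'a \<Rightarrow> real"
  assumes "g \<in> borel_measurable M" "f \<in> borel_measurable M"
  shows "(\<lambda>x. g x *\<^sub>R f x) \<in> borel_measurable M"
proof -
  obtain s where s: "\<And>i. simple_function M (s i)" "\<And>x. x \<in> space M \<Longrightarrow> (\<lambda>i. s i x) \<longlonglongrightarrow> g x"
    using borel_measurable_implies_sequence_metric[OF assms(1), of 0] by metis
  show ?thesis
  proof (rule borel_measurable_LIMSEQ_metric)
    show "(\<lambda>x. s i x *\<^sub>R f x) \<in> borel_measurable M" for i
      by (rule borel_measurable_simple_combine[OF s(1), where g="\<lambda>c y. c *\<^sub>R y"])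
         (intro measurable_compose[OF assms(2)] borel_measurable_continuous_onI continuous_intros)
    show "(\<lambda>i. s i x *\<^sub>R f x) \<longlonglongrightarrow> g x *\<^sub>R f x" if "x \<in> space M" for x
      by (intro tendsto_intros s(2) that)
  qed
qed

lemma simple_bochner_integrableD:
  "Bochner_Integration.simple_bochner_integrable M s \<Longrightarrow> simple_function M s"
  by (auto elim: Bochner_Integration.simple_bochner_integrable.cases)

lemma has_bochner_int_iff_has_bochner_integral:
  fixes f :: "'a \<Rightarrow> 'b::{real_normed_vector, second_countable_topology}"
  shows "has_bochner_int M f I \<longleftrightarrow> has_bochner_integral M f I"
  unfolding has_bochner_int_def by (auto simp: has_bochner_integral.simps)

text \<open>The images of the approximating simple functions approximate the image of
  \<open>f\<close>, with errors enlarged by a bound of the operator. Its main use is to evaluate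
  integrals in the dual at a vector of \<open>V\<close>, which turns them into real
  integrals.\<close>

lemma has_bochner_int_bounded_linear:
  fixes T :: "'b::real_normed_vector \<Rightarrow> 'c::real_normed_vector"
  assumes T: "bounded_linear T" and f: "has_bochner_int M f I"
  shows "has_bochner_int M (\<lambda>x. T (f x)) (T I)"
proof -
  interpret T: bounded_linear T by fact
  from f obtain s where meas: "f \<in> borel_measurable M"
    and s: "\<And>i. Bochner_Integration.simple_bochner_integrable M (s i)"
    and f_s: "(\<lambda>i. \<integral>\<^sup>+x. ennreal (norm (f x - s i x)) \<partial>M) \<longlonglongrightarrow> 0"
    and lim: "(\<lambda>i. Bochner_Integration.simple_bochner_integral M (s i)) \<longlonglongrightarrow> I"
    unfolding has_bochner_int_def by auto
  obtain K where K: "K > 0" "\<And>x i. norm (T (f x) - T (s i x)) \<le> norm (f x - s i x) * K"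
    using T.pos_bounded by (auto simp: T.diff[symmetric])
  have bound: "(\<integral>\<^sup>+x. ennreal (norm (T (f x) - T (s i x))) \<partial>M)
      \<le> ennreal K * (\<integral>\<^sup>+x. ennreal (norm (f x - s i x)) \<partial>M)" for i
  proof -
    have "(\<integral>\<^sup>+x. ennreal (norm (T (f x) - T (s i x))) \<partial>M)
        \<le> (\<integral>\<^sup>+x. ennreal K * ennreal (norm (f x - s i x)) \<partial>M)"
      using K by (intro nn_integral_mono) (auto simp: ac_simps ennreal_mult[symmetric])
    also have "\<dots> = ennreal K * (\<integral>\<^sup>+x. ennreal (norm (f x - s i x)) \<partial>M)"
      by (intro nn_integral_cmult borel_measurable_norm_diff_simple meas simple_bochner_integrableD s)
    finally show ?thesis .
  qed
  show ?thesis
    unfolding has_bochner_int_def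
  proof (intro conjI exI[of _ "\<lambda>i x. T (s i x)"] allI)
    show "(\<lambda>x. T (f x)) \<in> borel_measurable M"
      by (intro measurable_compose[OF meas] borel_measurable_continuous_onI T.continuous_on continuous_on_id)
    show "Bochner_Integration.simple_bochner_integrable M (\<lambda>x. T (s i x))" for i
      by (rule Bochner_Integration.simple_bochner_integrable_compose2[where p="\<lambda>x y. T x", OF _ s s]) (rule T.zero)
    show "(\<lambda>i. \<integral>\<^sup>+x. ennreal (norm (T (f x) - T (s i x))) \<partial>M) \<longlonglongrightarrow> 0"
    proof (rule tendsto_sandwich[OF _ _ tendsto_const])
      show "(\<lambda>i. ennreal K * (\<integral>\<^sup>+x. ennreal (norm (f x - s i x)) \<partial>M)) \<longlonglongrightarrow> 0"
        using ennreal_tendsto_cmult[OF _ f_s] by simp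
    qed (use bound in auto)
    show "(\<lambda>i. Bochner_Integration.simple_bochner_integral M (\<lambda>x. T (s i x))) \<longlonglongrightarrow> T I"
      using T.tendsto[OF lim] by (simp add: Bochner_Integration.simple_bochner_integral_linear[OF T.linear_axioms s])
  qed
qed

text \<open>The triangle inequality through \<open>f\<close>: two simple functions that are close to
  \<open>f\<close> in L1 have close integrals, and nothing about an integral of \<open>f\<close>
  itself is presupposed.\<close>

lemma simple_bochner_integral_diff_bound:
  fixes f :: "'a \<Rightarrow> 'b::real_normed_vector"
  assumes f: "f \<in> borel_measurable M"
  assumes s: "Bochner_Integration.simple_bochner_integrable M s"
    and t: "Bochner_Integration.simple_bochner_integrable M t"
  shows "ennreal (norm (Bochner_Integration.simple_bochner_integral M s - Bochner_Integration.simple_bochner_integral M t)) \<le>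
    (\<integral>\<^sup>+ x. ennreal (norm (f x - s x)) \<partial>M) + (\<integral>\<^sup>+ x. ennreal (norm (f x - t x)) \<partial>M)"
    (is "ennreal (norm (?s - ?t)) \<le> ?S + ?T")
proof -
  have "ennreal (norm (?s - ?t)) = norm (Bochner_Integration.simple_bochner_integral M (\<lambda>x. s x - t x))"
    using s t by (subst Bochner_Integration.simple_bochner_integral_diff) auto
  also have "\<dots> \<le> Bochner_Integration.simple_bochner_integral M (\<lambda>x. norm (s x - t x))"
    using Bochner_Integration.simple_bochner_integrable_compose2[of "(-)" M "s" "t"] s t
    by (auto intro!: Bochner_Integration.simple_bochner_integral_norm_bound)
  also have "\<dots> = (\<integral>\<^sup>+x. norm (s x - t x) \<partial>M)"
    using Bochner_Integration.simple_bochner_integrable_compose2[of "\<lambda>x y. norm (x - y)" M "s" "t"] s t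
    by (auto intro!: Bochner_Integration.simple_bochner_integral_eq_nn_integral)
  also have "\<dots> \<le> (\<integral>\<^sup>+x. ennreal (norm (f x - s x)) + ennreal (norm (f x - t x)) \<partial>M)"
  proof (rule nn_integral_mono)
    fix x
    have "norm (s x - t x) \<le> norm (f x - s x) + norm (f x - t x)"
      using norm_triangle_ineq4[of "f x - t x" "f x - s x"] by simp
    then show "ennreal (norm (s x - t x)) \<le> ennreal (norm (f x - s x)) + ennreal (norm (f x - t x))"
      by (metis ennreal_leI ennreal_plus norm_ge_zero)
  qed
  also have "\<dots> = ?S + ?T"
   by (intro nn_integral_add borel_measurable_norm_diff_simple f simple_bochner_integrableD s t)
  finally show ?thesis .
qed

text \<open>Approximants with error \<open>1 / Suc i\<close> have Cauchy integrals by
  \<open>simple_bochner_integral_diff_bound\<close>, and completeness supplies the value. The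
  approximation is a hypothesis because in a space that need not be separable integrability of the
  norm does not yield it.\<close>

lemma has_bochner_int_exists:
  fixes f :: "'a \<Rightarrow> 'b::banach"
  assumes f: "f \<in> borel_measurable M"
    and approx: "\<And>e. e > 0 \<Longrightarrow> \<exists>s. Bochner_Integration.simple_bochner_integrable M s \<and>
                   (\<integral>\<^sup>+x. ennreal (norm (f x - s x)) \<partial>M) \<le> ennreal e"
  shows "\<exists>I. has_bochner_int M f I"
proof -
  have "\<exists>s. \<forall>i. Bochner_Integration.simple_bochner_integrable M (s i) \<and>
          (\<integral>\<^sup>+x. ennreal (norm (f x - s i x)) \<partial>M) \<le> ennreal (1 / Suc i)"
    by (intro choice allI approx) simp
  then obtain s where s: "\<And>i. Bochner_Integration.simple_bochner_integrable M (s i)"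
    and le: "\<And>i. (\<integral>\<^sup>+x. ennreal (norm (f x - s i x)) \<partial>M) \<le> ennreal (1 / Suc i)" by auto
  let ?I = "\<lambda>i. Bochner_Integration.simple_bochner_integral M (s i)"
  have "ennreal (norm (?I i - ?I j)) \<le> ennreal (1 / Suc i) + ennreal (1 / Suc j)" for i j
    using simple_bochner_integral_diff_bound[OF f s s, of i j] le by (meson add_mono order_trans)
  then have norm_le: "norm (?I i - ?I j) \<le> 1 / Suc i + 1 / Suc j" for i j
    by (metis (no_types, lifting) add_nonneg_nonneg divide_nonneg_nonneg ennreal_le_iff ennreal_plus
        of_nat_0_le_iff zero_le_one)
  have "Cauchy ?I"
  proof (rule metric_CauchyI)
    fix e :: real assume "e > 0"
    then obtain N where N: "1 / Suc N < e / 2"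
      using nat_approx_posE half_gt_zero by metis
    have "1 / real (Suc i) \<le> 1 / Suc N" if "i \<ge> N" for i
      using that by (simp add: frac_le)
    then show "\<exists>N. \<forall>m\<ge>N. \<forall>n\<ge>N. dist (?I m) (?I n) < e"
      using N norm_le by (intro exI[of _ N]) (smt (verit, best) dist_norm field_sum_of_halves)
  qed
  then obtain I where I: "?I \<longlonglongrightarrow> I" by (metis Cauchy_convergent_iff convergent_def)
  have "(\<lambda>i. \<integral>\<^sup>+x. ennreal (norm (f x - s i x)) \<partial>M) \<longlonglongrightarrow> 0"
  proof (rule tendsto_sandwich[OF _ _ tendsto_const])
    have "(\<lambda>i. ennreal (1 / Suc i)) \<longlonglongrightarrow> ennreal 0"
      by (intro tendsto_ennrealI LIMSEQ_Suc lim_1_over_n)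
    then show "(\<lambda>i. ennreal (1 / Suc i)) \<longlonglongrightarrow> 0" by simp
  qed (use le in auto)
  with f s I show ?thesis unfolding has_bochner_int_def by blast
qed

section \<open>Integration by parts for generalized derivatives\<close>

lemma integrable_lebesgue_on_iff:
  fixes f :: "real \<Rightarrow> real"
  assumes "S \<in> sets lebesgue"
  shows "integrable (lebesgue_on S) f \<longleftrightarrow> f absolutely_integrable_on S"
  using assms by (simp add: set_integrable_def integrable_restrict_space)

lemma absolutely_integrable_on_Ioo_iff:
  fixes f :: "real \<Rightarrow> real"
  shows "f absolutely_integrable_on {a<..<b} \<longleftrightarrow> f absolutely_integrable_on {a..b}"
  using absolutely_integrable_on_open_interval[where f=f and a=a and b=b] by simp

lemma absolutely_integrable_continuous_mult:
  fixes f g :: "real \<Rightarrow> real"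
  assumes "continuous_on {a..b} g" "f absolutely_integrable_on {a..b}"
  shows "(\<lambda>x. g x * f x) absolutely_integrable_on {a..b}"
proof -
  have "bounded (g ` {a..b})"
    by (intro compact_imp_bounded compact_continuous_image assms(1)) auto
  moreover have "g \<in> borel_measurable (lebesgue_on {a..b})"
    by (intro continuous_imp_measurable_on_sets_lebesgue assms(1)) auto
  ultimately show ?thesis
    by (intro absolutely_integrable_bounded_measurable_product_real assms(2)) auto
qed

text \<open>A nonnegative kernel of mass 1 that concentrates at \<open>c\<close> averages
  \<open>g\<close> to \<open>g c\<close>. The point may be an end of the interval, since one-sided
  kernels are the ones that occur, and the mass is 1 once the ramp fits into the interval.\<close>

lemma mollifier_tendsto:
  fixes g :: "real \<Rightarrow> real" and \<kappa> :: "nat \<Rightarrow> real \<Rightarrow> real"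
  assumes g: "continuous_on {s..t} g" and c: "c \<in> {s..t}"
    and \<kappa>: "\<And>n. continuous_on {s..t} (\<kappa> n)" "\<And>n r. \<kappa> n r \<ge> 0"
    and int1: "\<forall>\<^sub>F n in sequentially. integral {s..t} (\<kappa> n) = 1"
    and supp: "\<And>d. d > 0 \<Longrightarrow> \<forall>\<^sub>F n in sequentially. \<forall>r\<in>{s..t}. \<bar>r - c\<bar> \<ge> d \<longrightarrow> \<kappa> n r = 0"
  shows "(\<lambda>n. integral {s..t} (\<lambda>r. \<kappa> n r * g r)) \<longlonglongrightarrow> g c"
proof (rule LIMSEQ_I)
  fix e :: real assume "e > 0"
  then obtain d where "d > 0" and d: "\<And>r. r \<in> {s..t} \<Longrightarrow> \<bar>r - c\<bar> < d \<Longrightarrow> \<bar>g r - g c\<bar> < e / 2"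
    using g c unfolding continuous_on_iff dist_real_def by (metis half_gt_zero)
  have "\<forall>\<^sub>F n in sequentially. norm (integral {s..t} (\<lambda>r. \<kappa> n r * g r) - g c) < e"
    using int1 supp[OF \<open>d > 0\<close>]
  proof eventually_elim
    case (elim n)
    have i1: "(\<lambda>r. \<kappa> n r * g r) integrable_on {s..t}" "\<kappa> n integrable_on {s..t}"
      by (intro integrable_continuous_real continuous_intros g \<kappa>)+
    have "integral {s..t} (\<lambda>r. \<kappa> n r * g r) - g c = integral {s..t} (\<lambda>r. \<kappa> n r * g r) - integral {s..t} (\<lambda>r. \<kappa> n r * g c)"
      using elim(1) by simp
    also have "\<dots> = integral {s..t} (\<lambda>r. \<kappa> n r * g r - \<kappa> n r * g c)"
      using i1 by (intro integral_diff[symmetric] integrable_on_mult_left) auto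
    also have "norm \<dots> \<le> integral {s..t} (\<lambda>r. \<kappa> n r * (e/2))"
    proof (rule integral_norm_bound_integral)
      show "(\<lambda>r. \<kappa> n r * g r - \<kappa> n r * g c) integrable_on {s..t}" "(\<lambda>r. \<kappa> n r * (e/2)) integrable_on {s..t}"
        by (intro integrable_continuous_real continuous_intros g \<kappa>)+
      fix r assume r: "r \<in> {s..t}"
      show "norm (\<kappa> n r * g r - \<kappa> n r * g c) \<le> \<kappa> n r * (e/2)"
      proof (cases "\<bar>r - c\<bar> < d")
        case True
        then show ?thesis
          using mult_left_mono[OF less_imp_le[OF d[OF r]] \<kappa>(2)[of n r]] \<kappa>(2)[of n r]
          by (simp add: abs_mult flip: right_diff_distrib)
      next
        case False
        then show ?thesis using elim(2) r by auto
      qed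
    qed
    also have "\<dots> = e / 2" using elim(1) by simp
    finally show ?case using \<open>e > 0\<close> by simp
  qed
  then show "\<exists>no. \<forall>n\<ge>no. norm (integral {s..t} (\<lambda>r. \<kappa> n r * g r) - g c) < e"
    by (simp add: eventually_sequentially)
qed

section \<open>Test functions and smooth cutoffs of an interval\<close>

lemma test_functionsI:
  assumes "smooth \<phi>" "a < c" "c \<le> d" "d < b" "\<And>t. t \<notin> {c..d} \<Longrightarrow> \<phi> t = 0"
  shows "\<phi> \<in> test_functions a b"
  unfolding test_functions_def
  using assms by (auto intro: smooth_imp_differentiable_on smooth_funpow_deriv)

text \<open>The coinduction invariant is the set of all iterated derivatives of \<phi>.\<close>

lemma smooth_test_functions:
  assumes "\<phi> \<in> test_functions a b"
  shows "smooth \<phi>"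
proof -
  have *: "(deriv ^^ n) \<phi> differentiable_on UNIV" for n
    using assms by (auto simp: test_functions_def)
  have "\<exists>n. f = (deriv ^^ n) \<phi> \<Longrightarrow> smooth f" for f
  proof (coinduction arbitrary: f rule: smooth.coinduct)
    case (smooth f)
    then obtain n where f: "f = (deriv ^^ n) \<phi>" by auto
    have "(f has_real_derivative deriv f x) (at x)" for x
      using *[of n] unfolding f differentiable_on_def
      by (metis DERIV_imp_deriv UNIV_I real_differentiable_def)
    moreover have "deriv f = (deriv ^^ Suc n) \<phi>" by (simp add: f)
    ultimately show ?case by blast
  qed
  from this[of \<phi>] show ?thesis by (metis funpow_0)
qed

text \<open>For large \<open>n\<close> a smoothed indicator of [s,t]. The offsets make it rise
  between \<open>s + 1 / n\<close> and \<open>s + 2 / n\<close> and fall between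
  \<open>t - 2 / n\<close> and \<open>t - 1 / n\<close>, so that products with it have compact
  support in the open interval.\<close>

definition cutoff :: "(real \<Rightarrow> real) \<Rightarrow> real \<Rightarrow> real \<Rightarrow> nat \<Rightarrow> real \<Rightarrow> real" where
  "cutoff \<theta> s t n r = \<theta> (n * (r - s) - 1) - \<theta> (n * (r - t) + 2)"

context
  fixes \<theta> :: "real \<Rightarrow> real"
  assumes \<theta>: "smooth \<theta>" "\<And>x. x \<le> 0 \<Longrightarrow> \<theta> x = 0" "\<And>x. x \<ge> 1 \<Longrightarrow> \<theta> x = 1"
    "\<And>x. 0 \<le> \<theta> x" "\<And>x. \<theta> x \<le> 1" "\<And>x. 0 \<le> deriv \<theta> x"
begin

lemma smooth_cutoff: "smooth (cutoff \<theta> s t n)"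
proof -
  have "smooth (\<lambda>r. 1 * \<theta> (n * r + (- n * s - 1)) - 1 * \<theta> (n * r + (- n * t + 2)))"
    by (intro smooth_diff smooth_affine \<theta>)
  then show ?thesis unfolding cutoff_def[abs_def] by (simp add: algebra_simps)
qed

text \<open>The bound concerns the absolute value because for small \<open>n\<close> the ramps come
  in the wrong order and the cutoff can be negative.\<close>

lemma abs_cutoff_le: "\<bar>cutoff \<theta> s t n r\<bar> \<le> 1"
  unfolding cutoff_def using \<theta>(4,5)[of "n * (r - s) - 1"] \<theta>(4,5)[of "n * (r - t) + 2"] by linarith

lemma cutoff_tendsto:
  assumes "s < r" "r < t"
  shows "(\<lambda>n. cutoff \<theta> s t n r) \<longlonglongrightarrow> 1"
proof (rule tendsto_eventually)
  have "\<forall>\<^sub>F n in sequentially. n * (r - s) \<ge> 2" "\<forall>\<^sub>F n in sequentially. n * (t - r) \<ge> 2"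
    using assms by real_asymp+
  then show "\<forall>\<^sub>F n in sequentially. cutoff \<theta> s t n r = 1"
  proof eventually_elim
    case (elim n)
    then have "\<theta> (n * (r - s) - 1) = 1" "\<theta> (n * (r - t) + 2) = 0"
      by (intro \<theta>, simp add: algebra_simps)+
    then show ?case by (simp add: cutoff_def)
  qed
qed

text \<open>\<open>n * (t - s) \<ge> 4\<close> puts the rising ramp to the left of the falling one,
  so outside the given interval the two terms are both 0 or both 1.\<close>

lemma cutoff_eq_0:
  assumes "n * (t - s) \<ge> 4" "r \<notin> {s + 1 / n..t - 1 / n}"
  shows "cutoff \<theta> s t n r = 0"
proof -
  have n: "n > 0" using assms(1) by (cases n) auto
  consider "r < s + 1 / n" | "r > t - 1 / n" using assms(2) by fastforce
  then show ?thesis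
  proof cases
    case 1
    then have "n * (r - s) \<le> 1" using n by (simp add: field_simps)
    then have "n * (r - s) - 1 \<le> 0" "n * (r - t) + 2 \<le> 0" using assms(1) by (auto simp: algebra_simps)
    then show ?thesis by (simp add: cutoff_def \<theta>)
  next
    case 2
    then have "n * (r - t) \<ge> -1" using n by (simp add: field_simps)
    then have "n * (r - s) - 1 \<ge> 1" "n * (r - t) + 2 \<ge> 1" using assms(1) by (auto simp: algebra_simps)
    then show ?thesis by (simp add: cutoff_def \<theta>)
  qed
qed

lemma affine_has_derivative:
  "((\<lambda>r. \<theta> (real n * (r - c) + k)) has_real_derivative n * deriv \<theta> (n * (r - c) + k)) (at r)"
proof -
  have "((\<lambda>r. real n * (r - c) + k) has_real_derivative n) (at r)"
    by (auto intro!: derivative_eq_intros)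
  from DERIV_chain2[OF smooth_deriv(1)[OF \<theta>(1)] this] show ?thesis by (simp add: mult.commute)
qed

lemma cutoff_has_derivative:
  "(cutoff \<theta> s t n has_real_derivative
     n * deriv \<theta> (n * (r - s) - 1) - n * deriv \<theta> (n * (r - t) + 2)) (at r)"
  using DERIV_diff[OF affine_has_derivative[of n s "-1"] affine_has_derivative[of n t 2], of r]
  by (simp add: cutoff_def[abs_def])

text \<open>Off the closed unit interval the step is locally constant; at 0 and 1 the value 0 is
  inherited from the outer side by continuity of the derivative.\<close>

lemma deriv_eq_0_outside: "x \<le> 0 \<or> x \<ge> 1 \<Longrightarrow> deriv \<theta> x = 0"
proof -
  have lt: "deriv \<theta> x = 0" if "x < 0 \<or> x > 1" for x
  proof -
    have "((\<lambda>x. if x < 0 then 0 else 1) has_real_derivative 0) (at x)"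
    proof (cases "x < 0")
      case True
      show ?thesis
        by (rule has_field_derivative_transform_within_open[of "\<lambda>x. 0" _ _ "{..<0}"]) (use True in auto)
    next
      case False
      show ?thesis
        by (rule has_field_derivative_transform_within_open[of "\<lambda>x. 1" 0 x "{0<..}"]) (use False that in auto)
    qed
    then have "(\<theta> has_real_derivative 0) (at x)"
      by (rule has_field_derivative_transform_within_open[where S="{..<0} \<union> {1<..}"]) (use that \<theta> in auto)
    then show ?thesis by (rule DERIV_imp_deriv)
  qed
  have c: "isCont (deriv \<theta>) x" for x
    using smooth_deriv(1)[OF smooth_deriv(2)[OF \<theta>(1)]] by (rule DERIV_isCont)
  have "deriv \<theta> 0 = 0"
  proof (rule tendsto_unique[of "at_left 0"])
    show "(deriv \<theta> \<longlongrightarrow> deriv \<theta> 0) (at_left 0)"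
      using c[of 0] by (simp add: isCont_def filterlim_at_split)
    have "\<forall>\<^sub>F x in at_left (0::real). x < 0" by (simp add: eventually_at_filter)
    then have "\<forall>\<^sub>F x in at_left 0. deriv \<theta> x = 0"
      by eventually_elim (use lt in auto)
    then show "(deriv \<theta> \<longlongrightarrow> 0) (at_left 0)" by (rule tendsto_eventually)
  qed auto
  moreover have "deriv \<theta> 1 = 0"
  proof (rule tendsto_unique[of "at_right 1"])
    show "(deriv \<theta> \<longlongrightarrow> deriv \<theta> 1) (at_right 1)"
      using c[of 1] by (simp add: isCont_def filterlim_at_split)
    have "\<forall>\<^sub>F x in at_right (1::real). x > 1" by (simp add: eventually_at_filter)
    then have "\<forall>\<^sub>F x in at_right 1. deriv \<theta> x = 0"
      by eventually_elim (use lt in auto)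
    then show "(deriv \<theta> \<longlongrightarrow> 0) (at_right 1)" by (rule tendsto_eventually)
  qed auto
  ultimately show "x \<le> 0 \<or> x \<ge> 1 \<Longrightarrow> deriv \<theta> x = 0"
    using lt by (metis order_le_less)
qed

text \<open>The derivatives of the two ramps are mollifiers that concentrate at \<open>s\<close>
  from the right and at \<open>t\<close> from the left. Their mass is a difference of two values of
  \<theta>, which is 1 for large \<open>n\<close>.\<close>

lemma cutoff_kernel_tendsto:
  fixes g :: "real \<Rightarrow> real"
  assumes "s < t" and g: "continuous_on {s..t} g"
  shows "(\<lambda>n. integral {s..t} (\<lambda>r. n * deriv \<theta> (n * (r - s) - 1) * g r)) \<longlonglongrightarrow> g s"
    and "(\<lambda>n. integral {s..t} (\<lambda>r. n * deriv \<theta> (n * (r - t) + 2) * g r)) \<longlonglongrightarrow> g t"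
proof -
  have c: "continuous_on A (\<lambda>r. real n * deriv \<theta> (n * (r - c) + k))" for A :: "real set" and n :: nat and c k :: real
    by (intro continuous_intros continuous_on_compose2[OF smooth_imp_continuous_on[OF smooth_deriv(2)[OF \<theta>(1)], of UNIV]]) auto
  have fund: "integral {s..t} (\<lambda>r. n * deriv \<theta> (n * (r - c) + k)) = \<theta> (n * (t - c) + k) - \<theta> (n * (s - c) + k)"
    for n :: nat and c k :: real
  proof (rule integral_unique, rule fundamental_theorem_of_calculus)
    fix r assume "r \<in> {s..t}"
    show "((\<lambda>r. \<theta> (n * (r - c) + k)) has_vector_derivative n * deriv \<theta> (n * (r - c) + k)) (at r within {s..t})"
      using affine_has_derivative
      by (simp add: has_real_derivative_iff_has_vector_derivative has_vector_derivative_at_within)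
  qed (use \<open>s < t\<close> in auto)
  have ev: "\<forall>\<^sub>F n in sequentially. real n * d \<ge> 3" if "d > 0" for d
    using that by real_asymp
  have "(\<lambda>n. integral {s..t} (\<lambda>r. (n * deriv \<theta> (n * (r - s) + (-1))) * g r)) \<longlonglongrightarrow> g s"
  proof (rule mollifier_tendsto[OF g])
    show "\<forall>\<^sub>F n in sequentially. integral {s..t} (\<lambda>r. n * deriv \<theta> (n * (r - s) + (-1))) = 1"
      using ev[of "t - s", simplified, OF \<open>s < t\<close>]
      by eventually_elim (subst fund, simp add: \<theta>(2,3))
    show "\<forall>\<^sub>F n in sequentially. \<forall>r\<in>{s..t}. d \<le> \<bar>r - s\<bar> \<longrightarrow> n * deriv \<theta> (n * (r - s) + (-1)) = 0" if "d > 0" for d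
      using ev[OF that]
    proof eventually_elim
      case (elim n)
      show ?case
      proof safe
        fix r assume "r \<in> {s..t}" "d \<le> \<bar>r - s\<bar>"
        then have "n * d \<le> n * (r - s)" by (intro mult_left_mono) auto
        then show "n * deriv \<theta> (n * (r - s) + (-1)) = 0" using elim by (simp add: deriv_eq_0_outside)
      qed
    qed
  qed (use \<open>s < t\<close> c[where A="{s..t}" and c=s and k="-1"] \<theta>(6) in auto)
  then show "(\<lambda>n. integral {s..t} (\<lambda>r. n * deriv \<theta> (n * (r - s) - 1) * g r)) \<longlonglongrightarrow> g s" by simp
  show "(\<lambda>n. integral {s..t} (\<lambda>r. (n * deriv \<theta> (n * (r - t) + 2)) * g r)) \<longlonglongrightarrow> g t"
  proof (rule mollifier_tendsto[OF g])
    show "\<forall>\<^sub>F n in sequentially. integral {s..t} (\<lambda>r. n * deriv \<theta> (n * (r - t) + 2)) = 1"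
      using ev[of "t - s", simplified, OF \<open>s < t\<close>]
    proof eventually_elim
      case (elim n)
      then have "real n * (s - t) + 2 \<le> 0" by (simp add: algebra_simps)
      then show ?case by (subst fund) (simp add: \<theta>(2,3))
    qed
    show "\<forall>\<^sub>F n in sequentially. \<forall>r\<in>{s..t}. d \<le> \<bar>r - t\<bar> \<longrightarrow> n * deriv \<theta> (n * (r - t) + 2) = 0" if "d > 0" for d
      using ev[OF that]
    proof eventually_elim
      case (elim n)
      show ?case
      proof safe
        fix r assume "r \<in> {s..t}" "d \<le> \<bar>r - t\<bar>"
        then have "n * d \<le> n * (t - r)" by (intro mult_left_mono) auto
        then have "n * (r - t) + 2 \<le> 0" using elim by (simp add: algebra_simps)
        then show "n * deriv \<theta> (n * (r - t) + 2) = 0" by (simp add: deriv_eq_0_outside)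
      qed
    qed
  qed (use \<open>s < t\<close> c \<theta>(6) in auto)
qed

text \<open>Dominated convergence, carried out on the open interval because the cutoff tends to 1
  only there.\<close>

lemma integral_cutoff_tendsto:
  fixes f :: "real \<Rightarrow> real"
  assumes "f absolutely_integrable_on {s..t}"
  shows "(\<lambda>n. integral {s..t} (\<lambda>r. cutoff \<theta> s t n r * f r)) \<longlonglongrightarrow> integral {s..t} f"
    and "(\<lambda>n. integral {s..t} (\<lambda>r. \<bar>cutoff \<theta> s t n r - 1\<bar> * \<bar>f r\<bar>)) \<longlonglongrightarrow> 0"
proof -
  have f: "f absolutely_integrable_on {s<..<t}" "(\<lambda>r. \<bar>f r\<bar>) absolutely_integrable_on {s..t}"
    using assms absolutely_integrable_norm[OF assms] by (simp_all add: absolutely_integrable_on_Ioo_iff o_def)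
  have i1: "(\<lambda>r. cutoff \<theta> s t n r * f r) absolutely_integrable_on {s<..<t}" for n
    unfolding absolutely_integrable_on_Ioo_iff
    by (intro absolutely_integrable_continuous_mult assms smooth_imp_continuous_on smooth_cutoff)
  have i2: "(\<lambda>r. \<bar>cutoff \<theta> s t n r - 1\<bar> * \<bar>f r\<bar>) absolutely_integrable_on {s<..<t}" for n
    unfolding absolutely_integrable_on_Ioo_iff
    by (intro absolutely_integrable_continuous_mult f continuous_intros smooth_imp_continuous_on smooth_cutoff)
  have i3: "(\<lambda>r. 2 * \<bar>f r\<bar>) integrable_on {s<..<t}"
    using f(2) by (auto simp: integrable_on_open_interval_real absolutely_integrable_on_def)
  have "(\<lambda>n. integral {s<..<t} (\<lambda>r. cutoff \<theta> s t n r * f r)) \<longlonglongrightarrow> integral {s<..<t} f"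
  proof (rule dominated_convergence[OF _ i3])
    fix n r
    show "norm (cutoff \<theta> s t n r * f r) \<le> 2 * \<bar>f r\<bar>"
      using mult_right_mono[OF abs_cutoff_le[of s t n r], of "\<bar>f r\<bar>"] by (simp add: abs_mult)
    assume "r \<in> {s<..<t}"
    then have "(\<lambda>n. cutoff \<theta> s t n r * f r) \<longlonglongrightarrow> 1 * f r" by (intro tendsto_intros cutoff_tendsto) auto
    then show "(\<lambda>n. cutoff \<theta> s t n r * f r) \<longlonglongrightarrow> f r" by simp
  qed (use i1 in \<open>auto simp: absolutely_integrable_on_def\<close>)
  then show "(\<lambda>n. integral {s..t} (\<lambda>r. cutoff \<theta> s t n r * f r)) \<longlonglongrightarrow> integral {s..t} f"
    by (simp add: integral_open_interval_real)
  have "(\<lambda>n. integral {s<..<t} (\<lambda>r. \<bar>cutoff \<theta> s t n r - 1\<bar> * \<bar>f r\<bar>)) \<longlonglongrightarrow> integral {s<..<t} (\<lambda>r. 0)"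
  proof (rule dominated_convergence[OF _ i3])
    fix n r
    have "\<bar>cutoff \<theta> s t n r - 1\<bar> \<le> 2" using abs_cutoff_le[of s t n r] by linarith
    then show "norm (\<bar>cutoff \<theta> s t n r - 1\<bar> * \<bar>f r\<bar>) \<le> 2 * \<bar>f r\<bar>"
      by (simp add: mult_right_mono)
    assume "r \<in> {s<..<t}"
    then have "(\<lambda>n. \<bar>cutoff \<theta> s t n r - 1\<bar> * \<bar>f r\<bar>) \<longlonglongrightarrow> \<bar>1 - 1\<bar> * \<bar>f r\<bar>"
      by (intro tendsto_intros cutoff_tendsto) auto
    then show "(\<lambda>n. \<bar>cutoff \<theta> s t n r - 1\<bar> * \<bar>f r\<bar>) \<longlonglongrightarrow> 0" by simp
  qed (use i2 in \<open>auto simp: absolutely_integrable_on_def\<close>)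
  then show "(\<lambda>n. integral {s..t} (\<lambda>r. \<bar>cutoff \<theta> s t n r - 1\<bar> * \<bar>f r\<bar>)) \<longlonglongrightarrow> 0"
    by (simp add: integral_open_interval_real)
qed

lemma cutoff_mult_test_function:
  assumes "smooth \<phi>" "a \<le> s" "t \<le> b" "real n * (t - s) \<ge> 4"
  shows "(\<lambda>r. \<phi> r * cutoff \<theta> s t n r) \<in> test_functions a b"
proof (rule test_functionsI[where c="s + 1 / n" and d="t - 1 / n"])
  have n: "n > 0" using assms(4) by (cases n) auto
  then have "1 / real n > 0" by simp
  then show "a < s + 1 / n" "t - 1 / n < b" using assms by linarith+
  have "2 / real n \<le> 4 / real n" by (simp add: divide_right_mono)
  also have "4 / real n \<le> t - s" using n assms(4) by (simp add: field_simps)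
  finally show "s + 1 / n \<le> t - 1 / n" by simp
next
  show "smooth (\<lambda>r. \<phi> r * cutoff \<theta> s t n r)"
    by (intro smooth_mult smooth_cutoff assms)
  show "\<phi> r * cutoff \<theta> s t n r = 0" if "r \<notin> {s + 1 / n..t - 1 / n}" for r
    using cutoff_eq_0[OF assms(4) that] by simp
qed

text \<open>The test function is \<phi> times the cutoff of [s,t]. As \<open>n\<close> grows, the
  derivatives of the two ramps turn into point evaluations at \<open>s\<close> and \<open>t\<close>,
  which are the boundary terms; thus \<phi> is free of boundary conditions, and continuity of
  \<omega> gives the point values a meaning.\<close>

lemma generalized_by_parts:
  fixes \<omega> \<xi> :: "real \<Rightarrow> real"
  assumes st: "a \<le> s" "s < t" "t \<le> b"
    and \<omega>: "continuous_on {a..b} \<omega>" and \<xi>: "\<xi> absolutely_integrable_on {a..b}"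
    and gen: "\<And>\<phi>. \<phi> \<in> test_functions a b \<Longrightarrow>
       integral {a..b} (\<lambda>r. deriv \<phi> r * \<omega> r) = - integral {a..b} (\<lambda>r. \<phi> r * \<xi> r)"
    and \<phi>: "smooth \<phi>"
  shows "integral {s..t} (\<lambda>r. \<phi> r * \<xi> r) = \<phi> t * \<omega> t - \<phi> s * \<omega> s - integral {s..t} (\<lambda>r. deriv \<phi> r * \<omega> r)"
proof -
  let ?\<chi> = "cutoff \<theta> s t"
  have sub: "{s..t} \<subseteq> {a..b}" using st by auto
  have \<omega>': "continuous_on {s..t} \<omega>" using \<omega> sub by (rule continuous_on_subset)
  have \<xi>': "\<xi> absolutely_integrable_on {s..t}" using \<xi> sub by (rule absolutely_integrable_on_subinterval)
  have c\<phi>: "continuous_on A \<phi>" "continuous_on A (deriv \<phi>)" for A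
    using \<phi> by (auto intro: smooth_imp_continuous_on smooth_deriv)
  have \<phi>\<xi>: "(\<lambda>r. \<phi> r * \<xi> r) absolutely_integrable_on {s..t}"
    by (intro absolutely_integrable_continuous_mult c\<phi> \<xi>')
  have \<phi>\<omega>: "(\<lambda>r. deriv \<phi> r * \<omega> r) absolutely_integrable_on {s..t}"
    by (intro absolutely_integrable_continuous_real continuous_intros c\<phi> \<omega>')
  have "\<forall>\<^sub>F n in sequentially. n * (t - s) \<ge> 4" using st by real_asymp
  then have ev: "\<forall>\<^sub>F n in sequentially. integral {s..t} (\<lambda>r. ?\<chi> n r * (\<phi> r * \<xi> r)) =
      - (integral {s..t} (\<lambda>r. ?\<chi> n r * (deriv \<phi> r * \<omega> r))
         + integral {s..t} (\<lambda>r. n * deriv \<theta> (n * (r - s) - 1) * (\<phi> r * \<omega> r))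
         - integral {s..t} (\<lambda>r. n * deriv \<theta> (n * (r - t) + 2) * (\<phi> r * \<omega> r)))"
  proof eventually_elim
    case (elim n)
    let ?\<psi> = "\<lambda>r. \<phi> r * ?\<chi> n r"
    have test: "?\<psi> \<in> test_functions a b"
      using cutoff_mult_test_function[OF \<phi>] st elim by auto
    have D: "(?\<psi> has_real_derivative (deriv \<phi> r * ?\<chi> n r +
        \<phi> r * (n * deriv \<theta> (n * (r - s) - 1) - n * deriv \<theta> (n * (r - t) + 2)))) (at r)" for r
      using DERIV_mult[OF smooth_deriv(1)[OF \<phi>] cutoff_has_derivative] by (simp add: algebra_simps)
    have n: "n > 0" using elim by (cases n) auto
    have zero: "?\<chi> n r = 0" "deriv ?\<psi> r = 0" if "r \<notin> {s..t}" for r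
    proof -
      have *: "?\<chi> n r = 0" if "r \<notin> {s..t}" for r
      proof -
        have "1 / real n > 0" using n by simp
        then have "r \<notin> {s + 1 / n..t - 1 / n}" using that unfolding atLeastAtMost_iff by linarith
        then show ?thesis by (rule cutoff_eq_0[OF elim])
      qed
      then show "?\<chi> n r = 0" using that .
      \<comment> \<open>The product vanishes on the open complement of [s,t], hence so does its
        derivative, and the integrals over [a,b] reduce to [s,t].\<close>
      have "(?\<psi> has_real_derivative 0) (at r)"
        by (rule has_field_derivative_transform_within_open[of "\<lambda>x. 0" _ _ "- {s..t}"]) (use that * in auto)
      then show "deriv ?\<psi> r = 0" by (rule DERIV_imp_deriv)
    qed
    have restr: "integral {a..b} f = integral {s..t} f" if "\<And>r. r \<notin> {s..t} \<Longrightarrow> f r = 0" for f :: "real \<Rightarrow> real"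
    proof -
      have "(\<lambda>r. if r \<in> {a..b} then f r else 0) = (\<lambda>r. if r \<in> {s..t} then f r else 0)"
        using that sub by (auto simp: fun_eq_iff)
      then show ?thesis using integral_restrict_UNIV[of "{a..b}" f] integral_restrict_UNIV[of "{s..t}" f] by simp
    qed
    have c1: "continuous_on {s..t} (\<lambda>r. deriv \<theta> (n * (r - c) + k))" for c k :: real
      by (intro continuous_intros continuous_on_compose2[OF smooth_imp_continuous_on[OF smooth_deriv(2)[OF \<theta>(1)], of UNIV]]) auto
    have c2: "continuous_on {s..t} (?\<chi> n)" by (intro smooth_imp_continuous_on smooth_cutoff)
    have "integral {s..t} (\<lambda>r. ?\<chi> n r * (\<phi> r * \<xi> r)) = integral {s..t} (\<lambda>r. ?\<psi> r * \<xi> r)"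
      by (intro integral_cong) simp
    also have "\<dots> = integral {a..b} (\<lambda>r. ?\<psi> r * \<xi> r)"
      by (intro restr[symmetric]) (simp add: zero)
    also have "\<dots> = - integral {a..b} (\<lambda>r. deriv ?\<psi> r * \<omega> r)"
      using gen[OF test] by simp
    also have "integral {a..b} (\<lambda>r. deriv ?\<psi> r * \<omega> r) = integral {s..t} (\<lambda>r. deriv ?\<psi> r * \<omega> r)"
      by (intro restr) (simp add: zero)
    also have "\<dots> = integral {s..t} (\<lambda>r. ?\<chi> n r * (deriv \<phi> r * \<omega> r)
        + n * deriv \<theta> (n * (r - s) + (-1)) * (\<phi> r * \<omega> r) - n * deriv \<theta> (n * (r - t) + 2) * (\<phi> r * \<omega> r))"
      by (intro integral_cong) (simp add: DERIV_imp_deriv[OF D] algebra_simps)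
    also have "\<dots> = integral {s..t} (\<lambda>r. ?\<chi> n r * (deriv \<phi> r * \<omega> r))
         + integral {s..t} (\<lambda>r. n * deriv \<theta> (n * (r - s) + (-1)) * (\<phi> r * \<omega> r))
         - integral {s..t} (\<lambda>r. n * deriv \<theta> (n * (r - t) + 2) * (\<phi> r * \<omega> r))"
    proof -
      have i: "(\<lambda>r. ?\<chi> n r * (deriv \<phi> r * \<omega> r)) integrable_on {s..t}"
        "(\<lambda>r. n * deriv \<theta> (n * (r - c) + k) * (\<phi> r * \<omega> r)) integrable_on {s..t}" for c k :: real
        by (intro integrable_continuous_real continuous_intros c1 c2 c\<phi> \<omega>')+
      show ?thesis by (simp only: integral_diff integral_add integrable_add i)
    qed
    finally show ?case by simp
  qed
  have c\<phi>\<omega>: "continuous_on {s..t} (\<lambda>r. \<phi> r * \<omega> r)" by (intro continuous_intros c\<phi> \<omega>')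
  have "(\<lambda>n. integral {s..t} (\<lambda>r. ?\<chi> n r * (\<phi> r * \<xi> r))) \<longlonglongrightarrow>
      - (integral {s..t} (\<lambda>r. deriv \<phi> r * \<omega> r) + \<phi> s * \<omega> s - \<phi> t * \<omega> t)"
    by (subst tendsto_cong[OF ev])
       (intro tendsto_intros integral_cutoff_tendsto(1)[OF \<phi>\<omega>]
          cutoff_kernel_tendsto(1)[OF \<open>s < t\<close> c\<phi>\<omega>] cutoff_kernel_tendsto(2)[OF \<open>s < t\<close> c\<phi>\<omega>])
  from LIMSEQ_unique[OF integral_cutoff_tendsto(1)[OF \<phi>\<xi>] this]
  show ?thesis by simp
qed

end

section \<open>The space \<open>W\<^sub>p\<^sub>q\<close>\<close>

lemma le_one_plus_powr:
  fixes x r :: real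
  assumes "x \<ge> 0" "r \<ge> 1"
  shows "x \<le> 1 + x powr r"
proof (cases "x \<le> 1")
  case False
  then have "x powr 1 \<le> x powr r" using assms by (intro powr_mono) auto
  then show ?thesis using False by simp
qed (simp add: add_increasing2)

lemma borel_measurable_norm':
  fixes f :: "'a \<Rightarrow> 'b::real_normed_vector"
  shows "f \<in> borel_measurable M \<Longrightarrow> (\<lambda>x. norm (f x)) \<in> borel_measurable M"
  by (rule measurable_compose[OF _ borel_measurable_continuous_onI]) (auto intro: continuous_intros)

lemma Lp_spaceD:
  assumes "f \<in> Lp_space r a b"
  shows "f \<in> borel_measurable (lebesgue_on {a<..<b})"
    and "(\<lambda>t. norm (f t) powr r) absolutely_integrable_on {a..b}"
    and "r \<ge> 1 \<Longrightarrow> (\<lambda>t. norm (f t)) absolutely_integrable_on {a..b}"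
proof -
  show f: "f \<in> borel_measurable (lebesgue_on {a<..<b})"
    using assms by (simp add: Lp_space_def)
  have *: "(\<lambda>t. norm (f t) powr r) absolutely_integrable_on {a<..<b}"
    using assms by (simp add: Lp_space_def integrable_lebesgue_on_iff)
  then show "(\<lambda>t. norm (f t) powr r) absolutely_integrable_on {a..b}"
    by (simp only: absolutely_integrable_on_Ioo_iff)
  assume r: "r \<ge> 1"
  have "(\<lambda>t. 1 + norm (f t) powr r) integrable_on {a<..<b}"
    using * by (intro integrable_add) (auto simp: absolutely_integrable_on_def integrable_on_open_interval_real)
  moreover have "norm (f t) \<le> 1 + norm (f t) powr r" for t
    using le_one_plus_powr[OF _ r] by simp
  ultimately have "(\<lambda>t. norm (f t)) absolutely_integrable_on {a<..<b}"
    by (intro measurable_bounded_by_integrable_imp_absolutely_integrable[where g="\<lambda>t. 1 + norm (f t) powr r"])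
       (auto intro: borel_measurable_norm' f)
  then show "(\<lambda>t. norm (f t)) absolutely_integrable_on {a..b}"
    by (simp only: absolutely_integrable_on_Ioo_iff)
qed

section \<open>Evaluation of dual-valued functions at a vector of \<open>V\<close>\<close>

lemma bounded_linear_to_dual: "bounded_linear (to_dual \<iota>)"
proof (rule bounded_linear_intro[where K="norm \<iota>"])
  show "to_dual \<iota> (x + y) = to_dual \<iota> x + to_dual \<iota> y" for x y
    by (rule blinfun_eqI) (simp add: to_dual_def blinfun.bilinear_simps inner_add_left)
  show "to_dual \<iota> (r *\<^sub>R x) = r *\<^sub>R to_dual \<iota> x" for r x
    by (rule blinfun_eqI) (simp add: to_dual_def blinfun.bilinear_simps)
  show "norm (to_dual \<iota> x) \<le> norm x * norm \<iota>" for x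
  proof (rule norm_blinfun_bound)
    fix v
    have "\<bar>x \<bullet> \<iota> v\<bar> \<le> norm x * norm (\<iota> v)" by (rule Cauchy_Schwarz_ineq2)
    also have "\<dots> \<le> norm x * (norm \<iota> * norm v)" by (intro mult_left_mono norm_blinfun) auto
    finally show "norm (to_dual \<iota> x v) \<le> norm x * norm \<iota> * norm v" by (simp add: to_dual_def mult.assoc)
  qed simp
qed

lemma to_dual_apply: "to_dual \<iota> y v = y \<bullet> \<iota> v"
  by (simp add: to_dual_def)

lemma bounded_linear_blinfun_apply_left: "bounded_linear (\<lambda>g :: 'a::real_normed_vector \<Rightarrow>\<^sub>L 'b::real_normed_vector. blinfun_apply g v)"
  by (rule blinfun.bounded_linear_left)

lemma borel_measurable_blinfun_eval:
  fixes D :: "'a \<Rightarrow> ('v::real_normed_vector \<Rightarrow>\<^sub>L real)"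
  assumes "D \<in> borel_measurable M"
  shows "(\<lambda>t. D t v) \<in> borel_measurable M"
  by (intro measurable_compose[OF assms] borel_measurable_continuous_onI
      bounded_linear.continuous_on[OF bounded_linear_blinfun_apply_left] continuous_on_id)

lemma dual_eval_absolutely_integrable:
  assumes X': "X' \<in> Lp_space q a b" and "q \<ge> 1"
  shows "(\<lambda>r. blinfun_apply (X' r) v :: real) absolutely_integrable_on {a..b}"
proof -
  have "(\<lambda>r. norm (X' r) * norm v) integrable_on {a<..<b}"
    using Lp_spaceD(3)[OF X' \<open>q \<ge> 1\<close>]
    by (intro integrable_on_mult_left) (auto simp: absolutely_integrable_on_def integrable_on_open_interval_real)
  then have "(\<lambda>r. X' r v) absolutely_integrable_on {a<..<b}"
    using norm_blinfun[of "X' _" v]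
    by (intro measurable_bounded_by_integrable_imp_absolutely_integrable[where g="\<lambda>r. norm (X' r) * norm v"]
        borel_measurable_blinfun_eval Lp_spaceD(1)[OF X']) auto
  then show ?thesis by (simp only: absolutely_integrable_on_Ioo_iff)
qed

lemma has_bochner_integral_lebesgue_on_Ioo:
  fixes f :: "real \<Rightarrow> real"
  assumes "has_bochner_integral (lebesgue_on {a<..<b}) f I"
  shows "integral {a..b} f = I"
  using assms lebesgue_integral_eq_integral[of "{a<..<b}" f]
  by (simp add: has_bochner_integral_iff integral_open_interval_real)

lemma has_bochner_int_eval:
  fixes f :: "real \<Rightarrow> ('v::real_normed_vector \<Rightarrow>\<^sub>L real)"
  assumes "has_bochner_int (lebesgue_on {a<..<b}) f I"
  shows "integral {a..b} (\<lambda>r. f r v) = I v"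
  using has_bochner_int_bounded_linear[OF bounded_linear_blinfun_apply_left assms, of v]
  by (intro has_bochner_integral_lebesgue_on_Ioo) (simp add: has_bochner_int_iff_has_bochner_integral)

lemma integral_cong_AE_Ioo:
  fixes f g :: "real \<Rightarrow> real"
  assumes "AE r in lebesgue_on {a<..<b}. f r = g r"
  shows "integral {a..b} f = integral {a..b} g"
proof -
  have "AE r in lebesgue. r \<in> {a<..<b} \<longrightarrow> f r = g r"
    using assms by (subst (asm) AE_restrict_space_iff) auto
  then obtain N where N: "N \<in> null_sets lebesgue" "{r. \<not> (r \<in> {a<..<b} \<longrightarrow> f r = g r)} \<subseteq> N"
    by (auto simp: eventually_ae_filter)
  then have "negligible N" by (simp add: negligible_iff_null_sets)
  then have "integral {a<..<b} f = integral {a<..<b} g"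
    by (rule integral_spike) (use N(2) in auto)
  then show ?thesis by (simp add: integral_open_interval_real)
qed

text \<open>Evaluating the Bochner identity at a fixed \<open>v\<close> gives real functions, to
  which \<open>generalized_by_parts\<close> applies. The boundary values are those of
  \<open>x\<close>, the continuous representative of the image of \<open>X\<close> under
  \<open>\<iota>\<close>.\<close>

lemma Wpq_by_parts:
  fixes \<iota> :: "'v::real_normed_vector \<Rightarrow>\<^sub>L 'h::real_inner"
  assumes W: "Wpq \<iota> p q a b X X'" and "q \<ge> 1" and st: "a \<le> s" "s < t" "t \<le> b"
    and x: "continuous_on {a..b} x" and ae: "AE t in lebesgue_on {a<..<b}. x t = \<iota> (X t)"
    and \<phi>: "smooth \<phi>"
  shows "integral {s..t} (\<lambda>r. \<phi> r * X' r v) =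
    \<phi> t * (x t \<bullet> \<iota> v) - \<phi> s * (x s \<bullet> \<iota> v) - integral {s..t} (\<lambda>r. deriv \<phi> r * (x r \<bullet> \<iota> v))"
proof -
  obtain \<theta> where \<theta>: "smooth \<theta>" "\<And>x. x \<le> 0 \<Longrightarrow> \<theta> x = 0" "\<And>x. x \<ge> 1 \<Longrightarrow> \<theta> x = 1"
    "\<And>x. 0 \<le> \<theta> x" "\<And>x. \<theta> x \<le> 1" "\<And>x. 0 \<le> deriv \<theta> x"
    using ex_smooth_step by metis
  show ?thesis
  proof (rule generalized_by_parts[OF \<theta> st _ _ _ \<phi>])
    show "continuous_on {a..b} (\<lambda>r. x r \<bullet> \<iota> v)" by (intro continuous_intros x)
    show "(\<lambda>r. X' r v) absolutely_integrable_on {a..b}"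
      using W \<open>q \<ge> 1\<close> by (intro dual_eval_absolutely_integrable) (auto simp: Wpq_def)
    fix \<psi> assume "\<psi> \<in> test_functions a b"
    then obtain I where
      I: "has_bochner_int (lebesgue_on {a<..<b}) (\<lambda>t. deriv \<psi> t *\<^sub>R to_dual \<iota> (\<iota> (X t))) I"
        "has_bochner_int (lebesgue_on {a<..<b}) (\<lambda>t. \<psi> t *\<^sub>R X' t) (- I)"
      using W unfolding Wpq_def generalized_derivative_def by blast
    have "integral {a..b} (\<lambda>r. deriv \<psi> r * (x r \<bullet> \<iota> v)) = integral {a..b} (\<lambda>r. deriv \<psi> r * (\<iota> (X r) \<bullet> \<iota> v))"
      by (rule integral_cong_AE_Ioo) (use ae in eventually_elim, simp)
    also have "\<dots> = I v"
      using has_bochner_int_eval[OF I(1), of v] by (simp add: blinfun.bilinear_simps to_dual_apply)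
    finally show "integral {a..b} (\<lambda>r. deriv \<psi> r * (x r \<bullet> \<iota> v)) = - integral {a..b} (\<lambda>r. \<psi> r * X' r v)"
      using has_bochner_int_eval[OF I(2), of v] by (simp add: blinfun.bilinear_simps)
  qed (use \<open>s < t\<close> in auto)
qed

lemma bounded_smooth:
  assumes "smooth \<phi>"
  obtains C where "C > 0" "\<And>r. r \<in> {a..b} \<Longrightarrow> \<bar>\<phi> r\<bar> \<le> C"
proof -
  have "bounded (\<phi> ` {a..b})"
    by (intro compact_imp_bounded compact_continuous_image smooth_imp_continuous_on assms) auto
  then show ?thesis using that by (auto simp: bounded_pos)
qed

lemma smooth_imp_measurable: "smooth \<phi> \<Longrightarrow> \<phi> \<in> borel_measurable (lebesgue_on S)"
proof -
  assume "smooth \<phi>"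
  then have "\<phi> \<in> borel_measurable borel"
    by (intro borel_measurable_continuous_onI smooth_imp_continuous_on)
  then have "\<phi> \<in> borel_measurable lebesgue" by (intro measurable_completion) simp
  then show ?thesis by (rule measurable_restrict_space1)
qed

lemma nn_integral_eq_integral_Ioo:
  fixes f :: "real \<Rightarrow> real"
  assumes "f absolutely_integrable_on {a..b}" "\<And>r. f r \<ge> 0"
  shows "(\<integral>\<^sup>+r. ennreal (f r) \<partial>lebesgue_on {a<..<b}) = ennreal (integral {a..b} f)"
proof -
  have i: "integrable (lebesgue_on {a<..<b}) f"
    using assms(1) by (simp add: integrable_lebesgue_on_iff absolutely_integrable_on_Ioo_iff)
  then show ?thesis
    using assms(2) lebesgue_integral_eq_integral[OF i]
    by (simp add: nn_integral_eq_integral integral_open_interval_real)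
qed

text \<open>Simple approximants in the dual come from the definition of the generalized derivative,
  which provides them for \<open>X'\<close> times a test function. A general smooth \<phi> is cut
  off near the ends, at a cost that is small in L1. This is used on both sides of a gluing point,
  where a test function of the whole interval need not vanish.\<close>

lemma Wpq_simple_approx:
  assumes W: "Wpq \<iota> p q a b X X'" and "q \<ge> 1" "a < b" "e > 0" and \<phi>: "smooth \<phi>"
  shows "\<exists>s. Bochner_Integration.simple_bochner_integrable (lebesgue_on {a<..<b}) s \<and>
     (\<integral>\<^sup>+r. ennreal (norm (\<phi> r *\<^sub>R X' r - s r)) \<partial>lebesgue_on {a<..<b}) \<le> ennreal e"
proof -
  let ?M = "lebesgue_on {a<..<b}"
  obtain \<theta> where \<theta>: "smooth \<theta>" "\<And>x. x \<le> 0 \<Longrightarrow> \<theta> x = 0" "\<And>x. x \<ge> 1 \<Longrightarrow> \<theta> x = 1"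
    "\<And>x. 0 \<le> \<theta> x" "\<And>x. \<theta> x \<le> 1" "\<And>x. 0 \<le> deriv \<theta> x"
    using ex_smooth_step by metis
  let ?\<chi> = "cutoff \<theta> a b"
  obtain C where C: "C > 0" "\<And>r. r \<in> {a..b} \<Longrightarrow> \<bar>\<phi> r\<bar> \<le> C"
    using bounded_smooth[OF \<phi>] by metis
  have X': "X' \<in> Lp_space q a b" using W by (simp add: Wpq_def)
  have "(\<lambda>r. C * norm (X' r)) absolutely_integrable_on {a..b}"
    by (intro absolutely_integrable_continuous_mult Lp_spaceD(3)[OF X' \<open>q \<ge> 1\<close>] continuous_intros)
  note i = this
  have lim: "(\<lambda>n. integral {a..b} (\<lambda>r. \<bar>?\<chi> n r - 1\<bar> * (C * norm (X' r)))) \<longlonglongrightarrow> 0"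
    using integral_cutoff_tendsto(2)[OF \<theta> i] C by (simp add: abs_mult)
  have "\<forall>\<^sub>F n in sequentially. integral {a..b} (\<lambda>r. \<bar>?\<chi> n r - 1\<bar> * (C * norm (X' r))) < e / 2"
    using \<open>e > 0\<close> by (intro order_tendstoD(2)[OF lim]) simp
  moreover have "\<forall>\<^sub>F n in sequentially. n * (b - a) \<ge> 4" using \<open>a < b\<close> by real_asymp
  ultimately have "\<forall>\<^sub>F n in sequentially. integral {a..b} (\<lambda>r. \<bar>?\<chi> n r - 1\<bar> * (C * norm (X' r))) < e / 2 \<and> n * (b - a) \<ge> 4"
    by (rule eventually_conj)
  \<comment> \<open>Cutting off costs at most \<open>e / 2\<close>; the other half is left for the
    approximation of the cut off function.\<close>
  then obtain n where n: "integral {a..b} (\<lambda>r. \<bar>?\<chi> n r - 1\<bar> * (C * norm (X' r))) < e / 2" "n * (b - a) \<ge> 4"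
    by (metis (no_types, lifting) eventually_sequentially order_refl)
  let ?\<psi> = "\<lambda>r. \<phi> r * ?\<chi> n r"
  have test: "?\<psi> \<in> test_functions a b"
    using n(2) by (intro cutoff_mult_test_function \<theta> \<phi>) auto
  have "\<forall>\<phi>\<in>test_functions a b. \<exists>I. has_bochner_int ?M (\<lambda>t. \<phi> t *\<^sub>R X' t) (- I)"
    using W unfolding Wpq_def generalized_derivative_def by blast
  from bspec[OF this test] obtain I where "has_bochner_int ?M (\<lambda>t. ?\<psi> t *\<^sub>R X' t) (- I)"
    by blast
  then obtain s where meas: "(\<lambda>t. ?\<psi> t *\<^sub>R X' t) \<in> borel_measurable ?M"
    and s: "\<And>i. Bochner_Integration.simple_bochner_integrable ?M (s i)"
    and lims: "(\<lambda>i. \<integral>\<^sup>+x. ennreal (norm (?\<psi> x *\<^sub>R X' x - s i x)) \<partial>?M) \<longlonglongrightarrow> 0"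
    unfolding has_bochner_int_def by auto
  have "\<forall>\<^sub>F i in sequentially. (\<integral>\<^sup>+x. ennreal (norm (?\<psi> x *\<^sub>R X' x - s i x)) \<partial>?M) < ennreal (e / 2)"
    using \<open>e > 0\<close> by (intro order_tendstoD(2)[OF lims]) simp
  then obtain i where si: "(\<integral>\<^sup>+x. ennreal (norm (?\<psi> x *\<^sub>R X' x - s i x)) \<partial>?M) < ennreal (e / 2)"
    by (metis (no_types, lifting) eventually_sequentially order_refl)
  have c\<chi>: "continuous_on A (?\<chi> n)" for A
    by (intro smooth_imp_continuous_on smooth_cutoff \<theta>)
  have "(\<integral>\<^sup>+r. ennreal (norm (\<phi> r *\<^sub>R X' r - s i r)) \<partial>?M)
     \<le> (\<integral>\<^sup>+r. ennreal (\<bar>?\<chi> n r - 1\<bar> * (C * norm (X' r))) + ennreal (norm (?\<psi> r *\<^sub>R X' r - s i r)) \<partial>?M)"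
  proof (rule nn_integral_mono)
    fix r assume "r \<in> space ?M"
    then have r: "\<bar>\<phi> r\<bar> \<le> C" by (intro C) (auto simp: space_restrict_space)
    have "norm (\<phi> r *\<^sub>R X' r - s i r) \<le> norm ((\<phi> r * (?\<chi> n r - 1)) *\<^sub>R X' r) + norm (?\<psi> r *\<^sub>R X' r - s i r)"
      using norm_triangle_ineq4[of "?\<psi> r *\<^sub>R X' r - s i r" "(\<phi> r * (?\<chi> n r - 1)) *\<^sub>R X' r"]
      by (simp add: algebra_simps)
    moreover have "norm ((\<phi> r * (?\<chi> n r - 1)) *\<^sub>R X' r) \<le> \<bar>?\<chi> n r - 1\<bar> * (C * norm (X' r))"
      using mult_right_mono[OF r, of "\<bar>?\<chi> n r - 1\<bar> * norm (X' r)"] by (simp add: abs_mult mult_ac)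
    ultimately have "norm (\<phi> r *\<^sub>R X' r - s i r)
        \<le> \<bar>?\<chi> n r - 1\<bar> * (C * norm (X' r)) + norm (?\<psi> r *\<^sub>R X' r - s i r)"
      by linarith
    from ennreal_leI[OF this] show "ennreal (norm (\<phi> r *\<^sub>R X' r - s i r)) \<le> ennreal (\<bar>?\<chi> n r - 1\<bar> * (C * norm (X' r))) + ennreal (norm (?\<psi> r *\<^sub>R X' r - s i r))"
      using C(1) by (subst (asm) ennreal_plus) auto
  qed
  also have "\<dots> = (\<integral>\<^sup>+r. ennreal (\<bar>?\<chi> n r - 1\<bar> * (C * norm (X' r))) \<partial>?M) + (\<integral>\<^sup>+r. ennreal (norm (?\<psi> r *\<^sub>R X' r - s i r)) \<partial>?M)"
  proof (rule nn_integral_add)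
    have "(\<lambda>r. norm (X' r)) \<in> borel_measurable ?M" using Lp_spaceD(1)[OF X'] by (rule borel_measurable_norm')
    moreover have "(\<lambda>r. ?\<chi> n r) \<in> borel_measurable ?M" by (intro smooth_imp_measurable smooth_cutoff \<theta>)
    ultimately show "(\<lambda>r. ennreal (\<bar>?\<chi> n r - 1\<bar> * (C * norm (X' r)))) \<in> borel_measurable ?M" by measurable
  qed (intro borel_measurable_norm_diff_simple meas simple_bochner_integrableD s)
  also have "(\<integral>\<^sup>+r. ennreal (\<bar>?\<chi> n r - 1\<bar> * (C * norm (X' r))) \<partial>?M) = ennreal (integral {a..b} (\<lambda>r. \<bar>?\<chi> n r - 1\<bar> * (C * norm (X' r))))"
    using C(1) by (intro nn_integral_eq_integral_Ioo absolutely_integrable_continuous_mult i continuous_intros c\<chi>) auto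
  also have "\<dots> + (\<integral>\<^sup>+r. ennreal (norm (?\<psi> r *\<^sub>R X' r - s i r)) \<partial>?M) \<le> ennreal (e / 2) + ennreal (e / 2)"
    using n(1) si by (intro add_mono ennreal_leI) auto
  also have "\<dots> = ennreal e" using \<open>e > 0\<close> by (subst ennreal_plus[symmetric]) auto
  finally show ?thesis using s by blast
qed

section \<open>Gluing two elements of \<open>Wpq\<close> at a time\<close>

definition concat_at :: "real \<Rightarrow> (real \<Rightarrow> 'b::zero) \<Rightarrow> (real \<Rightarrow> 'b) \<Rightarrow> real \<Rightarrow> 'b" where
  "concat_at c f g t = (if t < c then f t else if t = c then 0 else g t)"

lemma concat_at_measurable:
  fixes f g :: "real \<Rightarrow> 'b::{real_normed_vector}"
  assumes "f \<in> borel_measurable (lebesgue_on {a<..<c})" "g \<in> borel_measurable (lebesgue_on {c<..<b})" "a < c" "c < b"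
  shows "concat_at c f g \<in> borel_measurable (lebesgue_on {a<..<b})"
proof (rule measurable_piecewise_restrict[where C="{{a<..<c}, {c}, {c<..<b}}"])
  fix \<Omega> assume \<Omega>: "\<Omega> \<in> {{a<..<c}, {c}, {c<..<b}}"
  then show "\<Omega> \<inter> space (lebesgue_on {a<..<b}) \<in> sets (lebesgue_on {a<..<b})"
    using assms by (auto simp: sets_restrict_space_iff)
  have "restrict_space (lebesgue_on {a<..<b}) \<Omega> = lebesgue_on \<Omega>"
    using \<Omega> assms by (auto simp: restrict_restrict_space Int_absorb1 subset_eq intro!: arg_cong[where f="restrict_space lebesgue"])
  moreover have "concat_at c f g \<in> borel_measurable (lebesgue_on \<Omega>)"
  proof -
    consider "\<Omega> = {a<..<c}" | "\<Omega> = {c}" | "\<Omega> = {c<..<b}" using \<Omega> by auto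
    then show ?thesis
    proof cases
      case 1
      then show ?thesis using assms(1)
        by (subst measurable_cong[where g=f]) (auto simp: concat_at_def space_restrict_space)
    next
      case 2
      then show ?thesis
        by (subst measurable_cong[where g="\<lambda>_. 0"]) (auto simp: concat_at_def space_restrict_space)
    next
      case 3
      then show ?thesis using assms(2)
        by (subst measurable_cong[where g=g]) (auto simp: concat_at_def space_restrict_space)
    qed
  qed
  ultimately show "concat_at c f g \<in> borel_measurable (restrict_space (lebesgue_on {a<..<b}) \<Omega>)" by simp
qed (use assms in auto)

text \<open>Neither piece is prescribed at \<open>c\<close>, where \<open>concat_at\<close> takes
  the default value 0; this single point is a null set.\<close>

lemma AE_concat_at:
  assumes "AE t in lebesgue_on {a<..<c}. P t (f t)" "AE t in lebesgue_on {c<..<b}. P t (g t)"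
  shows "AE t in lebesgue_on {a<..<b}. P t (concat_at c f g t)"
proof -
  have "AE t in lebesgue. t \<in> {a<..<c} \<longrightarrow> P t (f t)" "AE t in lebesgue. t \<in> {c<..<b} \<longrightarrow> P t (g t)"
    using assms by (auto simp: AE_restrict_space_iff)
  moreover have "AE t in lebesgue. t \<noteq> c"
    by (rule AE_I'[of "{c}"]) (auto simp flip: negligible_iff_null_sets)
  ultimately have "AE t in lebesgue. t \<in> {a<..<b} \<longrightarrow> P t (concat_at c f g t)"
    by eventually_elim (auto simp: concat_at_def)
  then show ?thesis by (subst AE_restrict_space_iff) auto
qed

lemma absolutely_integrable_concat_at:
  fixes f g h :: "real \<Rightarrow> real"
  assumes "f absolutely_integrable_on {a..c}" "g absolutely_integrable_on {c..b}" "a < c" "c < b"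
    and h: "\<And>t. t < c \<Longrightarrow> h t = f t" "\<And>t. t > c \<Longrightarrow> h t = g t"
  shows "h absolutely_integrable_on {a..b}"
    and "integral {a..b} h = integral {a..c} f + integral {c..b} g"
proof -
  have n: "negligible {c}" by simp
  have 1: "h absolutely_integrable_on {a..c}"
    by (rule absolutely_integrable_spike[OF assms(1) n]) (use h in auto)
  have 2: "h absolutely_integrable_on {c..b}"
    by (rule absolutely_integrable_spike[OF assms(2) n]) (use h in auto)
  show *: "h absolutely_integrable_on {a..b}"
    using set_integrable_Un[OF 1 2] assms by (simp add: ivl_disj_un_two_touch)
  have "integral {a..c} h = integral {a..c} f" "integral {c..b} h = integral {c..b} g"
    by (rule integral_spike[OF n]; use h in auto)+
  then show "integral {a..b} h = integral {a..c} f + integral {c..b} g"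
    using Henstock_Kurzweil_Integration.integral_combine[of a c b h] * assms(3,4)
    by (simp add: absolutely_integrable_on_def)
qed

lemma Lp_space_concat_at:
  assumes f: "f \<in> Lp_space r a c" and g: "g \<in> Lp_space r c b" and "a < c" "c < b"
  shows "concat_at c f g \<in> Lp_space r a b"
proof -
  have "(\<lambda>t. norm (concat_at c f g t) powr r) absolutely_integrable_on {a..b}"
    by (rule absolutely_integrable_concat_at(1)[OF Lp_spaceD(2)[OF f] Lp_spaceD(2)[OF g] assms(3,4)])
       (auto simp: concat_at_def)
  then show ?thesis
    using concat_at_measurable[OF Lp_spaceD(1)[OF f] Lp_spaceD(1)[OF g] assms(3,4)]
    by (simp add: Lp_space_def integrable_lebesgue_on_iff absolutely_integrable_on_Ioo_iff)
qed

text \<open>The two approximants are extended by 0 and added. The intervals are disjoint and cover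
  all but the point \<open>c\<close>, so the errors add up.\<close>

lemma simple_approx_concat_at:
  fixes F :: "real \<Rightarrow> 'b::real_normed_vector"
  assumes "a < c" "c < b" "e1 \<ge> 0" "e2 \<ge> 0" and F: "F \<in> borel_measurable (lebesgue_on {a<..<b})"
    and s1: "Bochner_Integration.simple_bochner_integrable (lebesgue_on {a<..<c}) s1"
      "(\<integral>\<^sup>+r. ennreal (norm (F r - s1 r)) \<partial>lebesgue_on {a<..<c}) \<le> ennreal e1"
    and s2: "Bochner_Integration.simple_bochner_integrable (lebesgue_on {c<..<b}) s2"
      "(\<integral>\<^sup>+r. ennreal (norm (F r - s2 r)) \<partial>lebesgue_on {c<..<b}) \<le> ennreal e2"
  shows "\<exists>s. Bochner_Integration.simple_bochner_integrable (lebesgue_on {a<..<b}) s \<and>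
      (\<integral>\<^sup>+r. ennreal (norm (F r - s r)) \<partial>lebesgue_on {a<..<b}) \<le> ennreal (e1 + e2)"
proof (intro exI conjI)
  let ?s = "\<lambda>r. indicator {a<..<c} r *\<^sub>R s1 r + indicator {c<..<b} r *\<^sub>R s2 r"
  have 1: "Bochner_Integration.simple_bochner_integrable lebesgue (\<lambda>r. indicator {a<..<c} r *\<^sub>R s1 r)"
    using s1(1) by (subst (asm) simple_bochner_integrable_restrict_space) auto
  have 2: "Bochner_Integration.simple_bochner_integrable lebesgue (\<lambda>r. indicator {c<..<b} r *\<^sub>R s2 r)"
    using s2(1) by (subst (asm) simple_bochner_integrable_restrict_space) auto
  have "Bochner_Integration.simple_bochner_integrable lebesgue ?s"
    by (rule Bochner_Integration.simple_bochner_integrable_compose2[OF _ 1 2]) simp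
  moreover have "(\<lambda>r. indicator {a<..<b} r *\<^sub>R ?s r) = ?s"
    using assms(1,2) by (auto simp: fun_eq_iff indicator_def)
  ultimately show sb: "Bochner_Integration.simple_bochner_integrable (lebesgue_on {a<..<b}) ?s"
    by (subst simple_bochner_integrable_restrict_space) auto
  let ?d = "\<lambda>r. ennreal (norm (F r - ?s r))"
  have m: "?d \<in> borel_measurable (lebesgue_on {a<..<b})"
    by (intro borel_measurable_norm_diff_simple F simple_bochner_integrableD sb)
  have sub: "?d \<in> borel_measurable (lebesgue_on S)" if "S \<subseteq> {a<..<b}" "S \<in> sets lebesgue" for S
  proof -
    have "lebesgue_on S = restrict_space (lebesgue_on {a<..<b}) S"
      using that by (simp add: restrict_restrict_space Int_absorb1)
    then show ?thesis using measurable_restrict_space1[OF m] by metis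
  qed
  have "(\<integral>\<^sup>+r. ?d r \<partial>lebesgue_on {a<..<b}) = (\<integral>\<^sup>+r. ?d r * indicator {a<..<b} r \<partial>lebesgue)"
    by (subst nn_integral_restrict_space) auto
  also have "\<dots> = (\<integral>\<^sup>+r. ?d r * indicator {a<..<c} r + ?d r * indicator {c<..<b} r \<partial>lebesgue)"
  proof (rule nn_integral_cong_AE)
    have "AE r in lebesgue. r \<noteq> c"
      by (rule AE_I'[of "{c}"]) (auto simp flip: negligible_iff_null_sets)
    then show "AE r in lebesgue. ?d r * indicator {a<..<b} r = ?d r * indicator {a<..<c} r + ?d r * indicator {c<..<b} r"
      by eventually_elim (use assms(1,2) in \<open>auto simp: indicator_def\<close>)
  qed
  also have "\<dots> = (\<integral>\<^sup>+r. ?d r * indicator {a<..<c} r \<partial>lebesgue) + (\<integral>\<^sup>+r. ?d r * indicator {c<..<b} r \<partial>lebesgue)"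
    by (intro nn_integral_add borel_measurable_restrict_space_iff_ennreal[THEN iffD1] sub)
       (use assms(1,2) in auto)
  also have "\<dots> = (\<integral>\<^sup>+r. ?d r \<partial>lebesgue_on {a<..<c}) + (\<integral>\<^sup>+r. ?d r \<partial>lebesgue_on {c<..<b})"
    by (subst (1 2) nn_integral_restrict_space) auto
  also have "(\<integral>\<^sup>+r. ?d r \<partial>lebesgue_on {a<..<c}) = (\<integral>\<^sup>+r. ennreal (norm (F r - s1 r)) \<partial>lebesgue_on {a<..<c})"
    by (intro nn_integral_cong) (auto simp: space_restrict_space indicator_def)
  also have "(\<integral>\<^sup>+r. ?d r \<partial>lebesgue_on {c<..<b}) = (\<integral>\<^sup>+r. ennreal (norm (F r - s2 r)) \<partial>lebesgue_on {c<..<b})"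
    by (intro nn_integral_cong) (auto simp: space_restrict_space indicator_def)
  also have "(\<integral>\<^sup>+r. ennreal (norm (F r - s1 r)) \<partial>lebesgue_on {a<..<c}) + \<dots> \<le> ennreal e1 + ennreal e2"
    by (intro add_mono s1 s2)
  also have "\<dots> = ennreal (e1 + e2)" using assms by simp
  finally show "(\<integral>\<^sup>+r. ?d r \<partial>lebesgue_on {a<..<b}) \<le> ennreal (e1 + e2)" .
qed

lemma AE_lebesgue_on_subset:
  assumes "AE t in lebesgue_on S. P t" "R \<subseteq> S" "R \<in> sets lebesgue" "S \<in> sets lebesgue"
  shows "AE t in lebesgue_on R. P t"
proof -
  have "AE t in lebesgue. t \<in> S \<longrightarrow> P t"
    using assms(1,4) by (subst (asm) AE_restrict_space_iff) auto
  then have "AE t in lebesgue. t \<in> R \<longrightarrow> P t"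
    by eventually_elim (use \<open>R \<subseteq> S\<close> in auto)
  then show ?thesis
    using assms(3) by (subst AE_restrict_space_iff) auto
qed

lemma restrict_lebesgue_on:
  assumes "R \<subseteq> S" "S \<in> sets lebesgue" "R \<in> sets lebesgue"
  shows "restrict_space (lebesgue_on S) R = lebesgue_on R"
  using assms by (simp add: restrict_restrict_space Int_absorb1)

lemma Lp_space_subinterval:
  assumes h: "h \<in> Lp_space r a d" and "a \<le> a'" "c \<le> d"
  shows "h \<in> Lp_space r a' c"
proof -
  have "h \<in> borel_measurable (restrict_space (lebesgue_on {a<..<d}) {a'<..<c})"
    by (intro measurable_restrict_space1 Lp_spaceD(1)[OF h])
  then have "h \<in> borel_measurable (lebesgue_on {a'<..<c})"
    using assms(2,3) by (subst (asm) restrict_lebesgue_on) auto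
  moreover have "(\<lambda>t. norm (h t) powr r) absolutely_integrable_on {a'..c}"
    by (rule absolutely_integrable_on_subinterval[OF Lp_spaceD(2)[OF h]]) (use assms in auto)
  ultimately show ?thesis
    by (simp add: Lp_space_def integrable_lebesgue_on_iff absolutely_integrable_on_Ioo_iff)
qed

text \<open>The first function of a gluing is defined beyond the junction; its approximants restrict
  to the part that is kept.\<close>

lemma simple_approx_subinterval:
  fixes F :: "real \<Rightarrow> 'b::real_normed_vector"
  assumes "c \<le> d"
    and s: "Bochner_Integration.simple_bochner_integrable (lebesgue_on {a<..<d}) s"
      "(\<integral>\<^sup>+r. ennreal (norm (F r - s r)) \<partial>lebesgue_on {a<..<d}) \<le> e"
  shows "Bochner_Integration.simple_bochner_integrable (lebesgue_on {a<..<c}) s"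
    and "(\<integral>\<^sup>+r. ennreal (norm (F r - s r)) \<partial>lebesgue_on {a<..<c}) \<le> e"
proof -
  have 1: "Bochner_Integration.simple_bochner_integrable lebesgue (\<lambda>r. indicator {a<..<d} r *\<^sub>R s r)"
    using s(1) by (subst (asm) simple_bochner_integrable_restrict_space) auto
  have 2: "Bochner_Integration.simple_bochner_integrable lebesgue (indicator {a<..<c} :: real \<Rightarrow> real)"
  proof
    have "{y \<in> space lebesgue. indicator {a<..<c} y \<noteq> (0::real)} = {a<..<c}" by (auto simp: indicator_def)
    then show "emeasure lebesgue {y \<in> space lebesgue. indicator {a<..<c} y \<noteq> (0::real)} \<noteq> \<infinity>"
      using emeasure_bounded_finite[of "{a<..<c}"] by (simp add: less_top)
  qed auto
  have "Bochner_Integration.simple_bochner_integrable lebesgue (\<lambda>r. indicator {a<..<c} r *\<^sub>R (indicator {a<..<d} r *\<^sub>R s r))"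
    by (rule Bochner_Integration.simple_bochner_integrable_compose2[OF _ 2 1]) simp
  moreover have "(\<lambda>r. indicator {a<..<c} r *\<^sub>R (indicator {a<..<d} r *\<^sub>R s r)) = (\<lambda>r. indicator {a<..<c} r *\<^sub>R s r)"
    using \<open>c \<le> d\<close> by (auto simp: fun_eq_iff indicator_def)
  ultimately show "Bochner_Integration.simple_bochner_integrable (lebesgue_on {a<..<c}) s"
    by (subst simple_bochner_integrable_restrict_space) auto
  have "(\<integral>\<^sup>+r. ennreal (norm (F r - s r)) \<partial>lebesgue_on {a<..<c}) \<le> (\<integral>\<^sup>+r. ennreal (norm (F r - s r)) \<partial>lebesgue_on {a<..<d})"
    using \<open>c \<le> d\<close> by (simp add: nn_integral_restrict_space) (intro nn_integral_mono, auto simp: indicator_def)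
  then show "(\<integral>\<^sup>+r. ennreal (norm (F r - s r)) \<partial>lebesgue_on {a<..<c}) \<le> e" using s(2) by (rule order_trans)
qed

text \<open>On each side of \<open>c\<close> integration by parts leaves a boundary term at
  \<open>c\<close>; both contain the value of the continuous \<open>x\<close> there and cancel,
  while \<phi> vanishes at \<open>a\<close> and \<open>b\<close>. The first function lives on the
  longer interval up to \<open>d\<close>, as does a trajectory that is abandoned before its final
  time.\<close>

lemma Wpq_concat_at:
  fixes \<iota> :: "'v::{banach, second_countable_topology} \<Rightarrow>\<^sub>L 'h::real_inner"
  assumes W1: "Wpq \<iota> p q a d X1 X1'" and W2: "Wpq \<iota> p q c b X2 X2'"
    and "p \<ge> 1" "q \<ge> 1" "a < c" "c < b" "c \<le> d" and x: "continuous_on {a..b} x"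
    and x1: "continuous_on {a..d} x1" and eq: "\<And>t. t \<in> {a..c} \<Longrightarrow> x t = x1 t"
    and ae0: "AE t in lebesgue_on {a<..<d}. x1 t = \<iota> (X1 t)"
    and ae2: "AE t in lebesgue_on {c<..<b}. x t = \<iota> (X2 t)"
  shows "Wpq \<iota> p q a b (concat_at c X1 X2) (concat_at c X1' X2')"
proof -
  let ?X = "concat_at c X1 X2" and ?X' = "concat_at c X1' X2'" and ?M = "lebesgue_on {a<..<b}"
  have X: "?X \<in> Lp_space p a b"
    using W1 W2 Lp_space_subinterval[of X1 p a d a c] \<open>a < c\<close> \<open>c < b\<close> \<open>c \<le> d\<close>
    by (auto simp: Wpq_def Lp_space_concat_at)
  have X'1: "X1' \<in> Lp_space q a c" and X'2: "X2' \<in> Lp_space q c b"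
    using W1 W2 Lp_space_subinterval[of X1' q a d a c] \<open>c \<le> d\<close> by (auto simp: Wpq_def)
  have "AE t in lebesgue_on {a<..<c}. x1 t = \<iota> (X1 t)"
    by (rule AE_lebesgue_on_subset[OF ae0]) (use \<open>c \<le> d\<close> in auto)
  moreover have "AE t in lebesgue_on {a<..<c}. x t = x1 t"
    using eq by (intro AE_I2) (auto simp: space_restrict_space)
  ultimately have ae1: "AE t in lebesgue_on {a<..<c}. x t = \<iota> (X1 t)"
    by eventually_elim simp
  then have X': "?X' \<in> Lp_space q a b"
    using \<open>a < c\<close> \<open>c < b\<close> X'1 X'2 by (intro Lp_space_concat_at)
  have ae: "AE t in ?M. x t = \<iota> (?X t)"
    using AE_concat_at[where P="\<lambda>t y. x t = \<iota> y", OF ae1 ae2] .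
  have x2: "continuous_on {c..b} x"
    using x by (rule continuous_on_subset) (use \<open>a < c\<close> \<open>c < b\<close> in auto)
  have "generalized_derivative \<iota> a b ?X ?X'"
    unfolding generalized_derivative_def
  proof
    fix \<phi> assume test: "\<phi> \<in> test_functions a b"
    then have \<phi>: "smooth \<phi>" by (rule smooth_test_functions)
    have \<phi>ab: "\<phi> a = 0" "\<phi> b = 0" using test by (force simp: test_functions_def)+
    obtain C where C: "C > 0" "\<And>r. r \<in> {a..b} \<Longrightarrow> \<bar>deriv \<phi> r\<bar> \<le> C"
      using bounded_smooth[OF smooth_deriv(2)[OF \<phi>]] by metis
    \<comment> \<open>Here the values lie in the separable space \<open>V\<close>, so domination is
      enough for integrability; bounded linear maps then carry the integral to the dual.\<close>
    have "integrable ?M (\<lambda>t. deriv \<phi> t *\<^sub>R ?X t)"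
    proof (rule Bochner_Integration.integrable_bound)
      show "integrable ?M (\<lambda>t. C * norm (?X t))"
        using Lp_spaceD(3)[OF X \<open>p \<ge> 1\<close>]
        by (intro integrable_mult_right) (simp add: integrable_lebesgue_on_iff absolutely_integrable_on_Ioo_iff)
      show "(\<lambda>t. deriv \<phi> t *\<^sub>R ?X t) \<in> borel_measurable ?M"
        by (intro borel_measurable_scaleR' smooth_imp_measurable smooth_deriv \<phi> Lp_spaceD(1)[OF X])
      show "AE t in ?M. norm (deriv \<phi> t *\<^sub>R ?X t) \<le> norm (C * norm (?X t))"
        using C by (intro AE_I2) (auto simp: space_restrict_space abs_mult intro!: mult_right_mono)
    qed
    then obtain J where "has_bochner_integral ?M (\<lambda>t. deriv \<phi> t *\<^sub>R ?X t) J"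
      by (auto simp: integrable.simps)
    then have "has_bochner_int ?M (\<lambda>t. deriv \<phi> t *\<^sub>R ?X t) J"
      by (simp add: has_bochner_int_iff_has_bochner_integral)
    from has_bochner_int_bounded_linear[OF bounded_linear_compose[OF bounded_linear_to_dual blinfun.bounded_linear_right] this]
    have I: "has_bochner_int ?M (\<lambda>t. deriv \<phi> t *\<^sub>R to_dual \<iota> (\<iota> (?X t))) (to_dual \<iota> (\<iota> J))" (is "has_bochner_int _ _ ?I")
      by (simp add: blinfun.bilinear_simps linear_cmul[OF bounded_linear.linear[OF bounded_linear_to_dual]])
    have m: "(\<lambda>t. \<phi> t *\<^sub>R ?X' t) \<in> borel_measurable ?M"
      by (intro borel_measurable_scaleR' smooth_imp_measurable \<phi> Lp_spaceD(1)[OF X'])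
    \<comment> \<open>In the dual, existence is obtained by gluing simple approximants from the two
      sides of \<open>c\<close>.\<close>
    have "\<exists>K. has_bochner_int ?M (\<lambda>t. \<phi> t *\<^sub>R ?X' t) K"
    proof (rule has_bochner_int_exists[OF m])
      fix e :: real assume "e > 0"
      then have "e / 2 > 0" by simp
      have "a < d" using \<open>a < c\<close> \<open>c \<le> d\<close> by simp
      obtain s1 where s1': "Bochner_Integration.simple_bochner_integrable (lebesgue_on {a<..<d}) s1"
        "(\<integral>\<^sup>+r. ennreal (norm (\<phi> r *\<^sub>R X1' r - s1 r)) \<partial>lebesgue_on {a<..<d}) \<le> ennreal (e / 2)"
        using Wpq_simple_approx[OF W1 \<open>q \<ge> 1\<close> \<open>a < d\<close> \<open>e / 2 > 0\<close> \<phi>] by auto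
      note s1 = simple_approx_subinterval[OF \<open>c \<le> d\<close> s1']
      obtain s2 where s2: "Bochner_Integration.simple_bochner_integrable (lebesgue_on {c<..<b}) s2"
        "(\<integral>\<^sup>+r. ennreal (norm (\<phi> r *\<^sub>R X2' r - s2 r)) \<partial>lebesgue_on {c<..<b}) \<le> ennreal (e / 2)"
        using Wpq_simple_approx[OF W2 \<open>q \<ge> 1\<close> \<open>c < b\<close> \<open>e / 2 > 0\<close> \<phi>] by auto
      have "(\<integral>\<^sup>+r. ennreal (norm (\<phi> r *\<^sub>R ?X' r - s1 r)) \<partial>lebesgue_on {a<..<c})
          = (\<integral>\<^sup>+r. ennreal (norm (\<phi> r *\<^sub>R X1' r - s1 r)) \<partial>lebesgue_on {a<..<c})"
        "(\<integral>\<^sup>+r. ennreal (norm (\<phi> r *\<^sub>R ?X' r - s2 r)) \<partial>lebesgue_on {c<..<b})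
          = (\<integral>\<^sup>+r. ennreal (norm (\<phi> r *\<^sub>R X2' r - s2 r)) \<partial>lebesgue_on {c<..<b})"
        by (intro nn_integral_cong; simp add: concat_at_def space_restrict_space)+
      then show "\<exists>s. Bochner_Integration.simple_bochner_integrable ?M s \<and>
          (\<integral>\<^sup>+r. ennreal (norm (\<phi> r *\<^sub>R ?X' r - s r)) \<partial>?M) \<le> ennreal e"
        using simple_approx_concat_at[OF \<open>a < c\<close> \<open>c < b\<close> _ _ m s1(1) _ s2(1), of "e/2" "e/2"] s1(2) s2(2) \<open>e > 0\<close>
        by simp
    qed
    then obtain K where K: "has_bochner_int ?M (\<lambda>t. \<phi> t *\<^sub>R ?X' t) K" by auto
    \<comment> \<open>The integral is identified through its values at the vectors \<open>v\<close>,
      where only real integrals occur.\<close>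
    have "K v = - ?I v" for v
    proof -
      have c: "continuous_on A \<phi>" "continuous_on A (deriv \<phi>)" for A
        using \<phi> by (auto intro: smooth_imp_continuous_on smooth_deriv)
      have "K v = integral {a..b} (\<lambda>r. \<phi> r * ?X' r v)"
        using has_bochner_int_eval[OF K, of v] by (simp add: blinfun.bilinear_simps)
      also have "\<dots> = integral {a..c} (\<lambda>r. \<phi> r * X1' r v) + integral {c..b} (\<lambda>r. \<phi> r * X2' r v)"
        by (rule absolutely_integrable_concat_at(2))
           (auto intro!: absolutely_integrable_continuous_mult c dual_eval_absolutely_integrable[OF X'1 \<open>q \<ge> 1\<close>]
               dual_eval_absolutely_integrable[OF X'2 \<open>q \<ge> 1\<close>] \<open>a < c\<close> \<open>c < b\<close> simp: concat_at_def)
      also have "integral {a..c} (\<lambda>r. \<phi> r * X1' r v) = \<phi> c * (x c \<bullet> \<iota> v) - integral {a..c} (\<lambda>r. deriv \<phi> r * (x r \<bullet> \<iota> v))"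
      proof -
        have "integral {a..c} (\<lambda>r. deriv \<phi> r * (x r \<bullet> \<iota> v)) = integral {a..c} (\<lambda>r. deriv \<phi> r * (x1 r \<bullet> \<iota> v))"
          by (intro integral_cong) (simp add: eq)
        then show ?thesis
          using Wpq_by_parts[OF W1 \<open>q \<ge> 1\<close> order_refl \<open>a < c\<close> \<open>c \<le> d\<close> x1 ae0 \<phi>] eq[of c] \<open>a < c\<close>
          by (simp add: \<phi>ab)
      qed
      also have "integral {c..b} (\<lambda>r. \<phi> r * X2' r v) = - \<phi> c * (x c \<bullet> \<iota> v) - integral {c..b} (\<lambda>r. deriv \<phi> r * (x r \<bullet> \<iota> v))"
        using Wpq_by_parts[OF W2 \<open>q \<ge> 1\<close> order_refl \<open>c < b\<close> order_refl x2 ae2 \<phi>] by (simp add: \<phi>ab)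
      finally have "K v = - (integral {a..c} (\<lambda>r. deriv \<phi> r * (x r \<bullet> \<iota> v)) + integral {c..b} (\<lambda>r. deriv \<phi> r * (x r \<bullet> \<iota> v)))"
        by simp
      also have "integral {a..c} (\<lambda>r. deriv \<phi> r * (x r \<bullet> \<iota> v)) + integral {c..b} (\<lambda>r. deriv \<phi> r * (x r \<bullet> \<iota> v))
          = integral {a..b} (\<lambda>r. deriv \<phi> r * (x r \<bullet> \<iota> v))"
        using \<open>a < c\<close> \<open>c < b\<close>
        by (intro Henstock_Kurzweil_Integration.integral_combine integrable_continuous_real continuous_intros c x) auto
      also have "\<dots> = integral {a..b} (\<lambda>r. deriv \<phi> r * (\<iota> (?X r) \<bullet> \<iota> v))"
        by (rule integral_cong_AE_Ioo) (use ae in eventually_elim, simp)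
      also have "\<dots> = ?I v"
        using has_bochner_int_eval[OF I, of v] by (simp add: blinfun.bilinear_simps to_dual_apply)
      finally show ?thesis .
    qed
    then have "K = - ?I" by (intro blinfun_eqI) (simp add: blinfun.bilinear_simps)
    with I K show "\<exists>I. has_bochner_int ?M (\<lambda>t. deriv \<phi> t *\<^sub>R to_dual \<iota> (\<iota> (?X t))) I \<and>
        has_bochner_int ?M (\<lambda>t. \<phi> t *\<^sub>R ?X' t) (- I)" by metis
  qed
  with X X' show ?thesis by (simp add: Wpq_def)
qed

lemma sup_norm_cong: "(\<And>s. s \<in> {0..t} \<Longrightarrow> x s = y s) \<Longrightarrow> sup_norm t x = sup_norm t y"
  unfolding sup_norm_def by (intro SUP_cong) auto

text \<open>An Euler step produces a trajectory started at \<open>(t\<^sub>1, x)\<close>. Gluing it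
  to the path before \<open>t\<^sub>1\<close> makes it a trajectory from the original starting
  point, to which compactness and the modulus of \<open>F\<close> refer. The growth bound survives
  because it involves the path only up to the current time.\<close>

lemma trajectory_rhs_concat:
  fixes \<iota> :: "'v::{banach, second_countable_topology} \<Rightarrow>\<^sub>L 'h::real_inner"
  assumes x: "trajectory_rhs \<iota> A p q T L t\<^sub>0 x\<^sub>0 x f" and y: "trajectory_rhs \<iota> A p q T L t\<^sub>1 x y g"
    and "p \<ge> 1" "q \<ge> 1" "0 \<le> t\<^sub>0" "t\<^sub>0 < t\<^sub>1" "t\<^sub>1 < T"
  shows "trajectory_rhs \<iota> A p q T L t\<^sub>0 x\<^sub>0 y (concat_at t\<^sub>1 f g)"
proof -
  have px: "x \<in> paths T" "\<forall>t\<in>{0..t\<^sub>0}. x t = x\<^sub>0 t" "f \<in> Lp_space 2 t\<^sub>0 T"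
    and bx: "AE t in lebesgue_on {t\<^sub>0<..<T}. norm (f t) \<le> L * (1 + sup_norm t x)"
    and py: "y \<in> paths T" "\<forall>t\<in>{0..t\<^sub>1}. y t = x t" "g \<in> Lp_space 2 t\<^sub>1 T"
    and by': "AE t in lebesgue_on {t\<^sub>1<..<T}. norm (g t) \<le> L * (1 + sup_norm t y)"
    using x y unfolding trajectory_rhs_def by auto
  obtain X X' where X: "Wpq \<iota> p q t\<^sub>0 T X X'" "AE t in lebesgue_on {t\<^sub>0<..<T}. x t = \<iota> (X t)"
    "AE t in lebesgue_on {t\<^sub>0<..<T}. X' t + A t (X t) = to_dual \<iota> (f t)"
    using x unfolding trajectory_rhs_def by auto
  obtain Y Y' where Y: "Wpq \<iota> p q t\<^sub>1 T Y Y'" "AE t in lebesgue_on {t\<^sub>1<..<T}. y t = \<iota> (Y t)"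
    "AE t in lebesgue_on {t\<^sub>1<..<T}. Y' t + A t (Y t) = to_dual \<iota> (g t)"
    using y unfolding trajectory_rhs_def by auto
  have cont: "continuous_on {t\<^sub>0..T} x" "continuous_on {t\<^sub>0..T} y"
    using px(1) py(1) \<open>0 \<le> t\<^sub>0\<close> by (auto simp: paths_def intro: continuous_on_subset)
  have eq: "y t = x t" if "t \<in> {t\<^sub>0..t\<^sub>1}" for t
    using py(2) that \<open>0 \<le> t\<^sub>0\<close> by auto
  have W: "Wpq \<iota> p q t\<^sub>0 T (concat_at t\<^sub>1 X Y) (concat_at t\<^sub>1 X' Y')"
    by (rule Wpq_concat_at[OF X(1) Y(1) assms(3,4,6,7) _ cont(2,1) eq X(2) Y(2)]) (use \<open>t\<^sub>1 < T\<close> in auto)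
  have before: "AE t in lebesgue_on {t\<^sub>0<..<t\<^sub>1}. P t" if "AE t in lebesgue_on {t\<^sub>0<..<T}. P t" for P
    by (rule AE_lebesgue_on_subset[OF that]) (use \<open>t\<^sub>1 < T\<close> in auto)
  have inside: "AE t in lebesgue_on {t\<^sub>0<..<t\<^sub>1}. t \<in> {t\<^sub>0<..<t\<^sub>1}"
    by (intro AE_I2) (simp add: space_restrict_space)
  have 1: "AE t in lebesgue_on {t\<^sub>0<..<t\<^sub>1}. y t = \<iota> (X t)"
    using before[OF X(2)] inside by eventually_elim (use eq in force)
  have "AE t in lebesgue_on {t\<^sub>0<..<T}. y t = \<iota> (concat_at t\<^sub>1 X Y t)"
    using AE_concat_at[where P="\<lambda>t z. y t = \<iota> z", OF 1 Y(2)] .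
  moreover have "AE t in lebesgue_on {t\<^sub>0<..<T}. concat_at t\<^sub>1 X' Y' t + A t (concat_at t\<^sub>1 X Y t) = to_dual \<iota> (concat_at t\<^sub>1 f g t)"
  proof -
    \<comment> \<open>\<open>AE_concat_at\<close> glues one function at a time; derivative, state
      and right-hand side are therefore bundled into a triple.\<close>
    have c: "concat_at t\<^sub>1 (\<lambda>t. (X' t, X t, f t)) (\<lambda>t. (Y' t, Y t, g t)) t =
        (concat_at t\<^sub>1 X' Y' t, concat_at t\<^sub>1 X Y t, concat_at t\<^sub>1 f g t)" for t
      by (simp add: concat_at_def zero_prod_def)
    show ?thesis
      using AE_concat_at[where P="\<lambda>t (z', z, w). z' + A t z = to_dual \<iota> w" and
          f="\<lambda>t. (X' t, X t, f t)" and g="\<lambda>t. (Y' t, Y t, g t)" and a="t\<^sub>0" and b=T and c="t\<^sub>1"]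
        before[OF X(3)] Y(3) by (simp add: c)
  qed
  moreover have "AE t in lebesgue_on {t\<^sub>0<..<t\<^sub>1}. norm (f t) \<le> L * (1 + sup_norm t y)"
    using before[OF bx] inside
  proof eventually_elim
    case (elim t)
    have "sup_norm t y = sup_norm t x" by (rule sup_norm_cong) (use py(2) elim(2) in auto)
    then show ?case using elim(1) by simp
  qed
  from AE_concat_at[where P="\<lambda>t z. norm z \<le> L * (1 + sup_norm t y)", OF this by']
  have "AE t in lebesgue_on {t\<^sub>0<..<T}. norm (concat_at t\<^sub>1 f g t) \<le> L * (1 + sup_norm t y)" .
  moreover have "concat_at t\<^sub>1 f g \<in> Lp_space 2 t\<^sub>0 T"
    using assms(6,7) by (intro Lp_space_concat_at Lp_space_subinterval[OF px(3)] py(3)) auto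
  moreover have "\<forall>t\<in>{0..t\<^sub>0}. y t = x\<^sub>0 t"
    using py(2) px(2) assms(5,6) by auto
  ultimately show ?thesis
    using py(1) W unfolding trajectory_rhs_def by blast
qed

section \<open>The energy inequality\<close>

text \<open>Young's inequality for \<open>c * x\<close> and \<open>y / c\<close> with
  \<open>c powr q = \<theta> * q\<close>. The small weight goes to the factor with exponent
  \<open>q\<close>, whose integral stays fixed in the application, while the other factor will be
  made small.\<close>

lemma Young_eps:
  fixes p q \<theta> :: real
  assumes "p > 1" "q > 1" "1 / p + 1 / q = 1" "\<theta> > 0"
  obtains C where "C > 0" "\<And>x y. x \<ge> 0 \<Longrightarrow> y \<ge> 0 \<Longrightarrow> x * y \<le> \<theta> * x powr q + C * y powr p"
proof -
  define c where "c = (\<theta> * q) powr (1 / q)"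
  have c: "c > 0" "c powr q = \<theta> * q" using assms by (auto simp: c_def powr_powr)
  have "x * y \<le> \<theta> * x powr q + (1 / (c powr p * p)) * y powr p" if "x \<ge> 0" "y \<ge> 0" for x y
  proof -
    have "(c * x) * (y / c) \<le> (c * x) powr q / q + (y / c) powr p / p"
      using assms c that by (intro Youngs_inequality) (auto simp: add.commute)
    moreover have "(c * x) powr q / q = \<theta> * x powr q"
      using c that assms by (simp add: powr_mult)
    moreover have "(y / c) powr p / p = (1 / (c powr p * p)) * y powr p"
      using c that by (simp add: powr_divide)
    ultimately show ?thesis using c by simp
  qed
  moreover have "1 / (c powr p * p) > 0" using c assms by simp
  ultimately show ?thesis using that by blast
qed

lemma powr_sum_le:
  fixes x y r :: real
  assumes "x \<ge> 0" "y \<ge> 0" "r \<ge> 0"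
  shows "(x + y) powr r \<le> 2 powr r * (x powr r + y powr r)"
proof -
  have "(x + y) powr r \<le> (2 * max x y) powr r" using assms by (intro powr_mono2) auto
  also have "\<dots> = 2 powr r * max x y powr r" using assms by (simp add: powr_mult)
  also have "max x y powr r \<le> x powr r + y powr r" by (auto simp: max_def)
  finally show ?thesis by simp
qed

text \<open>Measurability of \<open>E\<close> is assumed after evaluation at fixed vectors;
  separability of the domain lets \<open>g\<close> be approximated by simple functions, for which
  that is enough.\<close>

lemma borel_measurable_weak_apply:
  fixes E :: "'a \<Rightarrow> ('v::{real_normed_vector, second_countable_topology} \<Rightarrow>\<^sub>L real)"
  assumes E: "\<And>v. (\<lambda>t. E t v) \<in> borel_measurable M" and g: "g \<in> borel_measurable M"
  shows "(\<lambda>t. E t (g t)) \<in> borel_measurable M"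
proof -
  obtain s where s: "\<And>i. simple_function M (s i)" "\<And>x. x \<in> space M \<Longrightarrow> (\<lambda>i. s i x) \<longlonglongrightarrow> g x"
    using borel_measurable_implies_sequence_metric[OF g, of 0] by metis
  show ?thesis
  proof (rule borel_measurable_LIMSEQ_metric)
    show "(\<lambda>t. E t (s i t)) \<in> borel_measurable M" for i
      by (rule borel_measurable_simple_combine[OF s(1), where g="\<lambda>c x. E x c" and f="\<lambda>x. x"]) (rule E)
    show "(\<lambda>i. E x (s i x)) \<longlonglongrightarrow> E x (g x)" if "x \<in> space M" for x
      by (intro tendsto_intros s(2) that)
  qed
qed

text \<open>\<open>\<Phi> r - \<Phi> (r - \<delta>)\<close> is an antiderivative of the increment,
  so its integral reduces to integrals of \<phi> over windows of length \<delta> that end at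
  \<open>t\<close> and at \<open>s\<close>.\<close>

lemma integral_increment:
  fixes \<phi> :: "real \<Rightarrow> real"
  assumes \<phi>: "continuous_on {a..b} \<phi>" and "0 < \<delta>" "a < s - \<delta>" "s \<le> t" "t \<le> b"
  defines "\<Phi> \<equiv> \<lambda>r. integral {a..r} \<phi>"
  shows "integral {s..t} (\<lambda>r. \<phi> r - \<phi> (r - \<delta>)) = (\<Phi> t - \<Phi> (t - \<delta>)) - (\<Phi> s - \<Phi> (s - \<delta>))"
proof (rule integral_unique, rule fundamental_theorem_of_calculus[OF \<open>s \<le> t\<close>])
  have D: "(\<Phi> has_real_derivative \<phi> r) (at r within {a..b})" if "r \<in> {a..b}" for r
    unfolding \<Phi>_def by (rule integral_has_real_derivative[OF \<phi> that])
  fix r assume r: "r \<in> {s..t}"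
  have "(\<Phi> has_real_derivative \<phi> r) (at r within {s..t})"
    by (rule DERIV_subset[OF D]) (use r assms in auto)
  moreover have "((\<lambda>r. \<Phi> (r - \<delta>)) has_real_derivative \<phi> (r - \<delta>) * 1) (at r within {s..t})"
  proof (rule DERIV_chain2[where f=\<Phi> and g="\<lambda>r. r - \<delta>"])
    show "((\<lambda>r. r - \<delta>) has_real_derivative 1) (at r within {s..t})"
      by (auto intro!: derivative_eq_intros)
    have "r - \<delta> \<in> interior {a..b}" using r assms by auto
    then show "(\<Phi> has_real_derivative \<phi> (r - \<delta>)) (at (r - \<delta>))"
      using D[of "r - \<delta>"] by (metis at_within_interior interior_subset subsetD)
  qed
  ultimately show "((\<lambda>r. \<Phi> r - \<Phi> (r - \<delta>)) has_vector_derivative \<phi> r - \<phi> (r - \<delta>)) (at r within {s..t})"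
    by (auto simp flip: has_real_derivative_iff_has_vector_derivative intro: DERIV_diff)
qed

lemma difference_quotient_tendsto:
  fixes \<phi> :: "real \<Rightarrow> real" and \<delta> :: "nat \<Rightarrow> real"
  assumes \<phi>: "continuous_on {a..b} \<phi>" and c: "a < c" "c \<le> b" and \<delta>: "\<delta> \<longlonglongrightarrow> 0" "\<And>n. \<delta> n > 0"
  shows "(\<lambda>n. (integral {a..c} \<phi> - integral {a..c - \<delta> n} \<phi>) / \<delta> n) \<longlonglongrightarrow> \<phi> c"
proof -
  let ?\<Phi> = "\<lambda>r. integral {a..r} \<phi>"
  have "((\<lambda>y. (?\<Phi> y - ?\<Phi> c) / (y - c)) \<longlongrightarrow> \<phi> c) (at c within {a..b})"
    using integral_has_real_derivative[OF \<phi>, of c] c by (simp add: has_field_derivative_iff)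
  moreover have "filterlim (\<lambda>n. c - \<delta> n) (at c within {a..b}) sequentially"
    unfolding filterlim_at
  proof
    have "\<forall>\<^sub>F n in sequentially. \<delta> n < c - a" using c by (intro order_tendstoD(2)[OF \<delta>(1)]) auto
    then show "\<forall>\<^sub>F n in sequentially. c - \<delta> n \<in> {a..b} \<and> c - \<delta> n \<noteq> c"
    proof eventually_elim
      case (elim n) then show ?case using \<delta>(2)[of n] c by auto
    qed
    show "(\<lambda>n. c - \<delta> n) \<longlonglongrightarrow> c" using tendsto_diff[OF tendsto_const \<delta>(1), of c] by simp
  qed
  ultimately have "(\<lambda>n. (?\<Phi> (c - \<delta> n) - ?\<Phi> c) / (c - \<delta> n - c)) \<longlonglongrightarrow> \<phi> c"
    by (rule filterlim_compose)
  moreover have "(?\<Phi> (c - \<delta> n) - ?\<Phi> c) / (c - \<delta> n - c) = (?\<Phi> c - ?\<Phi> (c - \<delta> n)) / \<delta> n" for n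
    by (simp add: divide_simps)
  ultimately show ?thesis by simp
qed

text \<open>The setting of the energy inequality: \<open>D\<close> is the derivative of
  \<open>w\<close> tested with vectors of \<open>V\<close>, and \<open>W\<close> is the
  \<open>V\<close>-valued version of \<open>w\<close>. Integrability is carried by a separate
  majorant \<open>k\<close>, since \<open>D\<close> is assumed measurable only after
  evaluation.\<close>

locale weak_path =
  fixes \<iota> :: "'v::{banach, second_countable_topology} \<Rightarrow>\<^sub>L 'h::real_inner"
    and p q a b :: real and w :: "real \<Rightarrow> 'h" and W :: "real \<Rightarrow> 'v" and D :: "real \<Rightarrow> ('v \<Rightarrow>\<^sub>L real)"
    and k :: "real \<Rightarrow> real"
  assumes ab: "a < b" and pq: "p > 1" "q > 1" "1 / p + 1 / q = 1"
    and w_cont: "continuous_on {a..b} w"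
    and W_meas: "W \<in> borel_measurable (lebesgue_on {a<..<b})"
    and W_int: "(\<lambda>t. norm (W t) powr p) absolutely_integrable_on {a..b}"
    and w_eq: "AE t in lebesgue_on {a<..<b}. w t = \<iota> (W t)"
    and D_meas: "\<And>v. (\<lambda>t. D t v) \<in> borel_measurable (lebesgue_on {a<..<b})"
    and k_int: "(\<lambda>t. k t powr q) absolutely_integrable_on {a..b}"
    and D_le: "\<And>t. norm (D t) \<le> k t"
    and weak: "\<And>v s t. a \<le> s \<Longrightarrow> s \<le> t \<Longrightarrow> t \<le> b \<Longrightarrow> (w t - w s) \<bullet> \<iota> v = integral {s..t} (\<lambda>r. D r v)"
begin

lemma k_nonneg: "k t \<ge> 0"
  using D_le[of t] norm_ge_zero order_trans by blast

lemma measurable_Icc: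
  fixes f :: "real \<Rightarrow> 'z::topological_space"
  assumes "f \<in> borel_measurable (lebesgue_on {a<..<b})" "a < s" "t < b"
  shows "f \<in> borel_measurable (lebesgue_on {s..t})"
proof -
  have "lebesgue_on {s..t} = restrict_space (lebesgue_on {a<..<b}) {s..t}"
    using assms by (intro restrict_lebesgue_on[symmetric]) auto
  then show ?thesis using measurable_restrict_space1[OF assms(1)] by metis
qed

lemma D_W_integrable: "(\<lambda>r. D r (W r)) absolutely_integrable_on {a..b}"
proof -
  obtain C where C: "C > 0" "\<And>x y. x \<ge> 0 \<Longrightarrow> y \<ge> 0 \<Longrightarrow> x * y \<le> 1 * x powr q + C * y powr p"
    using Young_eps[OF pq zero_less_one] by blast
  have i: "(\<lambda>r. 1 * k r powr q + C * norm (W r) powr p) integrable_on {a<..<b}"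
    using k_int W_int
    by (intro integrable_add integrable_on_mult_right)
       (auto simp: absolutely_integrable_on_def integrable_on_open_interval_real)
  have "(\<lambda>r. D r (W r)) absolutely_integrable_on {a<..<b}"
  proof (rule measurable_bounded_by_integrable_imp_absolutely_integrable[OF _ _ i])
    fix r
    have "norm (D r (W r)) \<le> norm (D r) * norm (W r)" by (rule norm_blinfun)
    also have "\<dots> \<le> k r * norm (W r)" by (intro mult_right_mono D_le) auto
    also have "\<dots> \<le> 1 * k r powr q + C * norm (W r) powr p" by (intro C k_nonneg) auto
    finally show "norm (D r (W r)) \<le> 1 * k r powr q + C * norm (W r) powr p" .
  qed (auto intro: borel_measurable_weak_apply[OF D_meas W_meas])
  then show ?thesis by (simp only: absolutely_integrable_on_Ioo_iff)
qed

end

text \<open>Backward differences look to the left of \<open>s\<close>, so the step lengths must keep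
  them inside (a,b). The ends of [a,b] are recovered afterwards by continuity.\<close>

locale weak_path_window = weak_path \<iota> p q a b w W D k
  for \<iota> :: "'v::{banach, second_countable_topology} \<Rightarrow>\<^sub>L 'h::real_inner"
    and p q a b :: real and w :: "real \<Rightarrow> 'h" and W :: "real \<Rightarrow> 'v" and D :: "real \<Rightarrow> ('v \<Rightarrow>\<^sub>L real)"
    and k :: "real \<Rightarrow> real" +
  fixes s t :: real and \<delta> :: "nat \<Rightarrow> real"
  assumes st: "a < s" "s \<le> t" "t < b"
    and \<delta>: "\<And>n. 0 < \<delta> n" "\<And>n. a < s - \<delta> n" "\<delta> \<longlonglongrightarrow> 0"
begin

text \<open>The backward difference quotient of \<open>w\<close> as a functional on
  \<open>V\<close>; it is to converge to \<open>D\<close> in a weak sense.\<close>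

definition G :: "nat \<Rightarrow> real \<Rightarrow> ('v \<Rightarrow>\<^sub>L real)" where
  "G n r = (1 / \<delta> n) *\<^sub>R to_dual \<iota> (w r - w (r - \<delta> n))"

definition K :: real where "K = integral {a..b} (\<lambda>r. k r powr q)"

lemma G_apply: "G n r v = ((w r - w (r - \<delta> n)) \<bullet> \<iota> v) / \<delta> n"
  by (simp add: G_def blinfun.bilinear_simps to_dual_apply)

lemma w_cont': "continuous_on {s..t} w" "continuous_on {s..t} (\<lambda>r. w (r - \<delta> n))"
proof -
  show "continuous_on {s..t} w" by (rule continuous_on_subset[OF w_cont]) (use st in auto)
  show "continuous_on {s..t} (\<lambda>r. w (r - \<delta> n))"
    by (rule continuous_on_compose2[OF w_cont]) (use st \<delta>(1,2)[of n] in \<open>auto intro!: continuous_intros\<close>)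
qed

lemma G_meas: "(\<lambda>r. G n r v) \<in> borel_measurable (lebesgue_on {s..t})"
  unfolding G_apply
  by (intro continuous_imp_measurable_on_sets_lebesgue continuous_intros w_cont') (use \<delta>(1)[of n] in auto)

lemma D_integrable: "(\<lambda>r. D r v) absolutely_integrable_on {a..b}"
proof -
  have i: "(\<lambda>r. (1 + k r powr q) * norm v) integrable_on {a<..<b}"
    using k_int by (intro integrable_on_mult_left integrable_add)
      (auto simp: absolutely_integrable_on_def integrable_on_open_interval_real)
  have "(\<lambda>r. D r v) absolutely_integrable_on {a<..<b}"
  proof (rule measurable_bounded_by_integrable_imp_absolutely_integrable[OF _ _ i])
    fix r
    have "norm (D r v) \<le> norm (D r) * norm v" by (rule norm_blinfun)
    also have "\<dots> \<le> (1 + k r powr q) * norm v"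
      using D_le[of r] le_one_plus_powr[of "k r" q] k_nonneg[of r] pq by (intro mult_right_mono) auto
    finally show "norm (D r v) \<le> (1 + k r powr q) * norm v" .
  qed (auto intro: D_meas)
  then show ?thesis by (simp only: absolutely_integrable_on_Ioo_iff)
qed

definition kint :: "real \<Rightarrow> real" where "kint r = integral {a..r} (\<lambda>r. k r powr q)"

lemma kq_integrable: "c \<ge> a \<Longrightarrow> d \<le> b \<Longrightarrow> (\<lambda>r. k r powr q) integrable_on {c..d}"
  using absolutely_integrable_on_subinterval[OF k_int, of c d] by (auto simp: absolutely_integrable_on_def)

lemma kint_cont: "continuous_on {a..b} kint"
  unfolding kint_def by (intro indefinite_integral_continuous_1 kq_integrable) auto

lemma kint_diff: "a \<le> c \<Longrightarrow> c \<le> d \<Longrightarrow> d \<le> b \<Longrightarrow> kint d - kint c = integral {c..d} (\<lambda>r. k r powr q)"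
  unfolding kint_def
  using Henstock_Kurzweil_Integration.integral_combine[of a c d "\<lambda>r. k r powr q"] kq_integrable[of a d] by simp

lemma kint_bounds: "a \<le> r \<Longrightarrow> r \<le> b \<Longrightarrow> 0 \<le> kint r \<and> kint r \<le> K"
proof -
  assume r: "a \<le> r" "r \<le> b"
  have "kint b - kint r \<ge> 0" using r by (subst kint_diff) (auto intro!: integral_nonneg kq_integrable)
  moreover have "kint r \<ge> 0" unfolding kint_def using r by (intro integral_nonneg kq_integrable) auto
  ultimately show ?thesis by (simp add: kint_def K_def)
qed

text \<open>The quotient is the mean of \<open>D\<close> over a window that ends at
  \<open>r\<close>. Young's inequality under the integral leaves the mean of
  \<open>k powr q\<close>, written as a difference quotient of its primitive
  \<open>kint\<close>.\<close>

lemma G_bound: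
  assumes C: "\<And>x y. x \<ge> 0 \<Longrightarrow> y \<ge> 0 \<Longrightarrow> x * y \<le> \<theta> * x powr q + C * y powr p"
    and r: "r \<in> {s..t}"
  shows "\<bar>G n r v\<bar> \<le> \<theta> * ((kint r - kint (r - \<delta> n)) / \<delta> n) + C * norm v powr p"
proof -
  have d: "a \<le> r - \<delta> n" "r - \<delta> n \<le> r" "r \<le> b" using r \<delta>(1,2)[of n] st by auto
  have i: "(\<lambda>\<rho>. \<theta> * k \<rho> powr q + C * norm v powr p) integrable_on {r - \<delta> n..r}"
    using d by (intro integrable_add integrable_on_mult_right kq_integrable) auto
  have "\<bar>(w r - w (r - \<delta> n)) \<bullet> \<iota> v\<bar> = norm (integral {r - \<delta> n..r} (\<lambda>\<rho>. D \<rho> v))"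
    using weak[OF d, of v] by simp
  also have "\<dots> \<le> integral {r - \<delta> n..r} (\<lambda>\<rho>. \<theta> * k \<rho> powr q + C * norm v powr p)"
  proof (rule integral_norm_bound_integral[OF _ i])
    show "(\<lambda>\<rho>. D \<rho> v) integrable_on {r - \<delta> n..r}"
      using absolutely_integrable_on_subinterval[OF D_integrable[of v], of "r - \<delta> n" r] d
      by (auto simp: absolutely_integrable_on_def)
    fix \<rho>
    have "norm (D \<rho> v) \<le> norm (D \<rho>) * norm v" by (rule norm_blinfun)
    also have "\<dots> \<le> k \<rho> * norm v" by (intro mult_right_mono D_le) auto
    also have "\<dots> \<le> \<theta> * k \<rho> powr q + C * norm v powr p" by (intro C k_nonneg) auto
    finally show "norm (D \<rho> v) \<le> \<theta> * k \<rho> powr q + C * norm v powr p" .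
  qed
  also have "\<dots> = \<theta> * (kint r - kint (r - \<delta> n)) + \<delta> n * (C * norm v powr p)"
  proof -
    have "(\<lambda>\<rho>. \<theta> * k \<rho> powr q) integrable_on {r - \<delta> n..r}"
      using d by (intro integrable_on_mult_right kq_integrable) auto
    then have "integral {r - \<delta> n..r} (\<lambda>\<rho>. \<theta> * k \<rho> powr q + C * norm v powr p)
        = integral {r - \<delta> n..r} (\<lambda>\<rho>. \<theta> * k \<rho> powr q) + integral {r - \<delta> n..r} (\<lambda>\<rho>. C * norm v powr p)"
      by (intro integral_add integrable_const_ivl)
    then show ?thesis using d \<delta>(1)[of n] by (simp add: kint_diff)
  qed
  finally have "\<bar>G n r v\<bar> \<le> (\<theta> * (kint r - kint (r - \<delta> n)) + \<delta> n * (C * norm v powr p)) / \<delta> n"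
    unfolding G_apply using \<delta>(1)[of n] by (simp add: abs_divide divide_right_mono)
  then show ?thesis using \<delta>(1)[of n] by (simp add: add_divide_distrib)
qed

text \<open>The bound must not depend on \<open>n\<close>. By \<open>integral_increment\<close> the
  integral equals the mean of \<open>kint\<close> over a window before \<open>t\<close> minus the
  one before \<open>s\<close>, and \<open>kint\<close> takes values between 0 and
  \<open>K\<close>.\<close>

lemma kint_quotient_integral:
  "(\<lambda>r. (kint r - kint (r - \<delta> n)) / \<delta> n) integrable_on {s..t}"
  "integral {s..t} (\<lambda>r. (kint r - kint (r - \<delta> n)) / \<delta> n) \<le> K"
proof -
  have c: "continuous_on {s..t} kint" "continuous_on {s..t} (\<lambda>r. kint (r - \<delta> n))"
    using st \<delta>(1,2)[of n]
    by (auto intro!: continuous_on_subset[OF kint_cont] continuous_on_compose2[OF kint_cont] continuous_intros)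
  show "(\<lambda>r. (kint r - kint (r - \<delta> n)) / \<delta> n) integrable_on {s..t}"
    using \<delta>(1)[of n] by (intro integrable_continuous_real continuous_intros c) auto
  let ?\<Phi> = "\<lambda>r. integral {a..r} kint"
  have ki: "kint integrable_on {c..d}" if "a \<le> c" "d \<le> b" for c d
    using that by (intro integrable_continuous_real continuous_on_subset[OF kint_cont]) auto
  have mono: "0 \<le> ?\<Phi> c - ?\<Phi> (c - \<delta> n) \<and> ?\<Phi> c - ?\<Phi> (c - \<delta> n) \<le> \<delta> n * K" if "a \<le> c - \<delta> n" "c \<le> b" for c
  proof -
    have eq: "?\<Phi> c - ?\<Phi> (c - \<delta> n) = integral {c - \<delta> n..c} kint"
      using Henstock_Kurzweil_Integration.integral_combine[of a "c - \<delta> n" c kint] that \<delta>(1)[of n] ki[of a c] by simp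
    have "integral {c - \<delta> n..c} kint \<le> integral {c - \<delta> n..c} (\<lambda>_. K)"
      using that kint_bounds by (intro integral_le ki) auto
    moreover have "0 \<le> integral {c - \<delta> n..c} kint"
      using that kint_bounds by (intro integral_nonneg ki) auto
    ultimately show ?thesis using eq \<delta>(1)[of n] by simp
  qed
  have "integral {s..t} (\<lambda>r. (kint r - kint (r - \<delta> n)) / \<delta> n) = ((?\<Phi> t - ?\<Phi> (t - \<delta> n)) - (?\<Phi> s - ?\<Phi> (s - \<delta> n))) / \<delta> n"
    using integral_increment[OF kint_cont, of "\<delta> n" s t] \<delta>(1,2)[of n] st by simp
  also have "\<dots> \<le> (\<delta> n * K) / \<delta> n"
    using mono[of t] mono[of s] st \<delta>(1,2)[of n] by (intro divide_right_mono) auto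
  also have "\<dots> = K" using \<delta>(1)[of n] by simp
  finally show "integral {s..t} (\<lambda>r. (kint r - kint (r - \<delta> n)) / \<delta> n) \<le> K" .
qed

definition Lp_window :: "(real \<Rightarrow> 'v) \<Rightarrow> bool" where
  "Lp_window g \<longleftrightarrow> g \<in> borel_measurable (lebesgue_on {s..t}) \<and> (\<lambda>r. norm (g r) powr p) integrable_on {s..t}"

definition defect :: "nat \<Rightarrow> (real \<Rightarrow> 'v) \<Rightarrow> real" where
  "defect n g = integral {s..t} (\<lambda>r. G n r (g r) - D r (g r))"

text \<open>Both terms are estimated by Young's inequality with the same weight \<theta>. The result
  is uniform in \<open>n\<close>, so that limits in \<open>g\<close> and in \<open>n\<close> can be
  interchanged.\<close>

lemma defect_bound:
  assumes g: "Lp_window g" and "\<theta> > 0" "C > 0"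
    and C: "\<And>x y. x \<ge> 0 \<Longrightarrow> y \<ge> 0 \<Longrightarrow> x * y \<le> \<theta> * x powr q + C * y powr p"
  shows "(\<lambda>r. G n r (g r) - D r (g r)) absolutely_integrable_on {s..t}"
    and "\<bar>defect n g\<bar> \<le> 2 * (\<theta> * K + C * integral {s..t} (\<lambda>r. norm (g r) powr p))"
proof -
  let ?B = "\<lambda>r. (\<theta> * ((kint r - kint (r - \<delta> n)) / \<delta> n) + C * norm (g r) powr p) + (\<theta> * k r powr q + C * norm (g r) powr p)"
  have gi: "(\<lambda>r. norm (g r) powr p) integrable_on {s..t}" using g by (simp add: Lp_window_def)
  have ki: "(\<lambda>r. k r powr q) integrable_on {s..t}" using st by (intro kq_integrable) auto
  have i: "?B integrable_on {s..t}"
    by (intro integrable_add integrable_on_mult_right gi ki kint_quotient_integral)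
  have le: "norm (G n r (g r) - D r (g r)) \<le> ?B r" if "r \<in> {s..t}" for r
  proof -
    have "norm (D r (g r)) \<le> norm (D r) * norm (g r)" by (rule norm_blinfun)
    also have "\<dots> \<le> k r * norm (g r)" by (intro mult_right_mono D_le) auto
    also have "\<dots> \<le> \<theta> * k r powr q + C * norm (g r) powr p" by (intro C k_nonneg) auto
    finally show ?thesis using G_bound[OF C that, of n "g r"] by simp
  qed
  show *: "(\<lambda>r. G n r (g r) - D r (g r)) absolutely_integrable_on {s..t}"
  proof (rule measurable_bounded_by_integrable_imp_absolutely_integrable[OF _ _ i le])
    have Dm: "(\<lambda>r. D r v) \<in> borel_measurable (lebesgue_on {s..t})" for v
      using D_meas st(1,3) by (rule measurable_Icc)
    have gm: "g \<in> borel_measurable (lebesgue_on {s..t})" using g by (simp add: Lp_window_def)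
    show "(\<lambda>r. G n r (g r) - D r (g r)) \<in> borel_measurable (lebesgue_on {s..t})"
      by (rule borel_measurable_diff[OF borel_measurable_weak_apply[OF G_meas gm] borel_measurable_weak_apply[OF Dm gm]])
  qed auto
  have "\<bar>defect n g\<bar> \<le> integral {s..t} ?B"
    unfolding defect_def using * integral_norm_bound_integral[OF _ i le]
    by (auto simp: absolutely_integrable_on_def)
  also have "\<dots> = \<theta> * integral {s..t} (\<lambda>r. (kint r - kint (r - \<delta> n)) / \<delta> n) + \<theta> * integral {s..t} (\<lambda>r. k r powr q)
      + 2 * C * integral {s..t} (\<lambda>r. norm (g r) powr p)"
  proof -
    have "(\<lambda>r. \<theta> * ((kint r - kint (r - \<delta> n)) / \<delta> n)) integrable_on {s..t}" "(\<lambda>r. \<theta> * k r powr q) integrable_on {s..t}"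
      "(\<lambda>r. C * norm (g r) powr p) integrable_on {s..t}"
      by (intro integrable_on_mult_right gi ki kint_quotient_integral)+
    then show ?thesis by (simp only: integral_add integrable_add integral_mult_right)
  qed
  also have "\<dots> \<le> \<theta> * K + \<theta> * K + 2 * C * integral {s..t} (\<lambda>r. norm (g r) powr p)"
  proof -
    have "integral {s..t} (\<lambda>r. k r powr q) \<le> K"
      using kint_bounds[of t] kint_bounds[of s] kint_diff[of s t] st by auto
    then show ?thesis using \<open>\<theta> > 0\<close> \<open>C > 0\<close> by (intro add_mono mult_left_mono kint_quotient_integral(2)) auto
  qed
  finally show "\<bar>defect n g\<bar> \<le> 2 * (\<theta> * K + C * integral {s..t} (\<lambda>r. norm (g r) powr p))" by simp
qed

lemma defect_integrable: "Lp_window g \<Longrightarrow> (\<lambda>r. G n r (g r) - D r (g r)) integrable_on {s..t}"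
proof -
  assume g: "Lp_window g"
  obtain C where C: "C > 0" "\<And>x y. x \<ge> 0 \<Longrightarrow> y \<ge> 0 \<Longrightarrow> x * y \<le> 1 * x powr q + C * y powr p"
    using Young_eps[OF pq zero_less_one] by blast
  show ?thesis
    using defect_bound(1)[OF g zero_less_one C] by (simp add: absolutely_integrable_on_def)
qed

text \<open>The functions \<open>g\<close> against which the quotients \<open>G n\<close> converge
  to \<open>D\<close>. The aim is \<open>nice_W\<close>, reached from indicators of half-lines by
  linearity, an induction over Borel sets and dominated limits.\<close>

definition nice :: "(real \<Rightarrow> 'v) \<Rightarrow> bool" where
  "nice g \<longleftrightarrow> Lp_window g \<and> (\<lambda>n. defect n g) \<longlonglongrightarrow> 0"

section \<open>Closure properties of the class \<open>nice\<close>\<close>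

lemma K_nonneg: "K \<ge> 0"
  unfolding K_def by (intro integral_nonneg kq_integrable) auto

lemma Lp_window_dominated:
  assumes g: "g \<in> borel_measurable (lebesgue_on {s..t})" and h: "(\<lambda>r. h r) integrable_on {s..t}"
    and le: "\<And>r. r \<in> {s..t} \<Longrightarrow> norm (g r) powr p \<le> h r"
  shows "Lp_window g"
proof -
  have "(\<lambda>r. norm (g r) powr p) \<in> borel_measurable (lebesgue_on {s..t})"
    using borel_measurable_norm'[OF g] by measurable
  then have "(\<lambda>r. norm (g r) powr p) absolutely_integrable_on {s..t}"
    by (rule measurable_bounded_by_integrable_imp_absolutely_integrable[OF _ _ h]) (use le in auto)
  with g show ?thesis by (simp add: Lp_window_def absolutely_integrable_on_def)
qed

lemma Lp_window_add:
  assumes g: "Lp_window g" and h: "Lp_window h"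
  shows "Lp_window (\<lambda>r. g r + h r)"
proof (rule Lp_window_dominated)
  show "(\<lambda>r. g r + h r) \<in> borel_measurable (lebesgue_on {s..t})"
    using g h by (intro borel_measurable_add) (simp_all add: Lp_window_def)
  show "(\<lambda>r. 2 powr p * (norm (g r) powr p + norm (h r) powr p)) integrable_on {s..t}"
    using g h by (intro integrable_on_mult_right integrable_add) (auto simp: Lp_window_def)
  fix r
  have "norm (g r + h r) powr p \<le> (norm (g r) + norm (h r)) powr p"
    using pq by (intro powr_mono2 norm_triangle_ineq) auto
  also have "\<dots> \<le> 2 powr p * (norm (g r) powr p + norm (h r) powr p)" using pq by (intro powr_sum_le) auto
  finally show "norm (g r + h r) powr p \<le> 2 powr p * (norm (g r) powr p + norm (h r) powr p)" .
qed

lemma Lp_window_uminus: "Lp_window g \<Longrightarrow> Lp_window (\<lambda>r. - g r)"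
  by (simp add: Lp_window_def)

lemma defect_add: "Lp_window g \<Longrightarrow> Lp_window h \<Longrightarrow> defect n (\<lambda>r. g r + h r) = defect n g + defect n h"
  unfolding defect_def using defect_integrable[of g n] defect_integrable[of h n]
  by (subst integral_add[symmetric]) (auto simp: blinfun.bilinear_simps intro!: integral_cong)

lemma defect_uminus: "defect n (\<lambda>r. - g r) = - defect n g"
  unfolding defect_def by (subst integral_neg[symmetric]) (simp add: blinfun.bilinear_simps)

lemma nice_add: "nice g \<Longrightarrow> nice h \<Longrightarrow> nice (\<lambda>r. g r + h r)"
  unfolding nice_def using Lp_window_add[of g h] tendsto_add[of "\<lambda>n. defect n g" 0 sequentially "\<lambda>n. defect n h" 0]
  by (simp add: defect_add)

lemma nice_uminus: "nice g \<Longrightarrow> nice (\<lambda>r. - g r)"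
  unfolding nice_def using Lp_window_uminus[of g] tendsto_minus[of "\<lambda>n. defect n g" 0 sequentially]
  by (simp add: defect_uminus)

lemma nice_diff: "nice g \<Longrightarrow> nice h \<Longrightarrow> nice (\<lambda>r. g r - h r)"
  using nice_add[of g "\<lambda>r. - h r"] nice_uminus[of h] by simp

lemma nice_0: "nice (\<lambda>r. 0)"
  using pq by (simp add: nice_def Lp_window_def defect_def blinfun.bilinear_simps integrable_0)

lemma nice_sum: "finite I \<Longrightarrow> (\<And>i. i \<in> I \<Longrightarrow> nice (f i)) \<Longrightarrow> nice (\<lambda>r. \<Sum>i\<in>I. f i r)"
  by (induction I rule: finite_induct) (auto intro: nice_0 nice_add)

lemma nice_spike:
  assumes g: "nice g" and h: "h \<in> borel_measurable (lebesgue_on {s..t})"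
    and N: "negligible N" and eq: "\<And>r. r \<in> {s..t} - N \<Longrightarrow> h r = g r"
  shows "nice h"
proof -
  have "(\<lambda>r. norm (h r) powr p) integrable_on {s..t}"
    by (rule integrable_spike[OF _ N, of "\<lambda>r. norm (g r) powr p"]) (use g eq in \<open>auto simp: nice_def Lp_window_def\<close>)
  moreover have "defect n h = defect n g" for n
    unfolding defect_def by (rule integral_spike[OF N]) (use eq in auto)
  ultimately show ?thesis using g h by (simp add: nice_def Lp_window_def)
qed

text \<open>The order of choices is \<theta>, small against \<open>K\<close>, which fixes
  \<open>C\<close>; then \<open>j\<close>, so that \<open>g\<close> and \<open>f j\<close> are close
  in Lp; then \<open>n\<close> for that \<open>j\<close>. The factor 2 in the domination is the one
  that comes with simple approximations of a measurable function.\<close>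

lemma nice_lim:
  assumes f: "\<And>j. nice (f j)" and g: "Lp_window g"
    and lim: "\<And>r. r \<in> {s..t} \<Longrightarrow> (\<lambda>j. f j r) \<longlonglongrightarrow> g r"
    and le: "\<And>j r. r \<in> {s..t} \<Longrightarrow> norm (f j r) \<le> 2 * norm (g r)"
  shows "nice g"
  unfolding nice_def
proof (intro conjI g LIMSEQ_I)
  fix e :: real assume "e > 0"
  \<comment> \<open>With this weight and the \<open>j\<close> chosen below,
    \<open>defect_bound\<close> yields at most \<open>2 * (e / 8 + e / 8)\<close>, that is
    \<open>e / 2\<close>.\<close>
  define \<theta> where "\<theta> = e / (8 * (K + 1))"
  have "\<theta> > 0" using \<open>e > 0\<close> K_nonneg by (simp add: \<theta>_def)
  then obtain C where C: "C > 0" "\<And>x y. x \<ge> 0 \<Longrightarrow> y \<ge> 0 \<Longrightarrow> x * y \<le> \<theta> * x powr q + C * y powr p"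
    using Young_eps[OF pq] by blast
  have d: "Lp_window (\<lambda>r. g r - f j r)" for j
    using Lp_window_add[OF g Lp_window_uminus, of "f j"] f[of j] by (simp add: nice_def)
  have "(\<lambda>j. integral {s..t} (\<lambda>r. norm (g r - f j r) powr p)) \<longlonglongrightarrow> integral {s..t} (\<lambda>r. 0)"
  proof (rule dominated_convergence)
    show "(\<lambda>r. norm (g r - f j r) powr p) integrable_on {s..t}" for j using d by (simp add: Lp_window_def)
    show "(\<lambda>r. 3 powr p * norm (g r) powr p) integrable_on {s..t}"
      using g by (intro integrable_on_mult_right) (simp add: Lp_window_def)
    show "norm (norm (g r - f j r) powr p) \<le> 3 powr p * norm (g r) powr p" if "r \<in> {s..t}" for j r
    proof -
      have "norm (g r - f j r) \<le> 3 * norm (g r)" using norm_triangle_ineq4[of "g r" "f j r"] le[OF that, of j] by simp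
      then have "norm (g r - f j r) powr p \<le> (3 * norm (g r)) powr p" using pq by (intro powr_mono2) auto
      then show ?thesis by (simp add: powr_mult)
    qed
    show "(\<lambda>j. norm (g r - f j r) powr p) \<longlonglongrightarrow> 0" if "r \<in> {s..t}" for r
    proof -
      have "(\<lambda>j. g r - f j r) \<longlonglongrightarrow> 0"
        using tendsto_diff[OF tendsto_const lim[OF that], of "g r"] by simp
      then have "(\<lambda>j. norm (g r - f j r)) \<longlonglongrightarrow> 0" by (rule tendsto_norm_zero)
      from tendsto_zero_powrI[OF this tendsto_const] show ?thesis using pq by simp
    qed
  qed
  then have "(\<lambda>j. integral {s..t} (\<lambda>r. norm (g r - f j r) powr p)) \<longlonglongrightarrow> 0" by simp
  then have "\<forall>\<^sub>F j in sequentially. integral {s..t} (\<lambda>r. norm (g r - f j r) powr p) < e / (8 * C)"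
    using \<open>e > 0\<close> C(1) by (intro order_tendstoD(2)) auto
  then obtain j where j: "integral {s..t} (\<lambda>r. norm (g r - f j r) powr p) < e / (8 * C)"
    by (metis (no_types, lifting) eventually_sequentially order_refl)
  have "\<bar>defect n (\<lambda>r. g r - f j r)\<bar> \<le> e / 2" for n
  proof -
    have "\<bar>defect n (\<lambda>r. g r - f j r)\<bar> \<le> 2 * (\<theta> * K + C * integral {s..t} (\<lambda>r. norm (g r - f j r) powr p))"
      by (rule defect_bound(2)[OF d \<open>\<theta> > 0\<close> C])
    also have "\<theta> * K \<le> e / 8"
      using K_nonneg \<open>e > 0\<close> by (simp add: \<theta>_def field_simps)
    also have "C * integral {s..t} (\<lambda>r. norm (g r - f j r) powr p) \<le> C * (e / (8 * C))"
      using j C(1) by (intro mult_left_mono) auto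
    also have "C * (e / (8 * C)) = e / 8" using C(1) by simp
    finally show ?thesis by simp
  qed
  moreover have "defect n g = defect n (f j) + defect n (\<lambda>r. g r - f j r)" for n
    using defect_add[of "f j" "\<lambda>r. g r - f j r" n] f[of j] d by (simp add: nice_def)
  moreover obtain n0 where "\<And>n. n \<ge> n0 \<Longrightarrow> \<bar>defect n (f j)\<bar> < e / 2"
    using LIMSEQ_D[of "\<lambda>n. defect n (f j)" 0 "e/2"] f[of j] \<open>e > 0\<close> by (auto simp: nice_def)
  ultimately show "\<exists>n0. \<forall>n\<ge>n0. norm (defect n g - 0) < e"
    by (intro exI[of _ n0]) (smt (verit, best) real_norm_def field_sum_of_halves)
qed

text \<open>For a fixed vector the defect is explicit: the difference quotients of the primitive of
  \<open>w r \<bullet> \<iota> v\<close> at the two ends converge to the values there, and the weak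
  formulation gives the integral of \<open>D\<close> the same difference.\<close>

lemma nice_interval: "nice (\<lambda>r. indicator {..c} r *\<^sub>R v)"
proof -
  have L: "Lp_window (\<lambda>r. indicator {..c} r *\<^sub>R v)"
  proof (rule Lp_window_dominated)
    have "(\<lambda>r. indicator {..c} r *\<^sub>R v) \<in> borel_measurable lebesgue"
      by (intro measurable_completion) simp
    then show "(\<lambda>r. indicator {..c} r *\<^sub>R v) \<in> borel_measurable (lebesgue_on {s..t})"
      by (rule measurable_restrict_space1)
    show "(\<lambda>r. norm v powr p) integrable_on {s..t}" by (rule integrable_const_ivl)
  qed (auto simp: indicator_def)
  have "(\<lambda>n. defect n (\<lambda>r. indicator {..c} r *\<^sub>R v)) \<longlonglongrightarrow> 0"
  proof (cases "c < s")
    case True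
    have "defect n (\<lambda>r. indicator {..c} r *\<^sub>R v) = 0" for n
      unfolding defect_def by (rule integral_unique, rule has_integral_is_0) (use True in \<open>auto simp: blinfun.bilinear_simps\<close>)
    then show ?thesis by simp
  next
    case False
    define e where "e = min c t"
    have e: "s \<le> e" "e \<le> t" using False st by (auto simp: e_def)
    let ?\<omega> = "\<lambda>r. w r \<bullet> \<iota> v"
    let ?\<Phi> = "\<lambda>r. integral {a..r} ?\<omega>"
    have \<omega>: "continuous_on {a..b} ?\<omega>" by (intro continuous_intros w_cont)
    have "defect n (\<lambda>r. indicator {..c} r *\<^sub>R v) =
       ((?\<Phi> e - ?\<Phi> (e - \<delta> n)) / \<delta> n - (?\<Phi> s - ?\<Phi> (s - \<delta> n)) / \<delta> n) - (?\<omega> e - ?\<omega> s)" for n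
    proof -
      have "defect n (\<lambda>r. indicator {..c} r *\<^sub>R v) = integral {s..t} (\<lambda>r. if r \<in> {s..e} then G n r v - D r v else 0)"
        unfolding defect_def by (intro integral_cong) (auto simp: e_def indicator_def blinfun.bilinear_simps)
      also have "\<dots> = integral {s..e} (\<lambda>r. G n r v - D r v)"
        using e by (subst integral_restrict_Int) (simp add: Int_absorb1 Int_absorb2)
      also have "\<dots> = integral {s..e} (\<lambda>r. G n r v) - integral {s..e} (\<lambda>r. D r v)"
      proof (rule integral_diff)
        have "continuous_on {s..e} w" "continuous_on {s..e} (\<lambda>r. w (r - \<delta> n))"
          using e by (auto intro: continuous_on_subset[OF w_cont'(1)] continuous_on_subset[OF w_cont'(2)])
        then show "(\<lambda>r. G n r v) integrable_on {s..e}"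
          unfolding G_apply using \<delta>(1)[of n] by (intro integrable_continuous_real continuous_intros) auto
        show "(\<lambda>r. D r v) integrable_on {s..e}"
          using absolutely_integrable_on_subinterval[OF D_integrable[of v], of s e] e st
          by (auto simp: absolutely_integrable_on_def)
      qed
      also have "integral {s..e} (\<lambda>r. D r v) = ?\<omega> e - ?\<omega> s"
        using weak[of s e v] e st by (simp add: inner_diff_left)
      also have "integral {s..e} (\<lambda>r. G n r v) = integral {s..e} (\<lambda>r. ?\<omega> r - ?\<omega> (r - \<delta> n)) / \<delta> n"
        by (simp add: G_apply inner_diff_left)
      also have "integral {s..e} (\<lambda>r. ?\<omega> r - ?\<omega> (r - \<delta> n)) = (?\<Phi> e - ?\<Phi> (e - \<delta> n)) - (?\<Phi> s - ?\<Phi> (s - \<delta> n))"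
        using e st \<delta>(1,2)[of n] by (intro integral_increment[OF \<omega>]) auto
      finally show ?thesis by (simp add: diff_divide_distrib)
    qed
    moreover have "(\<lambda>n. ((?\<Phi> e - ?\<Phi> (e - \<delta> n)) / \<delta> n - (?\<Phi> s - ?\<Phi> (s - \<delta> n)) / \<delta> n) - (?\<omega> e - ?\<omega> s))
        \<longlonglongrightarrow> (?\<omega> e - ?\<omega> s) - (?\<omega> e - ?\<omega> s)"
      using e st by (intro tendsto_intros difference_quotient_tendsto[OF \<omega>] \<delta>) auto
    ultimately show ?thesis by simp
  qed
  with L show ?thesis by (simp add: nice_def)
qed

lemma nice_const: "nice (\<lambda>r. v)"
proof (rule nice_spike[OF nice_interval[of t v], of _ "{}"])
qed (auto simp: indicator_def)

lemma Lp_window_indicator: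
  assumes "E \<in> sets lebesgue"
  shows "Lp_window (\<lambda>r. indicator E r *\<^sub>R v)"
proof (rule Lp_window_dominated)
  have "(\<lambda>r. indicator E r *\<^sub>R v) \<in> borel_measurable lebesgue"
    using assms by simp
  then show "(\<lambda>r. indicator E r *\<^sub>R v) \<in> borel_measurable (lebesgue_on {s..t})"
    by (rule measurable_restrict_space1)
  show "(\<lambda>r. norm v powr p) integrable_on {s..t}" by (rule integrable_const_ivl)
qed (auto simp: indicator_def)

text \<open>Half-lines form an intersection-stable generator of the Borel sets; complements are
  covered by linearity, disjoint unions by \<open>nice_lim\<close>.\<close>

lemma nice_borel: "E \<in> sets borel \<Longrightarrow> nice (\<lambda>r. indicator E r *\<^sub>R v)"
proof -
  assume "E \<in> sets borel"
  then have E: "E \<in> sigma_sets UNIV (range (\<lambda>c::real. {..c}))"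
    by (simp add: borel_eq_atMost)
  have "Int_stable (range (\<lambda>c::real. {..c}))"
    by (auto simp: Int_stable_def)
  then show ?thesis using subset_UNIV[of "range (\<lambda>c::real. {..c})", folded Pow_UNIV] E
  proof (induction rule: sigma_sets_induct_disjoint)
    case (basic A)
    then show ?case using nice_interval by auto
  next
    case empty
    then show ?case using nice_0 by simp
  next
    case (compl A)
    have "nice (\<lambda>r. v - indicator A r *\<^sub>R v)" by (intro nice_diff nice_const compl)
    moreover have "(\<lambda>r. indicator (UNIV - A) r *\<^sub>R v) = (\<lambda>r. v - indicator A r *\<^sub>R v)"
      by (auto simp: indicator_def fun_eq_iff)
    ultimately show ?case by simp
  next
    case (union A)
    have "A i \<in> sets borel" for i using union.hyps(2) by (auto simp: borel_eq_atMost)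
    then have A: "A i \<in> sets lebesgue" for i by (intro sets_completionI_sets) simp
    have eq: "indicator (\<Union>i<j. A i) r *\<^sub>R v = (\<Sum>i<j. indicator (A i) r *\<^sub>R v)" for j r
      using union(1)
      by (subst indicator_UN_disjoint) (auto simp: disjoint_family_on_def scaleR_sum_left)
    show ?case
    proof (rule nice_lim[where f="\<lambda>j r. indicator (\<Union>i<j. A i) r *\<^sub>R v"])
      show "nice (\<lambda>r. indicator (\<Union>i<j. A i) r *\<^sub>R v)" for j
        unfolding eq by (intro nice_sum union) auto
      show "Lp_window (\<lambda>r. indicator (\<Union>i. A i) r *\<^sub>R v)"
        using A by (intro Lp_window_indicator) auto
      show "(\<lambda>j. indicator (\<Union>i<j. A i) r *\<^sub>R v) \<longlonglongrightarrow> indicator (\<Union>i. A i) r *\<^sub>R v" for r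
        by (intro tendsto_scaleR tendsto_const LIMSEQ_indicator_UN)
      show "norm (indicator (\<Union>i<j. A i) r *\<^sub>R v) \<le> 2 * norm (indicator (\<Union>i. A i) r *\<^sub>R v)" for j r
        by (auto simp: indicator_def)
    qed
  qed
qed

text \<open>A Lebesgue set differs from a Borel set only within a null set, which the integrals do
  not see.\<close>

lemma nice_lebesgue:
  assumes "E \<in> sets lebesgue"
  shows "nice (\<lambda>r. indicator E r *\<^sub>R v)"
proof -
  obtain S N N' where E: "E = S \<union> N" "N \<subseteq> N'" "N' \<in> null_sets lborel" "S \<in> sets lborel"
    using assms by (rule sets_completionE)
  show ?thesis
  proof (rule nice_spike[OF nice_borel])
    show "S \<in> sets borel" using E by simp
    show "(\<lambda>r. indicator E r *\<^sub>R v) \<in> borel_measurable (lebesgue_on {s..t})"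
      using Lp_window_indicator[OF assms] by (simp add: Lp_window_def)
    show "negligible N'" using E(3) by (simp add: negligible_iff_null_sets null_sets_completionI)
  qed (use E in \<open>auto simp: indicator_def\<close>)
qed

lemma nice_simple:
  assumes "simple_function (lebesgue_on {s..t}) f"
  shows "nice f"
proof -
  let ?M = "lebesgue_on {s..t}"
  have fin: "finite (f ` space ?M)" using assms by (simp add: simple_function_def)
  have sets: "f -` {c} \<inter> space ?M \<in> sets lebesgue" if "c \<in> f ` space ?M" for c
    using assms that by (auto simp: simple_function_def sets_restrict_space_iff)
  have "nice (\<lambda>r. \<Sum>c\<in>f ` space ?M. indicator (f -` {c} \<inter> space ?M) r *\<^sub>R c)"
    by (intro nice_sum fin nice_lebesgue sets)
  then show ?thesis
  proof (rule nice_spike[where N="{}"])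
    show "f \<in> borel_measurable ?M" using assms by (rule borel_measurable_simple_function)
    fix r assume r: "r \<in> {s..t} - {}"
    then have "(\<Sum>c\<in>f ` space ?M. indicator (f -` {c} \<inter> space ?M) r *\<^sub>R c) = (\<Sum>c\<in>f ` space ?M. if c = f r then c else 0)"
      by (intro sum.cong) (auto simp: indicator_def)
    also have "\<dots> = f r" using fin r by (simp add: sum.delta)
    finally show "f r = (\<Sum>c\<in>f ` space ?M. indicator (f -` {c} \<inter> space ?M) r *\<^sub>R c)" ..
  qed simp
qed

lemma nice_W: "nice W"
proof -
  have "W \<in> borel_measurable (lebesgue_on {s..t})" using W_meas st(1,3) by (rule measurable_Icc)
  moreover from borel_measurable_implies_sequence_metric[OF this, of 0] obtain f where
    f: "\<forall>i. simple_function (lebesgue_on {s..t}) (f i)"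
      "\<forall>x\<in>{s..t}. (\<lambda>i. f i x) \<longlonglongrightarrow> W x"
      "\<forall>i. \<forall>x\<in>{s..t}. norm (f i x) \<le> 2 * norm (W x)"
    by auto
  moreover have "(\<lambda>r. norm (W r) powr p) integrable_on {s..t}"
    using absolutely_integrable_on_subinterval[OF W_int, of s t] st by (auto simp: absolutely_integrable_on_def)
  ultimately show ?thesis
    by - (rule nice_lim[where f=f]; simp add: nice_simple Lp_window_def)
qed

text \<open>The inequality \<open>\<bar>a\<bar>\<^sup>2 - \<bar>b\<bar>\<^sup>2 \<le> 2 (a - b,
  a)\<close> is used with \<open>a = w r\<close> and \<open>b = w (r - \<delta> n)\<close>. The
  quotient is thereby paired with \<open>W r\<close>, so \<open>nice_W\<close> identifies the limit
  on the right, while continuity of \<open>w\<close> gives the boundary values on the left.\<close>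

lemma energy_window: "(norm (w t))\<^sup>2 - (norm (w s))\<^sup>2 \<le> 2 * integral {s..t} (\<lambda>r. D r (W r))"
proof (rule LIMSEQ_le)
  let ?\<omega> = "\<lambda>r. (norm (w r))\<^sup>2"
  let ?\<Phi> = "\<lambda>r. integral {a..r} ?\<omega>"
  have \<omega>: "continuous_on {a..b} ?\<omega>" by (intro continuous_intros w_cont)
  show "(\<lambda>n. (?\<Phi> t - ?\<Phi> (t - \<delta> n)) / \<delta> n - (?\<Phi> s - ?\<Phi> (s - \<delta> n)) / \<delta> n) \<longlonglongrightarrow> ?\<omega> t - ?\<omega> s"
    using st by (intro tendsto_intros difference_quotient_tendsto[OF \<omega>] \<delta>) auto
  have "(\<lambda>n. 2 * (defect n W + integral {s..t} (\<lambda>r. D r (W r)))) \<longlonglongrightarrow> 2 * (0 + integral {s..t} (\<lambda>r. D r (W r)))"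
    using nice_W by (intro tendsto_intros) (simp add: nice_def)
  then show "(\<lambda>n. 2 * (defect n W + integral {s..t} (\<lambda>r. D r (W r)))) \<longlonglongrightarrow> 2 * integral {s..t} (\<lambda>r. D r (W r))"
    by simp
  have "(?\<Phi> t - ?\<Phi> (t - \<delta> n)) / \<delta> n - (?\<Phi> s - ?\<Phi> (s - \<delta> n)) / \<delta> n \<le> 2 * (defect n W + integral {s..t} (\<lambda>r. D r (W r)))" for n
  proof -
    have "(?\<Phi> t - ?\<Phi> (t - \<delta> n)) / \<delta> n - (?\<Phi> s - ?\<Phi> (s - \<delta> n)) / \<delta> n = integral {s..t} (\<lambda>r. ?\<omega> r - ?\<omega> (r - \<delta> n)) / \<delta> n"
      using integral_increment[OF \<omega>, of "\<delta> n" s t] st \<delta>(1,2)[of n] by (simp add: diff_divide_distrib)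
    also have "\<dots> = integral {s..t} (\<lambda>r. (?\<omega> r - ?\<omega> (r - \<delta> n)) / \<delta> n)" by simp
    also have "\<dots> \<le> integral {s..t} (\<lambda>r. 2 * (((w r - w (r - \<delta> n)) \<bullet> w r) / \<delta> n))"
    proof (rule integral_le)
      show "(\<lambda>r. (?\<omega> r - ?\<omega> (r - \<delta> n)) / \<delta> n) integrable_on {s..t}"
        "(\<lambda>r. 2 * (((w r - w (r - \<delta> n)) \<bullet> w r) / \<delta> n)) integrable_on {s..t}"
        using \<delta>(1)[of n] by (auto intro!: integrable_continuous_real continuous_intros w_cont')
      fix r
      \<comment> \<open>The discarded square of the increment is what makes the result an
        inequality.\<close>
      have "0 \<le> (norm (w r - w (r - \<delta> n)))\<^sup>2" by simp
      then have "?\<omega> r - ?\<omega> (r - \<delta> n) \<le> 2 * ((w r - w (r - \<delta> n)) \<bullet> w r)"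
        by (simp add: power2_norm_eq_inner inner_diff_left inner_diff_right inner_commute)
      then show "(?\<omega> r - ?\<omega> (r - \<delta> n)) / \<delta> n \<le> 2 * (((w r - w (r - \<delta> n)) \<bullet> w r) / \<delta> n)"
        using divide_right_mono[of _ _ "\<delta> n"] \<delta>(1)[of n] by fastforce
    qed
    also have "\<dots> = 2 * integral {s..t} (\<lambda>r. ((w r - w (r - \<delta> n)) \<bullet> w r) / \<delta> n)" by simp
    also have "integral {s..t} (\<lambda>r. ((w r - w (r - \<delta> n)) \<bullet> w r) / \<delta> n) = integral {s..t} (\<lambda>r. G n r (W r))"
    proof (rule integral_cong_AE_Ioo)
      have "AE r in lebesgue_on {s<..<t}. w r = \<iota> (W r)"
        by (rule AE_lebesgue_on_subset[OF w_eq]) (use st in auto)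
      then show "AE r in lebesgue_on {s<..<t}. ((w r - w (r - \<delta> n)) \<bullet> w r) / \<delta> n = G n r (W r)"
        by eventually_elim (simp add: G_apply)
    qed
    also have "\<dots> = integral {s..t} (\<lambda>r. (G n r (W r) - D r (W r)) + D r (W r))" by simp
    also have "\<dots> = defect n W + integral {s..t} (\<lambda>r. D r (W r))"
      unfolding defect_def
    proof (rule integral_add)
      show "(\<lambda>r. G n r (W r) - D r (W r)) integrable_on {s..t}"
        using nice_W by (intro defect_integrable) (simp add: nice_def)
      show "(\<lambda>r. D r (W r)) integrable_on {s..t}"
        using absolutely_integrable_on_subinterval[OF D_W_integrable, of s t] st by (auto simp: absolutely_integrable_on_def)
    qed
    finally show ?thesis .
  qed
  then show "\<exists>N. \<forall>n\<ge>N. (?\<Phi> t - ?\<Phi> (t - \<delta> n)) / \<delta> n - (?\<Phi> s - ?\<Phi> (s - \<delta> n)) / \<delta> n \<le> 2 * (defect n W + integral {s..t} (\<lambda>r. D r (W r)))"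
    by blast
qed

end

context weak_path
begin

text \<open>The window argument works strictly inside (a,b). Both sides are continuous in the end
  points, so these are approached from inside.\<close>

lemma energy_inequality:
  assumes "a \<le> s" "s \<le> t" "t \<le> b"
  shows "(norm (w t))\<^sup>2 - (norm (w s))\<^sup>2 \<le> 2 * integral {s..t} (\<lambda>r. D r (W r))"
proof (cases "s = t")
  case False
  then have "s < t" using assms by simp
  have open_case: "(norm (w t))\<^sup>2 - (norm (w s))\<^sup>2 \<le> 2 * integral {s..t} (\<lambda>r. D r (W r))" if "a < s" "s \<le> t" "t < b" for s t
  proof -
    define \<delta> where "\<delta> n = (s - a) / (real n + 2)" for n :: nat
    interpret weak_path_window \<iota> p q a b w W D k s t \<delta>
    proof
      show "0 < \<delta> n" for n using that by (simp add: \<delta>_def)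
      have "(s - a) / (real n + 2) < (s - a) / 1" for n
        using that by (intro divide_strict_left_mono) auto
      then show "a < s - \<delta> n" for n by (simp add: \<delta>_def algebra_simps)
      show "\<delta> \<longlonglongrightarrow> 0" unfolding \<delta>_def by real_asymp
    qed (use that in auto)
    show ?thesis by (rule energy_window)
  qed
  \<comment> \<open>The denominator \<open>real n + 3\<close> keeps every shift positive and at most
    half the length, hence \<open>\<sigma> n \<le> \<tau> n\<close>.\<close>
  define \<sigma> where "\<sigma> n = s + (t - s) / (real n + 3)" for n :: nat
  define \<tau> where "\<tau> n = t - (t - s) / (real n + 3)" for n :: nat
  have pos: "(t - s) / (real n + 3) > 0" for n using \<open>s < t\<close> by simp
  have le: "(t - s) / (real n + 3) \<le> (t - s) / 2" for n using \<open>s < t\<close> by (intro divide_left_mono) auto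
  have n: "a < \<sigma> n" "\<sigma> n \<le> \<tau> n" "\<tau> n < b" for n
  proof -
    show "a < \<sigma> n" using pos[of n] assms unfolding \<sigma>_def by linarith
    show "\<tau> n < b" using pos[of n] assms unfolding \<tau>_def by linarith
    show "\<sigma> n \<le> \<tau> n" unfolding \<sigma>_def \<tau>_def using le[of n] by argo
  qed
  have lim: "\<sigma> \<longlonglongrightarrow> s" "\<tau> \<longlonglongrightarrow> t" unfolding \<sigma>_def \<tau>_def by real_asymp+
  let ?I = "\<lambda>r. integral {a..r} (\<lambda>r. D r (W r))"
  have DWi: "(\<lambda>r. D r (W r)) integrable_on {a..c}" if "c \<le> b" for c
    using absolutely_integrable_on_subinterval[OF D_W_integrable, of a c] that by (auto simp: absolutely_integrable_on_def)
  have I: "integral {c..d} (\<lambda>r. D r (W r)) = ?I d - ?I c" if "a \<le> c" "c \<le> d" "d \<le> b" for c d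
    using Henstock_Kurzweil_Integration.integral_combine[of a c d "\<lambda>r. D r (W r)"] that DWi[of d] by simp
  have cont: "continuous_on {a..b} ?I" by (intro indefinite_integral_continuous_1 DWi) simp
  have lims: "(\<lambda>n. f (\<sigma> n)) \<longlonglongrightarrow> f s" "(\<lambda>n. f (\<tau> n)) \<longlonglongrightarrow> f t" if "continuous_on {a..b} f" for f :: "real \<Rightarrow> real"
  proof -
    have "\<sigma> n \<in> {a..b}" "\<tau> n \<in> {a..b}" for n using n[of n] by auto
    then show "(\<lambda>n. f (\<sigma> n)) \<longlonglongrightarrow> f s" "(\<lambda>n. f (\<tau> n)) \<longlonglongrightarrow> f t"
      using assms by (auto intro!: continuous_on_tendsto_compose[OF that] lim)
  qed
  have wc: "continuous_on {a..b} (\<lambda>r. (norm (w r))\<^sup>2)" by (intro continuous_intros w_cont)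
  have "(norm (w t))\<^sup>2 - (norm (w s))\<^sup>2 \<le> 2 * (?I t - ?I s)"
  proof (rule LIMSEQ_le)
    show "(\<lambda>n. (norm (w (\<tau> n)))\<^sup>2 - (norm (w (\<sigma> n)))\<^sup>2) \<longlonglongrightarrow> (norm (w t))\<^sup>2 - (norm (w s))\<^sup>2"
      by (intro tendsto_diff lims[OF wc])
    show "(\<lambda>n. 2 * (?I (\<tau> n) - ?I (\<sigma> n))) \<longlonglongrightarrow> 2 * (?I t - ?I s)"
      by (intro tendsto_intros lims[OF cont])
    have "(norm (w (\<tau> n)))\<^sup>2 - (norm (w (\<sigma> n)))\<^sup>2 \<le> 2 * (?I (\<tau> n) - ?I (\<sigma> n))" for n
      using open_case[OF n[of n]] I[of "\<sigma> n" "\<tau> n"] n[of n] by simp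
    then show "\<exists>N. \<forall>n\<ge>N. (norm (w (\<tau> n)))\<^sup>2 - (norm (w (\<sigma> n)))\<^sup>2 \<le> 2 * (?I (\<tau> n) - ?I (\<sigma> n))" by blast
  qed
  then show ?thesis using I[of s t] assms by simp
qed simp

end

section \<open>Trajectories\<close>

lemma sup_norm_upper:
  fixes x :: "real \<Rightarrow> 'h::real_normed_vector"
  assumes "continuous_on {0..T} x" "t \<le> T" "s \<in> {0..t}"
  shows "norm (x s) \<le> sup_norm t x"
  unfolding sup_norm_def
proof (rule cSUP_upper)
  have "continuous_on {0..t} (\<lambda>s. norm (x s))"
    using assms by (intro continuous_intros) (auto intro: continuous_on_subset)
  then show "bdd_above ((\<lambda>s. norm (x s)) ` {0..t})"
    by (intro bounded_imp_bdd_above compact_imp_bounded compact_continuous_image) auto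
qed (use assms in auto)

lemma sup_norm_least:
  assumes "0 \<le> t" "\<And>s. s \<in> {0..t} \<Longrightarrow> norm (x s) \<le> c"
  shows "sup_norm t x \<le> c"
  unfolding sup_norm_def using assms by (intro cSUP_least) auto

lemma sup_norm_nonneg:
  fixes x :: "real \<Rightarrow> 'h::real_normed_vector"
  assumes "continuous_on {0..T} x" "t \<le> T" "0 \<le> t"
  shows "0 \<le> sup_norm t x"
  using order_trans[OF norm_ge_zero sup_norm_upper[OF assms(1,2), of 0]] assms(3) by simp

lemma sup_norm_mono:
  fixes x :: "real \<Rightarrow> 'h::real_normed_vector"
  assumes "continuous_on {0..T} x" "0 \<le> s" "s \<le> t" "t \<le> T"
  shows "sup_norm s x \<le> sup_norm t x"
  using assms by (intro sup_norm_least sup_norm_upper) auto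

lemma integral_le_AE_Ioo:
  fixes f g :: "real \<Rightarrow> real"
  assumes f: "f absolutely_integrable_on {a..b}" and g: "g absolutely_integrable_on {a..b}"
    and "AE r in lebesgue_on {a<..<b}. f r \<le> g r"
  shows "integral {a..b} f \<le> integral {a..b} g"
proof -
  have i: "integrable (lebesgue_on {a<..<b}) f" "integrable (lebesgue_on {a<..<b}) g"
    using f g by (simp_all add: integrable_lebesgue_on_iff absolutely_integrable_on_Ioo_iff)
  have "integral\<^sup>L (lebesgue_on {a<..<b}) f \<le> integral\<^sup>L (lebesgue_on {a<..<b}) g"
    by (rule integral_mono_AE[OF i assms(3)])
  then show ?thesis
    using lebesgue_integral_eq_integral[OF i(1)] lebesgue_integral_eq_integral[OF i(2)]
    by (simp add: integral_open_interval_real)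
qed

lemma absolutely_integrable_AE_bound:
  fixes f g :: "real \<Rightarrow> real"
  assumes "f \<in> borel_measurable (lebesgue_on {a<..<b})" "g absolutely_integrable_on {a..b}"
    and "AE r in lebesgue_on {a<..<b}. \<bar>f r\<bar> \<le> g r"
  shows "f absolutely_integrable_on {a..b}"
proof -
  have "integrable (lebesgue_on {a<..<b}) g"
    using assms(2) by (simp add: integrable_lebesgue_on_iff absolutely_integrable_on_Ioo_iff)
  then have "integrable (lebesgue_on {a<..<b}) f"
  proof (rule Bochner_Integration.integrable_bound[OF _ assms(1)])
    show "AE r in lebesgue_on {a<..<b}. norm (f r) \<le> norm (g r)"
      using assms(3) by eventually_elim auto
  qed
  then show ?thesis by (simp add: integrable_lebesgue_on_iff absolutely_integrable_on_Ioo_iff)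
qed

lemma absolutely_integrable_spike_AE_Ioo:
  fixes f g :: "real \<Rightarrow> real"
  assumes g: "g absolutely_integrable_on {a..b}" and "AE r in lebesgue_on {a<..<b}. f r = g r"
  shows "f absolutely_integrable_on {a..b}"
proof -
  have "AE r in lebesgue. r \<in> {a<..<b} \<longrightarrow> f r = g r"
    using assms(2) by (subst (asm) AE_restrict_space_iff) auto
  then obtain N where N: "N \<in> null_sets lebesgue" "{r. \<not> (r \<in> {a<..<b} \<longrightarrow> f r = g r)} \<subseteq> N"
    by (auto simp: eventually_ae_filter)
  have "f absolutely_integrable_on {a<..<b}"
    by (rule absolutely_integrable_spike[where f=g and S=N])
       (use N g in \<open>auto simp: negligible_iff_null_sets absolutely_integrable_on_Ioo_iff\<close>)
  then show ?thesis by (simp only: absolutely_integrable_on_Ioo_iff)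
qed

text \<open>Almost everywhere the product is the functional \<open>to_dual \<iota> (f r)\<close>
  applied to \<open>X r\<close>; this gives measurability through the separable space
  \<open>V\<close>.\<close>

lemma inner_trajectory_integrable:
  fixes \<iota> :: "'v::{banach, second_countable_topology} \<Rightarrow>\<^sub>L 'h::real_inner"
  assumes f: "f \<in> Lp_space 2 a b" and X: "X \<in> borel_measurable (lebesgue_on {a<..<b})"
    and w: "continuous_on {a..b} w" and ae: "AE t in lebesgue_on {a<..<b}. w t = \<iota> (X t)"
  shows "(\<lambda>r. f r \<bullet> w r) absolutely_integrable_on {a..b}"
proof (rule absolutely_integrable_spike_AE_Ioo)
  have "bounded (w ` {a..b})"
    by (intro compact_imp_bounded compact_continuous_image w) auto
  then obtain C where C: "\<forall>r\<in>{a..b}. norm (w r) \<le> C" by (auto simp: bounded_iff)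
  have fm: "(\<lambda>r. to_dual \<iota> (f r) v) \<in> borel_measurable (lebesgue_on {a<..<b})" for v
    unfolding to_dual_apply
    by (rule measurable_compose[OF Lp_spaceD(1)[OF f] borel_measurable_continuous_onI])
       (intro continuous_intros)
  show "(\<lambda>r. to_dual \<iota> (f r) (X r)) absolutely_integrable_on {a..b}"
  proof (rule absolutely_integrable_AE_bound)
    show "(\<lambda>r. to_dual \<iota> (f r) (X r)) \<in> borel_measurable (lebesgue_on {a<..<b})"
      by (rule borel_measurable_weak_apply[OF fm X])
    show "(\<lambda>r. C * norm (f r)) absolutely_integrable_on {a..b}"
      by (intro absolutely_integrable_continuous_mult continuous_intros Lp_spaceD(3)[OF f]) simp
    have "AE r in lebesgue_on {a<..<b}. r \<in> {a..b}"
      by (intro AE_I2) (auto simp: space_restrict_space)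
    with ae show "AE r in lebesgue_on {a<..<b}. \<bar>to_dual \<iota> (f r) (X r)\<bar> \<le> C * norm (f r)"
    proof eventually_elim
      case (elim r)
      have "\<bar>f r \<bullet> w r\<bar> \<le> norm (f r) * norm (w r)" by (rule Cauchy_Schwarz_ineq2)
      also have "\<dots> \<le> norm (f r) * C" using bspec[OF C elim(2)] by (intro mult_left_mono) auto
      finally show ?case using elim by (simp add: to_dual_apply mult.commute)
    qed
  qed
  show "AE r in lebesgue_on {a<..<b}. f r \<bullet> w r = to_dual \<iota> (f r) (X r)"
    using ae by eventually_elim (simp add: to_dual_apply)
qed

text \<open>Integration by parts against the constant function 1.\<close>

lemma Wpq_weak:
  fixes \<iota> :: "'v::real_normed_vector \<Rightarrow>\<^sub>L 'h::real_inner"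
  assumes W: "Wpq \<iota> p q a b X X'" and "q \<ge> 1" and st: "a \<le> s" "s \<le> t" "t \<le> b"
    and x: "continuous_on {a..b} x" and ae: "AE t in lebesgue_on {a<..<b}. x t = \<iota> (X t)"
  shows "(x t - x s) \<bullet> \<iota> v = integral {s..t} (\<lambda>r. X' r v)"
proof (cases "s = t")
  case False
  have "deriv (\<lambda>x::real. 1::real) = (\<lambda>x. 0)" by (auto intro: DERIV_imp_deriv)
  then show ?thesis
    using Wpq_by_parts[OF W \<open>q \<ge> 1\<close> st(1) _ st(3) x ae smooth_const[of 1], of v] False st(2)
    by (simp add: inner_diff_left)
qed simp

section \<open>The evolution equation: energy estimates and the a priori bound\<close>

locale evolution =
  fixes T p q c\<^sub>2 :: real
    and \<iota> :: "'v::{banach, second_countable_topology} \<Rightarrow>\<^sub>L 'h::{real_inner, complete_space}"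
    and A :: "real \<Rightarrow> 'v \<Rightarrow> ('v \<Rightarrow>\<^sub>L real)"
  assumes T_pos: "T > 0" and p2: "p \<ge> 2" and q1: "q > 1" and conj: "1 / p + 1 / q = 1"
    and compact_\<iota>: "\<And>B. bounded B \<Longrightarrow> compact (closure (\<iota> ` B))"
    and mono: "AE t in lebesgue_on {0..T}. \<forall>x y. blinfun_apply (A t x - A t y) (x - y) \<ge> 0"
    and c\<^sub>2_pos: "c\<^sub>2 > 0"
    and coercive: "AE t in lebesgue_on {0..T}. \<forall>x. blinfun_apply (A t x) x \<ge> c\<^sub>2 * norm x powr p"
begin

lemma pathsD: "x \<in> paths T \<Longrightarrow> continuous_on {0..T} x"
  by (simp add: paths_def)

lemma trajectoryE:
  assumes "trajectory_rhs \<iota> A p q T L t\<^sub>0 x\<^sub>0 x f" "0 \<le> t\<^sub>0"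
  obtains X X' where "X \<in> Lp_space p t\<^sub>0 T" "X' \<in> Lp_space q t\<^sub>0 T"
    "AE t in lebesgue_on {t\<^sub>0<..<T}. x t = \<iota> (X t)"
    "AE t in lebesgue_on {t\<^sub>0<..<T}. X' t + A t (X t) = to_dual \<iota> (f t)"
    "\<And>s t v. t\<^sub>0 \<le> s \<Longrightarrow> s \<le> t \<Longrightarrow> t \<le> T \<Longrightarrow> (x t - x s) \<bullet> \<iota> v = integral {s..t} (\<lambda>r. X' r v)"
    "continuous_on {t\<^sub>0..T} x"
proof -
  from assms obtain X X' where X: "Wpq \<iota> p q t\<^sub>0 T X X'" "AE t in lebesgue_on {t\<^sub>0<..<T}. x t = \<iota> (X t)"
    "AE t in lebesgue_on {t\<^sub>0<..<T}. X' t + A t (X t) = to_dual \<iota> (f t)" and "x \<in> paths T"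
    unfolding trajectory_rhs_def by auto
  have cont: "continuous_on {t\<^sub>0..T} x"
    using pathsD[OF \<open>x \<in> paths T\<close>] by (rule continuous_on_subset) (use \<open>0 \<le> t\<^sub>0\<close> in auto)
  show ?thesis
    using that[OF _ _ X(2,3) Wpq_weak[OF X(1) _ _ _ _ cont X(2)] cont] X(1) q1 by (simp add: Wpq_def)
qed

lemma AE_Ioo: "AE t in lebesgue_on {0..T}. P t \<Longrightarrow> 0 \<le> t\<^sub>0 \<Longrightarrow> AE t in lebesgue_on {t\<^sub>0<..<T}. P t"
  by (rule AE_lebesgue_on_subset) auto

text \<open>The difference of two trajectories is a \<open>weak_path\<close> with derivative
  \<open>X' - Y'\<close>. Once the equation is inserted, the operator contributes a nonpositive term
  by monotonicity, and only the right-hand sides remain.\<close>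

lemma energy_difference:
  assumes x: "trajectory_rhs \<iota> A p q T L t\<^sub>0 x\<^sub>0 x f" and y: "trajectory_rhs \<iota> A p q T L' t\<^sub>0 y\<^sub>0 y g"
    and t\<^sub>0: "0 \<le> t\<^sub>0" "t\<^sub>0 < T"
  shows "(\<lambda>r. (f r - g r) \<bullet> (x r - y r)) absolutely_integrable_on {t\<^sub>0..T}"
    and "t\<^sub>0 \<le> s \<Longrightarrow> s \<le> t \<Longrightarrow> t \<le> T \<Longrightarrow>
      (norm (x t - y t))\<^sup>2 - (norm (x s - y s))\<^sup>2 \<le> 2 * integral {s..t} (\<lambda>r. (f r - g r) \<bullet> (x r - y r))"
proof -
  obtain X X' where X: "X \<in> Lp_space p t\<^sub>0 T" "X' \<in> Lp_space q t\<^sub>0 T"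
    "AE t in lebesgue_on {t\<^sub>0<..<T}. x t = \<iota> (X t)"
    "AE t in lebesgue_on {t\<^sub>0<..<T}. X' t + A t (X t) = to_dual \<iota> (f t)"
    "\<And>s t v. t\<^sub>0 \<le> s \<Longrightarrow> s \<le> t \<Longrightarrow> t \<le> T \<Longrightarrow> (x t - x s) \<bullet> \<iota> v = integral {s..t} (\<lambda>r. X' r v)"
    "continuous_on {t\<^sub>0..T} x"
    by (rule trajectoryE[OF x t\<^sub>0(1)]) (rule that)
  obtain Y Y' where Y: "Y \<in> Lp_space p t\<^sub>0 T" "Y' \<in> Lp_space q t\<^sub>0 T"
    "AE t in lebesgue_on {t\<^sub>0<..<T}. y t = \<iota> (Y t)"
    "AE t in lebesgue_on {t\<^sub>0<..<T}. Y' t + A t (Y t) = to_dual \<iota> (g t)"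
    "\<And>s t v. t\<^sub>0 \<le> s \<Longrightarrow> s \<le> t \<Longrightarrow> t \<le> T \<Longrightarrow> (y t - y s) \<bullet> \<iota> v = integral {s..t} (\<lambda>r. Y' r v)"
    "continuous_on {t\<^sub>0..T} y"
    by (rule trajectoryE[OF y t\<^sub>0(1)]) (rule that)
  have fg: "f \<in> Lp_space 2 t\<^sub>0 T" "g \<in> Lp_space 2 t\<^sub>0 T"
    using x y by (auto simp: trajectory_rhs_def)
  let ?w = "\<lambda>r. x r - y r" and ?W = "\<lambda>r. X r - Y r" and ?D = "\<lambda>r. X' r - Y' r"
  have cont: "continuous_on {t\<^sub>0..T} ?w" by (intro continuous_intros X(6) Y(6))
  have meas: "?W \<in> borel_measurable (lebesgue_on {t\<^sub>0<..<T})"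
    by (intro borel_measurable_diff Lp_spaceD(1)[OF X(1)] Lp_spaceD(1)[OF Y(1)])
  have ae: "AE t in lebesgue_on {t\<^sub>0<..<T}. ?w t = \<iota> (?W t)"
    using X(3) Y(3) by eventually_elim (simp add: blinfun.bilinear_simps)
  have "(\<lambda>r. f r \<bullet> ?w r - g r \<bullet> ?w r) absolutely_integrable_on {t\<^sub>0..T}"
    by (intro set_integral_diff(1) inner_trajectory_integrable[OF _ meas cont ae] fg)
  then show fgw: "(\<lambda>r. (f r - g r) \<bullet> ?w r) absolutely_integrable_on {t\<^sub>0..T}"
    by (simp add: inner_diff_left)
  have sum_int: "h absolutely_integrable_on {t\<^sub>0..T}"
    if h: "h \<in> borel_measurable (lebesgue_on {t\<^sub>0<..<T})"
      and u: "u absolutely_integrable_on {t\<^sub>0..T}" "u' absolutely_integrable_on {t\<^sub>0..T}"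
      and le: "\<And>r. \<bar>h r\<bar> \<le> c * (u r + u' r)" for h u u' :: "real \<Rightarrow> real" and c
  proof (rule absolutely_integrable_AE_bound[OF h])
    show "(\<lambda>r. c * (u r + u' r)) absolutely_integrable_on {t\<^sub>0..T}"
      by (intro absolutely_integrable_continuous_mult continuous_intros set_integral_add(1) u)
  qed (use le in auto)
  have norms: "(\<lambda>r. norm (X r)) \<in> borel_measurable (lebesgue_on {t\<^sub>0<..<T})"
     "(\<lambda>r. norm (X' r)) \<in> borel_measurable (lebesgue_on {t\<^sub>0<..<T})"
     "(\<lambda>r. norm (Y' r)) \<in> borel_measurable (lebesgue_on {t\<^sub>0<..<T})"
     "(\<lambda>r. norm (?W r)) \<in> borel_measurable (lebesgue_on {t\<^sub>0<..<T})"
    by (intro borel_measurable_norm' Lp_spaceD(1)[OF X(1)] Lp_spaceD(1)[OF X(2)] Lp_spaceD(1)[OF Y(2)] meas)+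
  interpret weak_path \<iota> p q t\<^sub>0 T ?w ?W ?D "\<lambda>r. norm (X' r) + norm (Y' r)"
  proof
    show "(\<lambda>r. norm (?W r) powr p) absolutely_integrable_on {t\<^sub>0..T}"
    proof (rule sum_int[OF _ Lp_spaceD(2)[OF X(1)] Lp_spaceD(2)[OF Y(1)]])
      show "(\<lambda>r. norm (?W r) powr p) \<in> borel_measurable (lebesgue_on {t\<^sub>0<..<T})"
        using norms(4) by measurable
      have Wp: "norm (?W r) powr p \<le> (norm (X r) + norm (Y r)) powr p" for r
        using p2 by (intro powr_mono2 norm_triangle_ineq4) auto
      show "\<bar>norm (?W r) powr p\<bar> \<le> 2 powr p * (norm (X r) powr p + norm (Y r) powr p)" for r
        using order_trans[OF Wp powr_sum_le, of r] p2 by simp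
    qed
    show "(\<lambda>r. (norm (X' r) + norm (Y' r)) powr q) absolutely_integrable_on {t\<^sub>0..T}"
    proof (rule sum_int[OF _ Lp_spaceD(2)[OF X(2)] Lp_spaceD(2)[OF Y(2)]])
      show "(\<lambda>r. (norm (X' r) + norm (Y' r)) powr q) \<in> borel_measurable (lebesgue_on {t\<^sub>0<..<T})"
        using norms(2,3) by measurable
      show "\<bar>(norm (X' r) + norm (Y' r)) powr q\<bar> \<le> 2 powr q * (norm (X' r) powr q + norm (Y' r) powr q)" for r
        using powr_sum_le[of "norm (X' r)" "norm (Y' r)" q] q1 by simp
    qed
    show "(\<lambda>t. ?D t v) \<in> borel_measurable (lebesgue_on {t\<^sub>0<..<T})" for v
      unfolding blinfun.diff_left
      by (intro borel_measurable_diff borel_measurable_blinfun_eval Lp_spaceD(1)[OF X(2)] Lp_spaceD(1)[OF Y(2)])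
    show "norm (?D t) \<le> norm (X' t) + norm (Y' t)" for t by (rule norm_triangle_ineq4)
    fix v s t assume st: "t\<^sub>0 \<le> s" "s \<le> t" "t \<le> T"
    have i: "(\<lambda>r. Z r v) integrable_on {s..t}" if "Z \<in> Lp_space q t\<^sub>0 T" for Z :: "real \<Rightarrow> 'v \<Rightarrow>\<^sub>L real"
      using absolutely_integrable_on_subinterval[OF dual_eval_absolutely_integrable[OF that, of v], of s t] st q1
      by (auto simp: absolutely_integrable_on_def)
    have "(?w t - ?w s) \<bullet> \<iota> v = (x t - x s) \<bullet> \<iota> v - (y t - y s) \<bullet> \<iota> v"
      by (simp add: inner_diff_left)
    also have "\<dots> = integral {s..t} (\<lambda>r. X' r v) - integral {s..t} (\<lambda>r. Y' r v)"
      by (simp add: X(5)[OF st] Y(5)[OF st])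
    also have "\<dots> = integral {s..t} (\<lambda>r. ?D r v)"
      by (simp add: integral_diff i X(2) Y(2) blinfun.diff_left)
    finally show "(?w t - ?w s) \<bullet> \<iota> v = integral {s..t} (\<lambda>r. ?D r v)" .
  qed (use t\<^sub>0 p2 q1 conj cont meas ae in auto)
  assume st: "t\<^sub>0 \<le> s" "s \<le> t" "t \<le> T"
  have "(norm (?w t))\<^sup>2 - (norm (?w s))\<^sup>2 \<le> 2 * integral {s..t} (\<lambda>r. ?D r (?W r))"
    by (rule energy_inequality[OF st])
  also have "integral {s..t} (\<lambda>r. ?D r (?W r)) \<le> integral {s..t} (\<lambda>r. (f r - g r) \<bullet> ?w r)"
  proof (rule integral_le_AE_Ioo)
    show "(\<lambda>r. ?D r (?W r)) absolutely_integrable_on {s..t}"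
      by (rule absolutely_integrable_on_subinterval[OF D_W_integrable]) (use st in auto)
    show "(\<lambda>r. (f r - g r) \<bullet> ?w r) absolutely_integrable_on {s..t}"
      by (rule absolutely_integrable_on_subinterval[OF fgw]) (use st in auto)
    have "AE r in lebesgue_on {t\<^sub>0<..<T}. ?D r (?W r) \<le> (f r - g r) \<bullet> ?w r"
      using ae X(4) Y(4) AE_Ioo[OF mono t\<^sub>0(1)]
    proof eventually_elim
      case (elim r)
      have "?D r = (to_dual \<iota> (f r) - to_dual \<iota> (g r)) - (A r (X r) - A r (Y r))"
        by (simp flip: elim(2,3))
      then have "?D r (?W r) = (f r - g r) \<bullet> \<iota> (?W r) - (A r (X r) - A r (Y r)) (?W r)"
        by (simp add: blinfun.diff_left to_dual_apply inner_diff_left)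
      then show ?case using elim(1,4) by simp
    qed
    then show "AE r in lebesgue_on {s<..<t}. ?D r (?W r) \<le> (f r - g r) \<bullet> ?w r"
      by (rule AE_lebesgue_on_subset) (use st in auto)
  qed
  finally show "(norm (?w t))\<^sup>2 - (norm (?w s))\<^sup>2 \<le> 2 * integral {s..t} (\<lambda>r. (f r - g r) \<bullet> ?w r)" by simp
qed

text \<open>Coercivity leaves the integral of the p-th power of the norm of \<open>V\<close> on the
  left. Without it the estimate bounds the path in \<open>H\<close>; with it the estimate gives the
  bound in \<open>V\<close> behind compactness.\<close>

lemma energy_single:
  assumes x: "trajectory_rhs \<iota> A p q T L t\<^sub>0 x\<^sub>0 x f" and t\<^sub>0: "0 \<le> t\<^sub>0" "t\<^sub>0 < T"
  shows "(\<lambda>r. f r \<bullet> x r) absolutely_integrable_on {t\<^sub>0..T}"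
    and "\<exists>X. (\<lambda>r. norm (X r) powr p) absolutely_integrable_on {t\<^sub>0..T} \<and>
      X \<in> borel_measurable (lebesgue_on {t\<^sub>0<..<T}) \<and>
      (AE t in lebesgue_on {t\<^sub>0<..<T}. x t = \<iota> (X t)) \<and>
      (\<forall>t\<in>{t\<^sub>0..T}. (norm (x t))\<^sup>2 + 2 * c\<^sub>2 * integral {t\<^sub>0..t} (\<lambda>r. norm (X r) powr p)
         \<le> (norm (x t\<^sub>0))\<^sup>2 + 2 * integral {t\<^sub>0..t} (\<lambda>r. f r \<bullet> x r))"
proof -
  obtain X X' where X: "X \<in> Lp_space p t\<^sub>0 T" "X' \<in> Lp_space q t\<^sub>0 T"
    "AE t in lebesgue_on {t\<^sub>0<..<T}. x t = \<iota> (X t)"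
    "AE t in lebesgue_on {t\<^sub>0<..<T}. X' t + A t (X t) = to_dual \<iota> (f t)"
    "\<And>s t v. t\<^sub>0 \<le> s \<Longrightarrow> s \<le> t \<Longrightarrow> t \<le> T \<Longrightarrow> (x t - x s) \<bullet> \<iota> v = integral {s..t} (\<lambda>r. X' r v)"
    "continuous_on {t\<^sub>0..T} x"
    by (rule trajectoryE[OF x t\<^sub>0(1)]) (rule that)
  have f: "f \<in> Lp_space 2 t\<^sub>0 T" using x by (auto simp: trajectory_rhs_def)
  show fx: "(\<lambda>r. f r \<bullet> x r) absolutely_integrable_on {t\<^sub>0..T}"
    by (rule inner_trajectory_integrable[OF f Lp_spaceD(1)[OF X(1)] X(6,3)])
  interpret weak_path \<iota> p q t\<^sub>0 T x X X' "\<lambda>r. norm (X' r)"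
    by unfold_locales
       (use t\<^sub>0 p2 q1 conj X(3,5,6) Lp_spaceD[OF X(1)] Lp_spaceD[OF X(2)] in \<open>auto intro: borel_measurable_blinfun_eval\<close>)
  have "(norm (x t))\<^sup>2 + 2 * c\<^sub>2 * integral {t\<^sub>0..t} (\<lambda>r. norm (X r) powr p)
         \<le> (norm (x t\<^sub>0))\<^sup>2 + 2 * integral {t\<^sub>0..t} (\<lambda>r. f r \<bullet> x r)" if t: "t \<in> {t\<^sub>0..T}" for t
  proof -
    have sub: "{t\<^sub>0..t} \<subseteq> {t\<^sub>0..T}" using t by auto
    have Xp: "(\<lambda>r. c\<^sub>2 * norm (X r) powr p) absolutely_integrable_on {t\<^sub>0..t}"
      by (intro absolutely_integrable_continuous_mult continuous_intros
          absolutely_integrable_on_subinterval[OF Lp_spaceD(2)[OF X(1)] sub])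
    have fx': "(\<lambda>r. f r \<bullet> x r) absolutely_integrable_on {t\<^sub>0..t}"
      by (rule absolutely_integrable_on_subinterval[OF fx sub])
    have "(norm (x t))\<^sup>2 - (norm (x t\<^sub>0))\<^sup>2 \<le> 2 * integral {t\<^sub>0..t} (\<lambda>r. X' r (X r))"
      using t by (intro energy_inequality) auto
    also have "integral {t\<^sub>0..t} (\<lambda>r. X' r (X r)) \<le> integral {t\<^sub>0..t} (\<lambda>r. f r \<bullet> x r - c\<^sub>2 * norm (X r) powr p)"
    proof (rule integral_le_AE_Ioo)
      show "(\<lambda>r. X' r (X r)) absolutely_integrable_on {t\<^sub>0..t}"
        by (rule absolutely_integrable_on_subinterval[OF D_W_integrable sub])
      show "(\<lambda>r. f r \<bullet> x r - c\<^sub>2 * norm (X r) powr p) absolutely_integrable_on {t\<^sub>0..t}"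
        by (intro set_integral_diff(1) Xp fx')
      have "AE r in lebesgue_on {t\<^sub>0<..<T}. X' r (X r) \<le> f r \<bullet> x r - c\<^sub>2 * norm (X r) powr p"
        using X(3,4) AE_Ioo[OF coercive t\<^sub>0(1)]
      proof eventually_elim
        case (elim r)
        have "X' r = to_dual \<iota> (f r) - A r (X r)" by (simp flip: elim(2))
        then have "X' r (X r) = f r \<bullet> \<iota> (X r) - A r (X r) (X r)" by (simp add: blinfun.diff_left to_dual_apply)
        then show ?case using elim(1) spec[OF elim(3), of "X r"] by simp
      qed
      then show "AE r in lebesgue_on {t\<^sub>0<..<t}. X' r (X r) \<le> f r \<bullet> x r - c\<^sub>2 * norm (X r) powr p"
        by (rule AE_lebesgue_on_subset) (use t in auto)
    qed
    also have "\<dots> = integral {t\<^sub>0..t} (\<lambda>r. f r \<bullet> x r) - c\<^sub>2 * integral {t\<^sub>0..t} (\<lambda>r. norm (X r) powr p)"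
      using Xp fx' by (simp add: integral_diff absolutely_integrable_on_def)
    finally show ?thesis by simp
  qed
  then show "\<exists>X. (\<lambda>r. norm (X r) powr p) absolutely_integrable_on {t\<^sub>0..T} \<and>
      X \<in> borel_measurable (lebesgue_on {t\<^sub>0<..<T}) \<and>
      (AE t in lebesgue_on {t\<^sub>0<..<T}. x t = \<iota> (X t)) \<and>
      (\<forall>t\<in>{t\<^sub>0..T}. (norm (x t))\<^sup>2 + 2 * c\<^sub>2 * integral {t\<^sub>0..t} (\<lambda>r. norm (X r) powr p)
         \<le> (norm (x t\<^sub>0))\<^sup>2 + 2 * integral {t\<^sub>0..t} (\<lambda>r. f r \<bullet> x r))"
    using Lp_spaceD(1,2)[OF X(1)] X(3) by blast
qed

text \<open>Gronwall's argument in weighted form: the weighted supremum \<open>Q\<close> satisfies \<open>Q \<le> C + Q / 2\<close>.\<close>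

lemma a_priori_bound:
  assumes "L \<ge> 0" and t\<^sub>0: "0 \<le> t\<^sub>0" "t\<^sub>0 < T" and x\<^sub>0: "x\<^sub>0 \<in> paths T"
  obtains R where "R \<ge> 1" "\<And>x f. trajectory_rhs \<iota> A p q T L t\<^sub>0 x\<^sub>0 x f \<Longrightarrow> 1 + sup_norm T x \<le> R"
proof -
  define C where "C = 2 * (1 + (sup_norm t\<^sub>0 x\<^sub>0)\<^sup>2)"
  \<comment> \<open>This rate makes \<open>4 * L / \<mu>\<close> at most 1/2, which is the factor in
    front of \<open>Q\<close>.\<close>
  define \<mu> where "\<mu> = 8 * L + 1"
  have "\<mu> > 0" using \<open>L \<ge> 0\<close> by (simp add: \<mu>_def)
  define R where "R = 2 * C * exp (\<mu> * T) + 1"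
  have "C \<ge> 0" by (simp add: C_def)
  then have "R \<ge> 1" by (simp add: R_def)
  moreover have "1 + sup_norm T x \<le> R" if x: "trajectory_rhs \<iota> A p q T L t\<^sub>0 x\<^sub>0 x f" for x f
  proof -
    have cx: "continuous_on {0..T} x" and x0: "\<And>t. t \<in> {0..t\<^sub>0} \<Longrightarrow> x t = x\<^sub>0 t"
      and f: "AE t in lebesgue_on {t\<^sub>0<..<T}. norm (f t) \<le> L * (1 + sup_norm t x)"
      using x pathsD unfolding trajectory_rhs_def by auto
    have S0: "sup_norm t\<^sub>0 x = sup_norm t\<^sub>0 x\<^sub>0" by (rule sup_norm_cong) (rule x0)
    define N where "N t = (1 + sup_norm t x)\<^sup>2" for t
    have S_nonneg: "sup_norm t x \<ge> 0" if "t \<in> {t\<^sub>0..T}" for t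
      using sup_norm_nonneg[OF cx] that t\<^sub>0 by auto
    define Q where "Q = (SUP t\<in>{t\<^sub>0..T}. N t * exp (- (\<mu> * t)))"
    have N_le: "N t \<le> N T" if "t \<in> {t\<^sub>0..T}" for t
      unfolding N_def using that t\<^sub>0 S_nonneg[OF that] by (intro power_mono add_left_mono sup_norm_mono[OF cx]) auto
    have bdd: "bdd_above ((\<lambda>t. N t * exp (- (\<mu> * t))) ` {t\<^sub>0..T})"
    proof (rule bdd_aboveI2)
      fix t assume t: "t \<in> {t\<^sub>0..T}"
      have "exp (- (\<mu> * t)) \<le> 1" using t t\<^sub>0 \<open>\<mu> > 0\<close> by simp
      then show "N t * exp (- (\<mu> * t)) \<le> N T * 1"
        using N_le[OF t] by (intro mult_mono) (auto simp: N_def)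
    qed
    have Q: "N t \<le> Q * exp (\<mu> * t)" if "t \<in> {t\<^sub>0..T}" for t
    proof -
      have "N t * exp (- (\<mu> * t)) \<le> Q" unfolding Q_def using that bdd by (intro cSUP_upper) auto
      then have "N t * exp (- (\<mu> * t)) * exp (\<mu> * t) \<le> Q * exp (\<mu> * t)" by (intro mult_right_mono) auto
      then show ?thesis by (simp add: mult.assoc flip: exp_add)
    qed
    have Q_nonneg: "Q \<ge> 0"
    proof -
      have "0 \<le> N T" by (simp add: N_def)
      then have "0 \<le> Q * exp (\<mu> * T)" using Q[of T] t\<^sub>0 by auto
      then show ?thesis by (simp add: zero_le_mult_iff)
    qed
    have step: "N t \<le> C + Q / 2 * exp (\<mu> * t)" if t: "t \<in> {t\<^sub>0..T}" for t
    proof -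
      have xr: "(norm (x r))\<^sup>2 \<le> (sup_norm t\<^sub>0 x\<^sub>0)\<^sup>2 + 2 * L * Q / \<mu> * exp (\<mu> * t)" if r: "r \<in> {0..t}" for r
      proof (cases "r \<le> t\<^sub>0")
        case True
        then have "norm (x r) \<le> sup_norm t\<^sub>0 x" using sup_norm_upper[OF cx, of t\<^sub>0 r] t\<^sub>0 r by auto
        then have "(norm (x r))\<^sup>2 \<le> (sup_norm t\<^sub>0 x\<^sub>0)\<^sup>2" unfolding S0 by (intro power_mono) auto
        moreover have "0 \<le> 2 * L * Q / \<mu> * exp (\<mu> * t)" using \<open>L \<ge> 0\<close> Q_nonneg \<open>\<mu> > 0\<close> by simp
        ultimately show ?thesis by simp
      next
        case False
        then have r': "r \<in> {t\<^sub>0..T}" using r t by auto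
        obtain X :: "real \<Rightarrow> 'v" where X: "\<forall>t\<in>{t\<^sub>0..T}. (norm (x t))\<^sup>2 + 2 * c\<^sub>2 * integral {t\<^sub>0..t} (\<lambda>r. norm (X r) powr p)
            \<le> (norm (x t\<^sub>0))\<^sup>2 + 2 * integral {t\<^sub>0..t} (\<lambda>r. f r \<bullet> x r)"
          using energy_single(2)[OF x t\<^sub>0] by blast
        \<comment> \<open>Integrability of the power was not carried along; if it failed, the
          integral would be 0 by default.\<close>
        have "integral {t\<^sub>0..r} (\<lambda>r. norm (X r) powr p) \<ge> 0"
          by (cases "(\<lambda>r. norm (X r) powr p) integrable_on {t\<^sub>0..r}")
             (auto intro: integral_nonneg simp: not_integrable_integral)
        then have "(norm (x r))\<^sup>2 \<le> (norm (x t\<^sub>0))\<^sup>2 + 2 * integral {t\<^sub>0..r} (\<lambda>r. f r \<bullet> x r)"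
          using bspec[OF X r'] c\<^sub>2_pos by (smt (verit, best) mult_nonneg_nonneg)
        also have "integral {t\<^sub>0..r} (\<lambda>r. f r \<bullet> x r) \<le> integral {t\<^sub>0..r} (\<lambda>r. L * Q * exp (\<mu> * r))"
        proof (rule integral_le_AE_Ioo)
          show "(\<lambda>r. f r \<bullet> x r) absolutely_integrable_on {t\<^sub>0..r}"
            by (rule absolutely_integrable_on_subinterval[OF energy_single(1)[OF x t\<^sub>0]]) (use r' in auto)
          show "(\<lambda>r. L * Q * exp (\<mu> * r)) absolutely_integrable_on {t\<^sub>0..r}"
            by (intro absolutely_integrable_continuous_real continuous_intros)
          have "AE s in lebesgue_on {t\<^sub>0<..<T}. s \<in> {t\<^sub>0..T}"
            by (intro AE_I2) (auto simp: space_restrict_space)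
          with f have "AE s in lebesgue_on {t\<^sub>0<..<T}. f s \<bullet> x s \<le> L * Q * exp (\<mu> * s)"
          proof eventually_elim
            case (elim s)
            have "f s \<bullet> x s \<le> norm (f s) * norm (x s)" by (rule norm_cauchy_schwarz)
            also have "\<dots> \<le> (L * (1 + sup_norm s x)) * (1 + sup_norm s x)"
            proof (intro mult_mono)
              have "norm (x s) \<le> sup_norm s x" using sup_norm_upper[OF cx, of s s] elim(2) t\<^sub>0 by auto
              then show "norm (x s) \<le> 1 + sup_norm s x" by simp
            qed (use elim S_nonneg[of s] \<open>L \<ge> 0\<close> in auto)
            also have "\<dots> = L * N s" by (simp add: N_def power2_eq_square)
            also have "\<dots> \<le> L * (Q * exp (\<mu> * s))" using Q[OF elim(2)] \<open>L \<ge> 0\<close> by (intro mult_left_mono) auto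
            finally show ?case by simp
          qed
          then show "AE s in lebesgue_on {t\<^sub>0<..<r}. f s \<bullet> x s \<le> L * Q * exp (\<mu> * s)"
            by (rule AE_lebesgue_on_subset) (use r' in auto)
        qed
        also have "integral {t\<^sub>0..r} (\<lambda>r. L * Q * exp (\<mu> * r)) = L * Q / \<mu> * exp (\<mu> * r) - L * Q / \<mu> * exp (\<mu> * t\<^sub>0)"
        proof (rule integral_unique, rule fundamental_theorem_of_calculus)
          show "((\<lambda>r. L * Q / \<mu> * exp (\<mu> * r)) has_vector_derivative L * Q * exp (\<mu> * s)) (at s within {t\<^sub>0..r})" for s
            unfolding has_real_derivative_iff_has_vector_derivative[symmetric]
            using \<open>\<mu> > 0\<close> by (auto intro!: derivative_eq_intros)
        qed (use r' in auto)
        also have "\<dots> \<le> L * Q / \<mu> * exp (\<mu> * t)"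
        proof -
          have "L * Q / \<mu> * exp (\<mu> * r) \<le> L * Q / \<mu> * exp (\<mu> * t)"
            using r \<open>L \<ge> 0\<close> Q_nonneg \<open>\<mu> > 0\<close> by (intro mult_left_mono) auto
          moreover have "L * Q / \<mu> * exp (\<mu> * t\<^sub>0) \<ge> 0" using \<open>L \<ge> 0\<close> Q_nonneg \<open>\<mu> > 0\<close> by simp
          ultimately show ?thesis by linarith
        qed
        also have "(norm (x t\<^sub>0))\<^sup>2 \<le> (sup_norm t\<^sub>0 x\<^sub>0)\<^sup>2"
          unfolding S0[symmetric] using sup_norm_upper[OF cx, of t\<^sub>0 t\<^sub>0] t\<^sub>0 by (intro power_mono) auto
        finally show ?thesis by (simp add: algebra_simps)
      qed
      have "norm (x r) \<le> sqrt ((sup_norm t\<^sub>0 x\<^sub>0)\<^sup>2 + 2 * L * Q / \<mu> * exp (\<mu> * t))" if "r \<in> {0..t}" for r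
        using xr[OF that] by (rule real_le_rsqrt)
      then have "sup_norm t x \<le> sqrt ((sup_norm t\<^sub>0 x\<^sub>0)\<^sup>2 + 2 * L * Q / \<mu> * exp (\<mu> * t))"
        using t t\<^sub>0 by (intro sup_norm_least) auto
      then have "(sup_norm t x)\<^sup>2 \<le> (sqrt ((sup_norm t\<^sub>0 x\<^sub>0)\<^sup>2 + 2 * L * Q / \<mu> * exp (\<mu> * t)))\<^sup>2"
        using S_nonneg[OF t] by (intro power_mono) auto
      also have "\<dots> = (sup_norm t\<^sub>0 x\<^sub>0)\<^sup>2 + 2 * L * Q / \<mu> * exp (\<mu> * t)"
        using \<open>L \<ge> 0\<close> Q_nonneg \<open>\<mu> > 0\<close> by simp
      finally have S2: "(sup_norm t x)\<^sup>2 \<le> (sup_norm t\<^sub>0 x\<^sub>0)\<^sup>2 + 2 * L * Q / \<mu> * exp (\<mu> * t)" .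
      \<comment> \<open>\<open>(1 + a)\<^sup>2 \<le> 2 * (1 + a\<^sup>2)\<close> is the origin of
        the factor 2 in \<open>C\<close>.\<close>
      have "N t \<le> 2 * (1 + (sup_norm t x)\<^sup>2)"
        unfolding N_def using sum_squares_bound[of 1 "sup_norm t x"] by (simp add: power2_eq_square algebra_simps)
      also have "\<dots> \<le> C + 4 * L / \<mu> * Q * exp (\<mu> * t)"
        using mult_left_mono[OF S2, of 2] by (simp add: C_def algebra_simps)
      also have "4 * L / \<mu> * Q * exp (\<mu> * t) \<le> 1 / 2 * Q * exp (\<mu> * t)"
        using Q_nonneg \<open>L \<ge> 0\<close> by (intro mult_right_mono) (auto simp: \<mu>_def field_simps)
      finally show ?thesis by simp
    qed
    have "Q \<le> C + Q / 2"
      unfolding Q_def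
    proof (rule cSUP_least)
      fix t assume t: "t \<in> {t\<^sub>0..T}"
      have "N t * exp (- (\<mu> * t)) \<le> (C + Q / 2 * exp (\<mu> * t)) * exp (- (\<mu> * t))"
        using step[OF t] by (intro mult_right_mono) auto
      also have "\<dots> = C * exp (- (\<mu> * t)) + Q / 2" by (simp add: distrib_right flip: exp_add)
      also have "\<dots> \<le> C * 1 + Q / 2"
        using t t\<^sub>0 \<open>\<mu> > 0\<close> \<open>C \<ge> 0\<close> by (intro add_right_mono mult_left_mono) auto
      finally show "N t * exp (- (\<mu> * t)) \<le> C + (SUP t\<in>{t\<^sub>0..T}. N t * exp (- (\<mu> * t))) / 2" by (simp add: Q_def)
    qed (use t\<^sub>0 in auto)
    then have "Q * exp (\<mu> * T) \<le> 2 * C * exp (\<mu> * T)" by (intro mult_right_mono) auto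
    from order_trans[OF Q this] have "N T \<le> 2 * C * exp (\<mu> * T)" using t\<^sub>0 by simp
    moreover have "1 + sup_norm T x \<le> N T"
      unfolding N_def using S_nonneg[of T] t\<^sub>0 by (auto simp: power2_eq_square algebra_simps)
    ultimately show ?thesis by (simp add: R_def)
  qed
  ultimately show ?thesis using that by blast
qed

end

section \<open>Compactness of the trajectory sets\<close>

context evolution
begin

abbreviation "Traj L t\<^sub>0 x\<^sub>0 \<equiv> trajectories \<iota> A p q T L t\<^sub>0 x\<^sub>0"

lemma rhs_bound:
  assumes "trajectory_rhs \<iota> A p q T L t\<^sub>0 x\<^sub>0 x f" "0 \<le> t\<^sub>0" "L \<ge> 0" and R: "1 + sup_norm T x \<le> R"
  shows "AE r in lebesgue_on {t\<^sub>0<..<T}. norm (f r) \<le> L * R"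
proof -
  have cx: "continuous_on {0..T} x" and f: "AE t in lebesgue_on {t\<^sub>0<..<T}. norm (f t) \<le> L * (1 + sup_norm t x)"
    using assms pathsD unfolding trajectory_rhs_def by auto
  have "AE r in lebesgue_on {t\<^sub>0<..<T}. r \<in> {t\<^sub>0<..<T}"
    by (intro AE_I2) (auto simp: space_restrict_space)
  with f show ?thesis
  proof eventually_elim
    case (elim r)
    have "1 + sup_norm r x \<le> R" using sup_norm_mono[OF cx, of r T] elim(2) \<open>0 \<le> t\<^sub>0\<close> R by auto
    then have "L * (1 + sup_norm r x) \<le> L * R" using \<open>L \<ge> 0\<close> by (rule mult_left_mono)
    with elim(1) show ?case by simp
  qed
qed

lemma trajectory_norm_le:
  assumes "trajectory_rhs \<iota> A p q T L t\<^sub>0 x\<^sub>0 x f" "1 + sup_norm T x \<le> R" "r \<in> {0..T}"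
  shows "norm (x r) \<le> R"
  using assms sup_norm_upper[of T x T r] pathsD[of x] unfolding trajectory_rhs_def by auto

lemma integral_const_AE_bound:
  fixes g :: "real \<Rightarrow> real"
  assumes "g absolutely_integrable_on {s..t}" "s \<le> t" "AE r in lebesgue_on {s<..<t}. g r \<le> c"
  shows "integral {s..t} g \<le> c * (t - s)"
proof -
  have "integral {s..t} g \<le> integral {s..t} (\<lambda>_. c)"
    by (rule integral_le_AE_Ioo[OF assms(1) _ assms(3)])
       (intro absolutely_integrable_continuous_real continuous_intros)
  then show ?thesis using \<open>s \<le> t\<close> by (simp add: mult.commute)
qed

text \<open>Crude constants suffice: the right-hand sides differ by at most
  \<open>2 * (L * R)\<close>, the paths by at most \<open>2 * R\<close>, and the energy inequality
  doubles the product. Closeness at one time thus persists for a short while.\<close>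

lemma difference_growth:
  assumes x: "trajectory_rhs \<iota> A p q T L t\<^sub>0 x\<^sub>0 x f" and y: "trajectory_rhs \<iota> A p q T L t\<^sub>0 x\<^sub>0 y g"
    and t\<^sub>0: "0 \<le> t\<^sub>0" "t\<^sub>0 < T" and "L \<ge> 0" and R: "1 + sup_norm T x \<le> R" "1 + sup_norm T y \<le> R"
    and st: "t\<^sub>0 \<le> s" "s \<le> t" "t \<le> T"
  shows "(norm (x t - y t))\<^sup>2 \<le> (norm (x s - y s))\<^sup>2 + 8 * L * R\<^sup>2 * (t - s)"
proof -
  have int: "(\<lambda>r. (f r - g r) \<bullet> (x r - y r)) absolutely_integrable_on {s..t}"
    by (rule absolutely_integrable_on_subinterval[OF energy_difference(1)[OF x y t\<^sub>0]]) (use st in auto)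
  have "AE r in lebesgue_on {t\<^sub>0<..<T}. r \<in> {0..T}"
    by (intro AE_I2) (use t\<^sub>0 in \<open>auto simp: space_restrict_space\<close>)
  with rhs_bound[OF x t\<^sub>0(1) \<open>L \<ge> 0\<close> R(1)] rhs_bound[OF y t\<^sub>0(1) \<open>L \<ge> 0\<close> R(2)]
  have "AE r in lebesgue_on {t\<^sub>0<..<T}. (f r - g r) \<bullet> (x r - y r) \<le> 4 * L * R\<^sup>2"
  proof eventually_elim
    case (elim r)
    have "(f r - g r) \<bullet> (x r - y r) \<le> norm (f r - g r) * norm (x r - y r)" by (rule norm_cauchy_schwarz)
    also have "\<dots> \<le> (2 * (L * R)) * (2 * R)"
    proof (rule mult_mono)
      show "norm (f r - g r) \<le> 2 * (L * R)" using norm_triangle_ineq4[of "f r" "g r"] elim by linarith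
      then show "0 \<le> 2 * (L * R)" using norm_ge_zero order_trans by blast
      show "norm (x r - y r) \<le> 2 * R"
        using norm_triangle_ineq4[of "x r" "y r"] trajectory_norm_le[OF x R(1) elim(3)] trajectory_norm_le[OF y R(2) elim(3)]
        by linarith
    qed auto
    finally show ?case by (simp add: power2_eq_square mult_ac)
  qed
  then have "AE r in lebesgue_on {s<..<t}. (f r - g r) \<bullet> (x r - y r) \<le> 4 * L * R\<^sup>2"
    by (rule AE_lebesgue_on_subset) (use st in auto)
  from integral_const_AE_bound[OF int st(2) this] energy_difference(2)[OF x y t\<^sub>0 st]
  show ?thesis by (simp add: algebra_simps)
qed

text \<open>A nonempty open interval has positive measure, so the almost-everywhere filter on it is
  proper.\<close>

lemma AE_Ioo_ex:
  fixes c d :: real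
  assumes "AE s in lebesgue_on {c<..<d}. P s" "c < d"
  shows "\<exists>s\<in>{c<..<d}. P s"
proof (rule ccontr)
  assume *: "\<not> ?thesis"
  have "AE s in lebesgue_on {c<..<d}. s \<in> {c<..<d}"
    by (intro AE_I2) (simp add: space_restrict_space)
  with assms(1) have "AE s in lebesgue_on {c<..<d}. False"
    by eventually_elim (use * in auto)
  then have "ae_filter (lebesgue_on {c<..<d}) = bot" by (simp add: trivial_limit_def)
  then have "emeasure (lebesgue_on {c<..<d}) (space (lebesgue_on {c<..<d})) = 0"
    by (simp only: ae_filter_eq_bot_iff)
  then show False using \<open>c < d\<close> by (simp add: emeasure_restrict_space)
qed

text \<open>Fatou's lemma applied to \<open>\<parallel>X\<^sub>n(s)\<parallel>\<^sup>p\<close>: at almost every time some subsequence is bounded in \<open>V\<close>,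
  hence relatively compact in \<open>H\<close>.\<close>

lemma subsequence_at_time:
  fixes x f :: "nat \<Rightarrow> real \<Rightarrow> 'h"
  assumes x: "\<And>n. trajectory_rhs \<iota> A p q T L t\<^sub>0 x\<^sub>0 (x n) (f n)"
    and t\<^sub>0: "0 \<le> t\<^sub>0" "t\<^sub>0 < T" and "L \<ge> 0" and R: "\<And>n. 1 + sup_norm T (x n) \<le> R"
    and cd: "t\<^sub>0 \<le> c" "c < d" "d \<le> T"
  shows "\<exists>s\<in>{c<..<d}. \<exists>\<sigma>. strict_mono \<sigma> \<and> convergent (\<lambda>n. x (\<sigma> n) s)"
proof -
  let ?M = "lebesgue_on {t\<^sub>0<..<T}"
  define good where "good n X \<longleftrightarrow> (\<lambda>r. norm (X r) powr p) absolutely_integrable_on {t\<^sub>0..T} \<and>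
      X \<in> borel_measurable ?M \<and> (AE t in ?M. x n t = \<iota> (X t)) \<and>
      (\<forall>t\<in>{t\<^sub>0..T}. (norm (x n t))\<^sup>2 + 2 * c\<^sub>2 * integral {t\<^sub>0..t} (\<lambda>r. norm (X r) powr p)
         \<le> (norm (x n t\<^sub>0))\<^sup>2 + 2 * integral {t\<^sub>0..t} (\<lambda>r. f n r \<bullet> x n r))" for n X
  have "\<exists>X. good n X" for n
    unfolding good_def by (rule energy_single(2)[OF x t\<^sub>0])
  then obtain X where X: "\<And>n. good n (X n)" by metis
  have Xi: "(\<lambda>r. norm (X n r) powr p) absolutely_integrable_on {t\<^sub>0..T}"
    and Xm: "X n \<in> borel_measurable ?M" and xX: "AE t in ?M. x n t = \<iota> (X n t)"
    and Xe: "\<forall>t\<in>{t\<^sub>0..T}. (norm (x n t))\<^sup>2 + 2 * c\<^sub>2 * integral {t\<^sub>0..t} (\<lambda>r. norm (X n r) powr p)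
         \<le> (norm (x n t\<^sub>0))\<^sup>2 + 2 * integral {t\<^sub>0..t} (\<lambda>r. f n r \<bullet> x n r)" for n
    using X[of n] unfolding good_def by blast+
  \<comment> \<open>The energy estimate at \<open>T\<close> gives this value: the initial term is at
    most \<open>R\<^sup>2\<close> and the integral of \<open>f n r \<bullet> x n r\<close> at most
    \<open>L * R * R * (T - t\<^sub>0)\<close>.\<close>
  define C where "C = (R\<^sup>2 + 2 * (L * R * R * (T - t\<^sub>0))) / (2 * c\<^sub>2)"
  have int_le: "integral {t\<^sub>0..T} (\<lambda>r. norm (X n r) powr p) \<le> C" for n
  proof -
    have "AE r in ?M. r \<in> {0..T}"
      by (intro AE_I2) (use t\<^sub>0 in \<open>auto simp: space_restrict_space\<close>)
    with rhs_bound[OF x t\<^sub>0(1) \<open>L \<ge> 0\<close> R, of n] have "AE r in ?M. f n r \<bullet> x n r \<le> L * R * R"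
    proof eventually_elim
      case (elim r)
      have "f n r \<bullet> x n r \<le> norm (f n r) * norm (x n r)" by (rule norm_cauchy_schwarz)
      also have "\<dots> \<le> (L * R) * R"
      proof (rule mult_mono)
        show "0 \<le> L * R" using elim(1) norm_ge_zero order_trans by blast
      qed (use elim trajectory_norm_le[OF x R elim(2), of n] in auto)
      finally show ?case .
    qed
    then have "integral {t\<^sub>0..T} (\<lambda>r. f n r \<bullet> x n r) \<le> L * R * R * (T - t\<^sub>0)"
      using t\<^sub>0 by (intro integral_const_AE_bound energy_single(1)[OF x t\<^sub>0]) auto
    moreover have "(norm (x n t\<^sub>0))\<^sup>2 \<le> R\<^sup>2"
      using trajectory_norm_le[OF x R, of t\<^sub>0 n] t\<^sub>0 by (intro power_mono) auto
    moreover have "(norm (x n T))\<^sup>2 + 2 * c\<^sub>2 * integral {t\<^sub>0..T} (\<lambda>r. norm (X n r) powr p)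
         \<le> (norm (x n t\<^sub>0))\<^sup>2 + 2 * integral {t\<^sub>0..T} (\<lambda>r. f n r \<bullet> x n r)"
      using Xe[of n] t\<^sub>0 by auto
    moreover have "0 \<le> (norm (x n T))\<^sup>2" by simp
    ultimately have "2 * c\<^sub>2 * integral {t\<^sub>0..T} (\<lambda>r. norm (X n r) powr p) \<le> R\<^sup>2 + 2 * (L * R * R * (T - t\<^sub>0))"
      by linarith
    then show ?thesis using c\<^sub>2_pos by (simp add: C_def pos_le_divide_eq mult.commute)
  qed
  let ?u = "\<lambda>n s. ennreal (norm (X n s) powr p)"
  have um: "?u n \<in> borel_measurable ?M" for n
    using borel_measurable_norm'[OF Xm[of n]] by measurable
  have "(\<integral>\<^sup>+s. liminf (\<lambda>n. ?u n s) \<partial>?M) \<le> liminf (\<lambda>n. \<integral>\<^sup>+s. ?u n s \<partial>?M)"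
    by (rule nn_integral_liminf[OF um])
  also have "\<dots> \<le> liminf (\<lambda>n. ennreal C)"
    using nn_integral_eq_integral_Ioo[OF Xi] int_le by (intro Liminf_mono) (auto intro!: always_eventually ennreal_leI)
  also have "\<dots> = ennreal C" by (simp add: Liminf_const)
  finally have "(\<integral>\<^sup>+s. liminf (\<lambda>n. ?u n s) \<partial>?M) \<noteq> \<infinity>" by (auto simp: top_unique)
  then have "AE s in ?M. liminf (\<lambda>n. ?u n s) \<noteq> \<infinity>"
    by (intro nn_integral_PInf_AE borel_measurable_liminf um)
  moreover have "AE s in ?M. \<forall>n. x n s = \<iota> (X n s)" using xX by (simp add: AE_all_countable)
  ultimately have "AE s in ?M. liminf (\<lambda>n. ?u n s) \<noteq> \<infinity> \<and> (\<forall>n. x n s = \<iota> (X n s))" by eventually_elim simp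
  then have "AE s in lebesgue_on {c<..<d}. liminf (\<lambda>n. ?u n s) \<noteq> \<infinity> \<and> (\<forall>n. x n s = \<iota> (X n s))"
    by (rule AE_lebesgue_on_subset) (use cd in auto)
  from AE_Ioo_ex[OF this \<open>c < d\<close>] obtain s where s: "s \<in> {c<..<d}"
    and lim: "liminf (\<lambda>n. ?u n s) \<noteq> \<infinity>" and eq: "\<And>n. x n s = \<iota> (X n s)" by auto
  \<comment> \<open>A finite lower limit means that one bound \<open>b\<close> holds for infinitely
    many \<open>n\<close>; these form the subsequence.\<close>
  have "\<not> (\<infinity> \<le> liminf (\<lambda>n. ?u n s))" using lim by (simp add: top_unique)
  then obtain y where y: "y < \<infinity>" "\<not> (\<forall>\<^sub>F n in sequentially. y < ?u n s)"
    unfolding le_Liminf_iff by blast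
  obtain b where b: "y = ennreal b" "b \<ge> 0" using y(1) by (cases y) auto
  have "infinite {n. norm (X n s) powr p \<le> b}"
  proof
    assume "finite {n. norm (X n s) powr p \<le> b}"
    then have "\<forall>\<^sub>F n in cofinite. \<not> (norm (X n s) powr p \<le> b)" by (simp add: eventually_cofinite)
    then have "\<forall>\<^sub>F n in sequentially. y < ?u n s"
      unfolding cofinite_eq_sequentially by eventually_elim (use b in \<open>simp add: ennreal_less_iff\<close>)
    with y(2) show False by simp
  qed
  then obtain \<sigma> :: "nat \<Rightarrow> nat" where \<sigma>: "strict_mono \<sigma>" "\<And>n. norm (X (\<sigma> n) s) powr p \<le> b"
    using infinite_enumerate by force
  have "norm (X (\<sigma> n) s) \<le> 1 + b" for n
    using le_one_plus_powr[of "norm (X (\<sigma> n) s)" p] \<sigma>(2)[of n] p2 by simp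
  then have "x (\<sigma> n) s \<in> \<iota> ` cball 0 (1 + b)" for n
    unfolding eq by (intro imageI) simp
  then have mem: "x (\<sigma> n) s \<in> closure (\<iota> ` cball 0 (1 + b))" for n
    using closure_subset by blast
  have "compact (closure (\<iota> ` cball 0 (1 + b)))" by (rule compact_\<iota>) simp
  then obtain l \<rho> where "strict_mono \<rho>" "((\<lambda>n. x (\<sigma> n) s) \<circ> \<rho>) \<longlonglongrightarrow> l"
    using mem unfolding compact_eq_seq_compact_metric seq_compact_def by metis
  then have "strict_mono (\<sigma> \<circ> \<rho>) \<and> convergent (\<lambda>n. x ((\<sigma> \<circ> \<rho>) n) s)"
    using \<sigma>(1) by (auto simp: strict_mono_def convergent_def o_def)
  with s show ?thesis by blast
qed

text \<open>Finitely many times are treated by successive thinning, which preserves convergence at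
  the earlier ones. The times are free within prescribed intervals because convergence can be
  arranged only at almost every time.\<close>

lemma subsequence_at_times:
  fixes x f :: "nat \<Rightarrow> real \<Rightarrow> 'h" and c d :: "nat \<Rightarrow> real"
  assumes x: "\<And>n. trajectory_rhs \<iota> A p q T L t\<^sub>0 x\<^sub>0 (x n) (f n)"
    and t\<^sub>0: "0 \<le> t\<^sub>0" "t\<^sub>0 < T" and "L \<ge> 0" and R: "\<And>n. 1 + sup_norm T (x n) \<le> R"
    and cd: "\<And>k. k < N \<Longrightarrow> t\<^sub>0 \<le> c k" "\<And>k. k < N \<Longrightarrow> c k < d k" "\<And>k. k < N \<Longrightarrow> d k \<le> T"
  shows "\<exists>s \<sigma>. strict_mono \<sigma> \<and> (\<forall>k<N. s k \<in> {c k<..<d k} \<and> convergent (\<lambda>n. x (\<sigma> n) (s k)))"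
  using cd
proof (induction N)
  case 0
  show ?case by (intro exI[of _ "\<lambda>n. n"] exI[of _ "\<lambda>_. 0"]) (auto simp: strict_mono_def)
next
  case (Suc N)
  have "\<exists>s \<sigma>. strict_mono \<sigma> \<and> (\<forall>k<N. s k \<in> {c k<..<d k} \<and> convergent (\<lambda>n. x (\<sigma> n) (s k)))"
    by (rule Suc.IH) (use Suc.prems in auto)
  then obtain s \<sigma> where \<sigma>: "strict_mono \<sigma>"
    and s\<sigma>: "\<forall>k<N. s k \<in> {c k<..<d k} \<and> convergent (\<lambda>n. x (\<sigma> n) (s k))" by blast
  then have s: "strict_mono \<sigma>" "\<And>k. k < N \<Longrightarrow> s k \<in> {c k<..<d k}"
    "\<And>k. k < N \<Longrightarrow> convergent (\<lambda>n. x (\<sigma> n) (s k))" by blast+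
  obtain r \<rho> where r: "r \<in> {c N<..<d N}" "strict_mono \<rho>" "convergent (\<lambda>n. x (\<sigma> (\<rho> n)) r)"
    using subsequence_at_time[of L t\<^sub>0 x\<^sub>0 "\<lambda>n. x (\<sigma> n)" "\<lambda>n. f (\<sigma> n)" R "c N" "d N"] x t\<^sub>0 \<open>L \<ge> 0\<close> R Suc.prems
    by auto
  have "convergent (\<lambda>n. x (\<sigma> (\<rho> n)) (s k))" if "k < N" for k
    using convergent_subseq_convergent[OF s(3)[OF that] r(2)] by (simp add: o_def)
  then have "strict_mono (\<sigma> \<circ> \<rho>) \<and> (\<forall>k<Suc N. (s(N := r)) k \<in> {c k<..<d k} \<and> convergent (\<lambda>n. x ((\<sigma> \<circ> \<rho>) n) ((s(N := r)) k)))"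
    using s(1,2) r by (auto simp: strict_mono_def less_Suc_eq)
  then show ?case by blast
qed

text \<open>Total boundedness asks for two members of the sequence that are close, so no limit path
  is constructed. They are close at one time in each cell of a fine grid, and
  \<open>difference_growth\<close> covers the gaps.\<close>

lemma close_pair:
  fixes x f :: "nat \<Rightarrow> real \<Rightarrow> 'h"
  assumes x: "\<And>n. trajectory_rhs \<iota> A p q T L t\<^sub>0 x\<^sub>0 (x n) (f n)"
    and t\<^sub>0: "0 \<le> t\<^sub>0" "t\<^sub>0 < T" and "L \<ge> 0" and x\<^sub>0: "x\<^sub>0 \<in> paths T" and "e > 0"
  shows "\<exists>m n. m < n \<and> (\<forall>t\<in>{0..T}. norm (x m t - x n t) < e)"
proof -
  obtain R where R: "R \<ge> 1" "\<And>n. 1 + sup_norm T (x n) \<le> R"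
    using a_priori_bound[OF \<open>L \<ge> 0\<close> t\<^sub>0 x\<^sub>0] x by metis
  \<comment> \<open>A comparison time will lie at most two cells of length \<delta> back, so the
    squared distance grows by at most \<open>8 * L * R\<^sup>2 * (2 * \<delta>)\<close>, which
    equals \<open>B / N\<close>.\<close>
  define B where "B = 16 * L * R\<^sup>2 * (T - t\<^sub>0)"
  have "B \<ge> 0" using \<open>L \<ge> 0\<close> t\<^sub>0 by (simp add: B_def)
  obtain N :: nat where N: "N > 4 * (B + 1) / e\<^sup>2" using reals_Archimedean2 by blast
  have "4 * (B + 1) / e\<^sup>2 > 0" using \<open>B \<ge> 0\<close> \<open>e > 0\<close> by simp
  then have "N > 0" using N by (metis of_nat_0_less_iff order_less_trans)
  define \<delta> where "\<delta> = (T - t\<^sub>0) / N"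
  have \<delta>: "\<delta> > 0" "N * \<delta> = T - t\<^sub>0" using \<open>N > 0\<close> t\<^sub>0 by (auto simp: \<delta>_def)
  have small: "16 * L * R\<^sup>2 * \<delta> < e\<^sup>2 / 4"
  proof -
    have "4 * (B + 1) < N * e\<^sup>2" using N \<open>e > 0\<close> by (simp add: pos_divide_less_eq)
    then have "B / N < e\<^sup>2 / 4" using \<open>N > 0\<close> by (simp add: field_simps)
    then show ?thesis by (simp add: B_def \<delta>_def)
  qed
  have pos: "t\<^sub>0 + real k * \<delta> \<le> T" if "k \<le> N" for k
  proof -
    have "real k * \<delta> \<le> real N * \<delta>" using that \<delta>(1) by (intro mult_right_mono) auto
    then show ?thesis using \<delta>(2) by simp
  qed
  have "\<exists>s \<sigma>. strict_mono \<sigma> \<and> (\<forall>k<N. s k \<in> {t\<^sub>0 + real k * \<delta><..<t\<^sub>0 + real (Suc k) * \<delta>} \<and> convergent (\<lambda>n. x (\<sigma> n) (s k)))"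
    using \<delta>(1) pos[of "Suc _"] by (intro subsequence_at_times[OF x t\<^sub>0 \<open>L \<ge> 0\<close> R(2)]) (auto simp: algebra_simps)
  then obtain s \<sigma> where \<sigma>: "strict_mono \<sigma>" and s: "\<And>k. k < N \<Longrightarrow> s k \<in> {t\<^sub>0 + real k * \<delta><..<t\<^sub>0 + real (Suc k) * \<delta>}"
    and conv: "\<And>k. k < N \<Longrightarrow> convergent (\<lambda>n. x (\<sigma> n) (s k))" by blast
  have "\<forall>\<^sub>F n in sequentially. \<forall>k\<in>{..<N}. norm (x (\<sigma> n) (s k) - x (\<sigma> (Suc n)) (s k)) < e / 2"
  proof (rule eventually_ball_finite)
    show "\<forall>k\<in>{..<N}. \<forall>\<^sub>F n in sequentially. norm (x (\<sigma> n) (s k) - x (\<sigma> (Suc n)) (s k)) < e / 2"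
    proof
      fix k assume "k \<in> {..<N}"
      then obtain l where l: "(\<lambda>n. x (\<sigma> n) (s k)) \<longlonglongrightarrow> l" using conv by (auto simp: convergent_def)
      have "(\<lambda>n. norm (x (\<sigma> n) (s k) - x (\<sigma> (Suc n)) (s k))) \<longlonglongrightarrow> norm (l - l)"
        by (intro tendsto_intros l LIMSEQ_Suc[OF l])
      then show "\<forall>\<^sub>F n in sequentially. norm (x (\<sigma> n) (s k) - x (\<sigma> (Suc n)) (s k)) < e / 2"
        using \<open>e > 0\<close> by (intro order_tendstoD(2)) auto
    qed
  qed simp
  then obtain n where n: "\<And>k. k < N \<Longrightarrow> norm (x (\<sigma> n) (s k) - x (\<sigma> (Suc n)) (s k)) < e / 2"
    by (auto simp: eventually_sequentially)
  let ?w = "\<lambda>t. x (\<sigma> n) t - x (\<sigma> (Suc n)) t"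
  have growth: "(norm (?w t))\<^sup>2 \<le> (norm (?w s))\<^sup>2 + 8 * L * R\<^sup>2 * (t - s)" if "t\<^sub>0 \<le> s" "s \<le> t" "t \<le> T" for s t
    by (rule difference_growth[OF x x t\<^sub>0 \<open>L \<ge> 0\<close> R(2) R(2) that])
  have eq0: "?w t = 0" if "t \<in> {0..t\<^sub>0}" for t
    using x that unfolding trajectory_rhs_def by auto
  have "norm (?w t) < e" if t: "t \<in> {0..T}" for t
  proof -
    have "\<exists>r. t\<^sub>0 \<le> r \<and> r \<le> t \<and> t - r \<le> 2 * \<delta> \<and> norm (?w r) < e / 2" if "t > t\<^sub>0"
    proof -
      \<comment> \<open>\<open>j\<close> numbers the cell of \<open>t\<close>. The time chosen in
        that cell may come after \<open>t\<close>, so the one in the preceding cell is used; in cell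
        0 it is replaced by \<open>t\<^sub>0\<close>, where the paths agree.\<close>
      define j where "j = nat \<lfloor>(t - t\<^sub>0) / \<delta>\<rfloor>"
      have j: "real j \<le> (t - t\<^sub>0) / \<delta>" "(t - t\<^sub>0) / \<delta> < real j + 1"
        using that \<delta>(1) by (simp_all add: j_def)
      then have j: "real j * \<delta> \<le> t - t\<^sub>0" "t - t\<^sub>0 < (real j + 1) * \<delta>"
        using \<delta>(1) by (simp_all add: pos_le_divide_eq pos_divide_less_eq)
      show ?thesis
      proof (cases j)
        case 0
        then show ?thesis using j that eq0[of t\<^sub>0] t\<^sub>0 \<open>e > 0\<close> \<delta>(1) by (intro exI[of _ t\<^sub>0]) auto
      next
        case (Suc i)
        have "real j * \<delta> \<le> real N * \<delta>" using j(1) t \<delta>(2) by auto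
        then have "j \<le> N" using \<delta>(1) by simp
        then have "i < N" using Suc by simp
        have "real (Suc i) * \<delta> = real i * \<delta> + \<delta>" by (simp add: algebra_simps)
        moreover have "0 \<le> real i * \<delta>" using \<delta>(1) by simp
        moreover have "(real j + 1) * \<delta> = real (Suc i) * \<delta> + \<delta>" using Suc by (simp add: algebra_simps)
        moreover have "real (Suc i) * \<delta> \<le> t - t\<^sub>0" using j(1) Suc by simp
        ultimately have "t\<^sub>0 \<le> s i" "s i \<le> t" "t - s i \<le> 2 * \<delta>"
          using s[OF \<open>i < N\<close>] j(2) unfolding greaterThanLessThan_iff by linarith+
        then show ?thesis using n[OF \<open>i < N\<close>] by blast
      qed
    qed
    then obtain r where r: "t\<^sub>0 \<le> r" "r \<le> t" "t - r \<le> 2 * \<delta>" "norm (?w r) < e / 2" if "t > t\<^sub>0" by blast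
    show ?thesis
    proof (cases "t \<le> t\<^sub>0")
      case True
      then show ?thesis using eq0[of t] t \<open>e > 0\<close> by simp
    next
      case False
      then have "(norm (?w t))\<^sup>2 \<le> (norm (?w r))\<^sup>2 + 8 * L * R\<^sup>2 * (t - r)"
        using r t by (intro growth) auto
      also have "(norm (?w r))\<^sup>2 \<le> (e / 2)\<^sup>2" using r False by (intro power_mono) auto
      also have "8 * L * R\<^sup>2 * (t - r) \<le> 8 * L * R\<^sup>2 * (2 * \<delta>)"
        using r False \<open>L \<ge> 0\<close> by (intro mult_left_mono) auto
      finally have "(norm (?w t))\<^sup>2 \<le> (e / 2)\<^sup>2 + 16 * L * R\<^sup>2 * \<delta>" by simp
      also have "\<dots> < e\<^sup>2"
      proof -
        have "(e / 2)\<^sup>2 = e\<^sup>2 / 4" "e\<^sup>2 > 0" using \<open>e > 0\<close> by (simp_all add: power_divide)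
        then show ?thesis using small by linarith
      qed
      finally show ?thesis using \<open>e > 0\<close> by (simp add: power2_less_imp_less)
    qed
  qed
  moreover have "\<sigma> n < \<sigma> (Suc n)" using \<sigma> by (simp add: strict_mono_def)
  ultimately show ?thesis by blast
qed

text \<open>Freezing a path outside [0,T] embeds it isometrically into the Banach space of bounded
  continuous functions on the line, whose completeness is then available.\<close>

definition path_fun :: "(real \<Rightarrow> 'h) \<Rightarrow> (real \<Rightarrow>\<^sub>C 'h)" where
  "path_fun x = Bcontfun (\<lambda>r. x (max 0 (min T r)))"

lemma path_fun_apply:
  assumes "x \<in> paths T"
  shows "apply_bcontfun (path_fun x) r = x (max 0 (min T r))"
proof -
  have cont: "continuous_on UNIV (\<lambda>r. x (max 0 (min T r)))"
    by (rule continuous_on_compose2[OF pathsD[OF assms]]) (use T_pos in \<open>auto intro!: continuous_intros\<close>)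
  have "bounded (x ` {0..T})"
    by (intro compact_imp_bounded compact_continuous_image pathsD[OF assms]) auto
  then have "bounded (range (\<lambda>r. x (max 0 (min T r))))"
    by (rule bounded_subset) (use T_pos in auto)
  with cont have "(\<lambda>r. x (max 0 (min T r))) \<in> bcontfun" by (simp add: bcontfun_def)
  then show ?thesis by (simp add: path_fun_def Bcontfun_inverse)
qed

lemma restrict_path_fun: "x \<in> paths T \<Longrightarrow> restrict (apply_bcontfun (path_fun x)) {0..T} = x"
  by (rule extensionalityI[where A="{0..T}"]) (auto simp: paths_def path_fun_apply[unfolded paths_def])

lemma restrict_in_paths: "restrict (apply_bcontfun \<phi>) {0..T} \<in> paths T"
proof -
  have "continuous_on {0..T} (restrict (apply_bcontfun \<phi>) {0..T})"
    by (rule continuous_on_eq[OF continuous_on_apply_bcontfun[of _ \<phi>]]) simp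
  then show ?thesis by (simp add: paths_def)
qed

lemma dist_path_fun_le:
  assumes "x \<in> paths T" "y \<in> paths T" "\<And>r. r \<in> {0..T} \<Longrightarrow> norm (x r - y r) \<le> c"
  shows "dist (path_fun x) (path_fun y) \<le> c"
  by (rule dist_bound) (use assms T_pos in \<open>auto simp: path_fun_apply dist_norm\<close>)

lemma TrajE: assumes "x \<in> Traj L t\<^sub>0 x\<^sub>0" obtains f where "trajectory_rhs \<iota> A p q T L t\<^sub>0 x\<^sub>0 x f" "x \<in> paths T"
  using assms by (auto simp: trajectories_def trajectory_rhs_def)

text \<open>If total boundedness failed, there would be an infinite separated sequence of
  trajectories, in conflict with \<open>close_pair\<close>. Closedness of the trajectory set is not
  established; the closure in the complete space takes its place.\<close>

lemma compact_trajectories: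
  assumes t\<^sub>0: "0 \<le> t\<^sub>0" "t\<^sub>0 < T" and "L \<ge> 0" and x\<^sub>0: "x\<^sub>0 \<in> paths T"
  shows "compact (closure (path_fun ` Traj L t\<^sub>0 x\<^sub>0))"
  unfolding compact_eq_totally_bounded
proof (intro conjI allI impI)
  let ?S = "path_fun ` Traj L t\<^sub>0 x\<^sub>0"
  show "complete (closure ?S)" by (simp add: complete_eq_closed)
  fix \<epsilon> :: real assume "\<epsilon> > 0"
  have "\<exists>k. finite k \<and> k \<subseteq> ?S \<and> ?S \<subseteq> (\<Union>x\<in>k. ball x (\<epsilon> / 2))"
  proof (rule ccontr)
    assume "\<not> ?thesis"
    then have *: "\<And>k. finite k \<Longrightarrow> k \<subseteq> ?S \<Longrightarrow> \<not> ?S \<subseteq> (\<Union>x\<in>k. ball x (\<epsilon> / 2))" by blast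
    let ?Q = "\<lambda>x n r. r \<in> ?S \<and> (\<forall>m < (n::nat). \<not> (dist (x m) r < \<epsilon> / 2))"
    have "\<exists>x. \<forall>n::nat. ?Q x n (x n)"
    proof (rule dependent_wellorder_choice)
      fix n x assume "\<And>y. y < n \<Longrightarrow> ?Q x y (x y)"
      then have "\<not> ?S \<subseteq> (\<Union>x\<in>x ` {0..<n}. ball x (\<epsilon> / 2))"
        using *[of "x ` {0 ..< n}"] by (auto simp: subset_eq)
      then obtain z where z: "z \<in> ?S" "z \<notin> (\<Union>x\<in>x ` {0..<n}. ball x (\<epsilon> / 2))"
        unfolding subset_eq by blast
      have "\<not> dist (x m) z < \<epsilon> / 2" if "m < n" for m
        using z(2) that by (simp del: less_divide_eq_numeral1)
      with z(1) show "\<exists>r. ?Q x n r" by blast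
    qed simp
    then obtain \<phi> :: "nat \<Rightarrow> (real \<Rightarrow>\<^sub>C 'h)" where \<phi>: "\<forall>n. \<phi> n \<in> ?S" and sep: "\<And>n m. m < n \<Longrightarrow> \<not> (dist (\<phi> m) (\<phi> n) < \<epsilon> / 2)"
      by blast
    have "\<forall>n. \<exists>xf. trajectory_rhs \<iota> A p q T L t\<^sub>0 x\<^sub>0 (fst xf) (snd xf) \<and> \<phi> n = path_fun (fst xf)"
      using \<phi> by (force simp: trajectories_def)
    then obtain xf where xf: "\<And>n. trajectory_rhs \<iota> A p q T L t\<^sub>0 x\<^sub>0 (fst (xf n)) (snd (xf n))"
      "\<And>n. \<phi> n = path_fun (fst (xf n))" by metis
    obtain m n where mn: "m < n" "\<forall>t\<in>{0..T}. norm (fst (xf m) t - fst (xf n) t) < \<epsilon> / 4"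
      using close_pair[of L t\<^sub>0 x\<^sub>0 "\<lambda>n. fst (xf n)" "\<lambda>n. snd (xf n)" "\<epsilon> / 4"] xf(1) t\<^sub>0 \<open>L \<ge> 0\<close> x\<^sub>0 \<open>\<epsilon> > 0\<close> by auto
    have "fst (xf n) \<in> paths T" for n using xf(1)[of n] by (simp add: trajectory_rhs_def)
    then have "dist (\<phi> m) (\<phi> n) \<le> \<epsilon> / 4"
      unfolding xf(2) using mn(2) by (intro dist_path_fun_le) (auto intro: less_imp_le)
    with sep[OF mn(1)] \<open>\<epsilon> > 0\<close> show False by simp
  qed
  then obtain k where k: "finite k" "?S \<subseteq> (\<Union>x\<in>k. ball x (\<epsilon> / 2))" by blast
  \<comment> \<open>Closed balls of half the radius cover the closure as well.\<close>
  have "?S \<subseteq> (\<Union>x\<in>k. cball x (\<epsilon> / 2))"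
    by (rule subset_trans[OF k(2)]) (intro UN_mono order_refl ball_subset_cball)
  moreover have "closed (\<Union>x\<in>k. cball x (\<epsilon> / 2))" using k(1) by auto
  ultimately have "closure ?S \<subseteq> (\<Union>x\<in>k. cball x (\<epsilon> / 2))" by (rule closure_minimal)
  also have "\<dots> \<subseteq> (\<Union>x\<in>k. ball x \<epsilon>)"
  proof (rule UN_mono)
    fix x
    show "cball x (\<epsilon> / 2) \<subseteq> ball x \<epsilon>" using \<open>\<epsilon> > 0\<close> by auto
  qed simp
  finally show "\<exists>k. finite k \<and> closure ?S \<subseteq> (\<Union>x\<in>k. ball x \<epsilon>)" using k(1) by blast
qed

section \<open>Uniform continuity over the trajectory set\<close>

lemma uniformly_continuous_path:
  fixes f :: "real \<Rightarrow> 'h"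
  assumes "continuous_on {0..T} f" "e > 0"
  shows "\<exists>d>0. \<forall>s\<in>{0..T}. \<forall>t\<in>{0..T}. \<bar>s - t\<bar> < d \<longrightarrow> norm (f s - f t) < e"
proof -
  have "uniformly_continuous_on {0..T} f"
    by (intro compact_uniformly_continuous assms(1)) auto
  then have "\<forall>e>0. \<exists>d>0. \<forall>s\<in>{0..T}. \<forall>t\<in>{0..T}. dist t s < d \<longrightarrow> dist (f t) (f s) < e"
    by (simp only: uniformly_continuous_on_def)
  with \<open>e > 0\<close> have "\<exists>d>0. \<forall>s\<in>{0..T}. \<forall>t\<in>{0..T}. dist t s < d \<longrightarrow> dist (f t) (f s) < e" by simp
  then show ?thesis by (simp add: dist_norm norm_minus_commute abs_minus_commute)
qed

text \<open>A finite net of radius \<open>e / 3\<close> reduces the claim to the uniform continuity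
  of finitely many functions.\<close>

lemma equicontinuous_trajectories:
  assumes t\<^sub>0: "0 \<le> t\<^sub>0" "t\<^sub>0 < T" and "L \<ge> 0" and x\<^sub>0: "x\<^sub>0 \<in> paths T" and "e > 0"
  shows "\<exists>\<delta>>0. \<forall>x\<in>Traj L t\<^sub>0 x\<^sub>0. \<forall>s\<in>{0..T}. \<forall>t\<in>{0..T}. \<bar>s - t\<bar> < \<delta> \<longrightarrow> norm (x s - x t) < e"
proof -
  let ?S = "closure (path_fun ` Traj L t\<^sub>0 x\<^sub>0)"
  have "\<forall>\<epsilon>>0. \<exists>k. finite k \<and> ?S \<subseteq> (\<Union>x\<in>k. ball x \<epsilon>)"
    using compact_trajectories[OF assms(1-4)] unfolding compact_eq_totally_bounded by (rule conjunct2)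
  moreover have "e / 3 > 0" using \<open>e > 0\<close> by simp
  ultimately obtain k where k: "finite k" "?S \<subseteq> (\<Union>x\<in>k. ball x (e / 3))" by blast
  have "\<exists>\<delta>>0. \<forall>s\<in>{0..T}. \<forall>t\<in>{0..T}. \<bar>s - t\<bar> < \<delta> \<longrightarrow> norm (apply_bcontfun \<phi> s - apply_bcontfun \<phi> t) < e / 3" for \<phi> :: "real \<Rightarrow>\<^sub>C 'h"
    using \<open>e > 0\<close> by (intro uniformly_continuous_path) auto
  then have "\<forall>\<phi> :: real \<Rightarrow>\<^sub>C 'h. \<exists>\<delta>. \<delta> > 0 \<and> (\<forall>s\<in>{0..T}. \<forall>t\<in>{0..T}. \<bar>s - t\<bar> < \<delta> \<longrightarrow>
      norm (apply_bcontfun \<phi> s - apply_bcontfun \<phi> t) < e / 3)" by blast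
  from choice[OF this] obtain d :: "(real \<Rightarrow>\<^sub>C 'h) \<Rightarrow> real" where d: "\<And>\<phi>. d \<phi> > 0" "\<And>\<phi> s t. s \<in> {0..T} \<Longrightarrow> t \<in> {0..T} \<Longrightarrow> \<bar>s - t\<bar> < d \<phi> \<Longrightarrow>
      norm (apply_bcontfun \<phi> s - apply_bcontfun \<phi> t) < e / 3" by blast
  \<comment> \<open>The element 1 keeps the minimum defined when the net is empty.\<close>
  define \<delta> where "\<delta> = Min (insert 1 (d ` k))"
  have "\<delta> > 0" using k(1) d(1) by (auto simp: \<delta>_def)
  moreover have "norm (x s - x t) < e" if x: "x \<in> Traj L t\<^sub>0 x\<^sub>0" and st: "s \<in> {0..T}" "t \<in> {0..T}" "\<bar>s - t\<bar> < \<delta>" for x s t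
  proof -
    have "path_fun x \<in> ?S" using imageI[OF x, of path_fun] closure_subset by (rule rev_subsetD)
    then obtain \<phi> where \<phi>: "\<phi> \<in> k" "dist \<phi> (path_fun x) < e / 3" using k(2) by auto
    have "\<delta> \<le> d \<phi>" using k(1) \<phi>(1) by (simp add: \<delta>_def)
    then have 1: "norm (apply_bcontfun \<phi> s - apply_bcontfun \<phi> t) < e / 3" using st by (intro d) auto
    have px: "x \<in> paths T" using x by (rule TrajE)
    have 2: "norm (apply_bcontfun \<phi> r - x r) < e / 3" if "r \<in> {0..T}" for r
      using dist_bounded[of \<phi> r "path_fun x"] \<phi>(2) that by (simp add: path_fun_apply[OF px] dist_norm)
    have "x s - x t = (apply_bcontfun \<phi> s - apply_bcontfun \<phi> t) - (apply_bcontfun \<phi> s - x s) + (apply_bcontfun \<phi> t - x t)"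
      by simp
    also have "norm \<dots> \<le> norm (apply_bcontfun \<phi> s - apply_bcontfun \<phi> t) + norm (apply_bcontfun \<phi> s - x s) + norm (apply_bcontfun \<phi> t - x t)"
      by (intro order_trans[OF norm_triangle_ineq] add_right_mono norm_triangle_ineq4)
    finally show ?thesis using 1 2[OF st(1)] 2[OF st(2)] by linarith
  qed
  ultimately show ?thesis by blast
qed

text \<open>Restriction to [0,T] extends the functional continuously to all bounded continuous
  functions; on the compact closure it is bounded and uniformly continuous.\<close>

lemma terminal_uniform:
  fixes h :: "(real \<Rightarrow> 'h) \<Rightarrow> real"
  assumes t\<^sub>0: "0 \<le> t\<^sub>0" "t\<^sub>0 < T" and "L \<ge> 0" and x\<^sub>0: "x\<^sub>0 \<in> paths T" and h: "continuous_terminal T h"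
  shows "\<exists>C. \<forall>x\<in>Traj L t\<^sub>0 x\<^sub>0. \<bar>h x\<bar> \<le> C"
    and "e > 0 \<Longrightarrow> \<exists>\<delta>>0. \<forall>x\<in>Traj L t\<^sub>0 x\<^sub>0. \<forall>y\<in>Traj L t\<^sub>0 x\<^sub>0.
       (\<forall>r\<in>{0..T}. norm (x r - y r) < \<delta>) \<longrightarrow> \<bar>h x - h y\<bar> < e"
proof -
  let ?S = "closure (path_fun ` Traj L t\<^sub>0 x\<^sub>0)"
  let ?h = "\<lambda>\<phi>. h (restrict (apply_bcontfun \<phi>) {0..T})"
  have "continuous_on UNIV ?h"
    unfolding continuous_on_iff
  proof (intro ballI allI impI)
    fix \<phi> :: "real \<Rightarrow>\<^sub>C 'h" and e :: real assume "e > 0"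
    then obtain \<delta> where \<delta>: "\<delta> > 0" "\<And>y. y \<in> paths T \<Longrightarrow>
       sup_norm T (\<lambda>r. restrict (apply_bcontfun \<phi>) {0..T} r - y r) < \<delta> \<Longrightarrow> \<bar>?h \<phi> - h y\<bar> < e"
      using h restrict_in_paths[of \<phi>] unfolding continuous_terminal_def by metis
    have "dist (?h \<psi>) (?h \<phi>) < e" if "dist \<psi> \<phi> < \<delta> / 2" for \<psi>
    proof -
      have "sup_norm T (\<lambda>r. restrict (apply_bcontfun \<phi>) {0..T} r - restrict (apply_bcontfun \<psi>) {0..T} r) \<le> \<delta> / 2"
      proof (rule sup_norm_least)
        fix r assume r: "r \<in> {0..T}"
        have "dist (apply_bcontfun \<phi> r) (apply_bcontfun \<psi> r) \<le> \<delta> / 2"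
          by (rule order_trans[OF dist_bounded]) (use that in \<open>simp add: dist_commute\<close>)
        then show "norm (restrict (apply_bcontfun \<phi>) {0..T} r - restrict (apply_bcontfun \<psi>) {0..T} r) \<le> \<delta> / 2"
          using r by (simp add: dist_norm)
      qed (use T_pos in simp)
      then show ?thesis using \<delta>(2)[OF restrict_in_paths, of \<psi>] \<delta>(1) by (simp add: dist_real_def abs_minus_commute)
    qed
    then show "\<exists>d>0. \<forall>\<psi>\<in>UNIV. dist \<psi> \<phi> < d \<longrightarrow> dist (?h \<psi>) (?h \<phi>) < e"
      using \<delta>(1) by (intro exI[of _ "\<delta> / 2"]) auto
  qed
  then have cont: "continuous_on ?S ?h" by (rule continuous_on_subset) simp
  note comp = compact_trajectories[OF assms(1-4)]
  have mem: "path_fun x \<in> ?S" if "x \<in> Traj L t\<^sub>0 x\<^sub>0" for x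
    using imageI[OF that, of path_fun] closure_subset by (rule rev_subsetD)
  have eq: "?h (path_fun x) = h x" if "x \<in> Traj L t\<^sub>0 x\<^sub>0" for x
    using that by (auto elim!: TrajE simp: restrict_path_fun)
  have "bounded (?h ` ?S)" by (intro compact_imp_bounded compact_continuous_image cont comp)
  then obtain C where "\<forall>\<phi>\<in>?S. \<bar>?h \<phi>\<bar> \<le> C" by (auto simp: bounded_iff)
  then show "\<exists>C. \<forall>x\<in>Traj L t\<^sub>0 x\<^sub>0. \<bar>h x\<bar> \<le> C" using mem eq by metis
  assume "e > 0"
  moreover have "uniformly_continuous_on ?S ?h" by (rule compact_uniformly_continuous[OF cont comp])
  ultimately obtain \<delta> where \<delta>: "\<delta> > 0" "\<And>\<phi> \<psi>. \<phi> \<in> ?S \<Longrightarrow> \<psi> \<in> ?S \<Longrightarrow> dist \<psi> \<phi> < \<delta> \<Longrightarrow> dist (?h \<psi>) (?h \<phi>) < e"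
    unfolding uniformly_continuous_on_def by metis
  have "\<bar>h x - h y\<bar> < e" if xy: "x \<in> Traj L t\<^sub>0 x\<^sub>0" "y \<in> Traj L t\<^sub>0 x\<^sub>0" "\<forall>r\<in>{0..T}. norm (x r - y r) < \<delta> / 2" for x y
  proof -
    have "dist (path_fun x) (path_fun y) \<le> \<delta> / 2"
      using xy by (intro dist_path_fun_le) (auto elim: TrajE intro: less_imp_le)
    then show ?thesis using \<delta>(2)[OF mem[OF xy(2)] mem[OF xy(1)]] \<delta>(1) xy eq by (simp add: dist_real_def)
  qed
  then show "\<exists>\<delta>>0. \<forall>x\<in>Traj L t\<^sub>0 x\<^sub>0. \<forall>y\<in>Traj L t\<^sub>0 x\<^sub>0. (\<forall>r\<in>{0..T}. norm (x r - y r) < \<delta>) \<longrightarrow> \<bar>h x - h y\<bar> < e"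
    using \<delta>(1) by (intro exI[of _ "\<delta> / 2"]) auto
qed

lemma d_inf_le:
  assumes "\<And>r. r \<in> {0..T} \<Longrightarrow> norm (x (min r t) - y (min r s)) \<le> c"
  shows "d_inf T (t, x) (s, y) \<le> \<bar>t - s\<bar> + c"
  unfolding d_inf_def using assms T_pos by (auto intro!: cSUP_least)

text \<open>A change of the stopping time costs the oscillation of \<open>x\<close>, a change of the
  path costs the sup distance; the two are added in \<open>d_inf\<close>.\<close>

lemma d_inf_small:
  fixes x :: "real \<Rightarrow> 'h"
  assumes x: "continuous_on {0..T} x" and t: "t \<in> {0..T}" and "e > 0"
  shows "\<exists>\<delta>>0. \<forall>s\<in>{0..T}. \<forall>y. \<bar>t - s\<bar> < \<delta> \<and> (\<forall>r\<in>{0..T}. norm (x r - y r) < \<delta>) \<longrightarrow> d_inf T (t, x) (s, y) < e"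
proof -
  obtain d where d: "d > 0" "\<And>r s. r \<in> {0..T} \<Longrightarrow> s \<in> {0..T} \<Longrightarrow> \<bar>r - s\<bar> < d \<Longrightarrow> norm (x r - x s) < e / 4"
    using uniformly_continuous_path[OF x, of "e / 4"] \<open>e > 0\<close> by auto
  let ?\<delta> = "min d (e / 4)"
  have "d_inf T (t, x) (s, y) < e" if s: "s \<in> {0..T}" "\<bar>t - s\<bar> < ?\<delta>" and y: "\<forall>r\<in>{0..T}. norm (x r - y r) < ?\<delta>" for s y
  proof -
    have "norm (x (min r t) - y (min r s)) \<le> e / 4 + e / 4" if r: "r \<in> {0..T}" for r
    proof -
      have m: "min r t \<in> {0..T}" "min r s \<in> {0..T}" using r s t by auto
      have "norm (x (min r t) - x (min r s)) < e / 4" using m s(2) by (intro d) auto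
      moreover have "norm (x (min r s) - y (min r s)) < ?\<delta>" using y m by blast
      moreover have "norm (x (min r t) - y (min r s)) \<le> norm (x (min r t) - x (min r s)) + norm (x (min r s) - y (min r s))"
        using norm_triangle_ineq[of "x (min r t) - x (min r s)" "x (min r s) - y (min r s)"] by simp
      ultimately show ?thesis by linarith
    qed
    from d_inf_le[of x t y s, OF this] show ?thesis using s(2) \<open>e > 0\<close> by auto
  qed
  then show ?thesis using d(1) \<open>e > 0\<close> by (intro exI[of _ ?\<delta>]) auto
qed

end

section \<open>Comparison\<close>

lemma norm_diff_le_three:
  fixes a b c d :: "'a::real_normed_vector"
  shows "norm (a - b) \<le> norm (a - c) + norm (c - d) + norm (b - d)"
  using norm_triangle_ineq[of "a - c" "c - b"] norm_triangle_ineq4[of "c - d" "b - d"] by simp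

text \<open>Everything is fixed at one starting point \<open>(t\<^sub>0, x\<^sub>0)\<close>: a
  common \<open>L\<close> for both semisolutions, and the modulus \<open>m\<close> that belongs to
  this \<open>L\<close> and this point.\<close>

locale doubling = evolution T p q c\<^sub>2 \<iota> A
  for T p q c\<^sub>2 :: real
    and \<iota> :: "'v::{banach, second_countable_topology} \<Rightarrow>\<^sub>L 'h::{real_inner, complete_space}"
    and A :: "real \<Rightarrow> 'v \<Rightarrow> ('v \<Rightarrow>\<^sub>L real)" +
  fixes h :: "(real \<Rightarrow> 'h) \<Rightarrow> real" and F :: "real \<Rightarrow> (real \<Rightarrow> 'h) \<Rightarrow> 'h \<Rightarrow> real"
    and L\<^sub>0 L t\<^sub>0 :: real and m :: "real \<Rightarrow> real" and x\<^sub>0 :: "real \<Rightarrow> 'h"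
    and S :: "(real \<Rightarrow> 'h) set" and u v :: "real \<Rightarrow> (real \<Rightarrow> 'h) \<Rightarrow> real"
  assumes t\<^sub>0: "0 \<le> t\<^sub>0" "t\<^sub>0 < T" and L_nonneg: "L \<ge> 0" and x\<^sub>0: "x\<^sub>0 \<in> S" and S_paths: "S \<subseteq> paths T"
    and h_cont: "continuous_terminal T h"
    and F_cont: "\<And>t x z \<epsilon>. t \<in> {0..T} \<Longrightarrow> x \<in> paths T \<Longrightarrow> \<epsilon> > 0 \<Longrightarrow> \<exists>\<delta>>0. \<forall>s\<in>{0..T}. \<forall>y\<in>paths T. \<forall>z'.
        d_inf T (t, x) (s, y) < \<delta> \<and> norm (z - z') < \<delta> \<longrightarrow> \<bar>F t x z - F s y z'\<bar> < \<epsilon>"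
    and L\<^sub>0_nonneg: "L\<^sub>0 \<ge> 0"
    and F_lip: "\<And>t x z z'. t \<in> {0..T} \<Longrightarrow> x \<in> paths T \<Longrightarrow>
        \<bar>F t x z - F t x z'\<bar> \<le> L\<^sub>0 * (1 + sup_norm t x) * norm (z - z')"
    and m: "modulus_of_continuity m"
    and F_mod: "\<And>\<epsilon> t x y. \<epsilon> > 0 \<Longrightarrow> t \<in> {t\<^sub>0..T} \<Longrightarrow> x \<in> Traj L t\<^sub>0 x\<^sub>0 \<Longrightarrow> y \<in> Traj L t\<^sub>0 x\<^sub>0 \<Longrightarrow>
        F t x ((1 / \<epsilon>) *\<^sub>R (x t - y t)) - F t y ((1 / \<epsilon>) *\<^sub>R (x t - y t))
          \<le> m ((1 / \<epsilon>) * (norm (x t - y t))\<^sup>2 + sup_norm t (\<lambda>s. x s - y s))"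
    and u_T: "\<And>x. x \<in> S \<Longrightarrow> u T x \<le> h x" and v_T: "\<And>x. x \<in> S \<Longrightarrow> v T x \<ge> h x"
    and u_sub: "\<And>t\<^sub>1 x\<^sub>1 z. 0 \<le> t\<^sub>1 \<Longrightarrow> t\<^sub>1 < T \<Longrightarrow> x\<^sub>1 \<in> S \<Longrightarrow> \<exists>x\<in>S. \<exists>f. trajectory_rhs \<iota> A p q T L t\<^sub>1 x\<^sub>1 x f \<and>
        (\<forall>t\<in>{t\<^sub>1..T}. u t\<^sub>1 x\<^sub>1 \<le> integral\<^sup>L (lebesgue_on {t\<^sub>1..t}) (\<lambda>s. inner (- f s) z + F s x z) + u t x)"
    and v_sup: "\<And>t\<^sub>1 x\<^sub>1 z. 0 \<le> t\<^sub>1 \<Longrightarrow> t\<^sub>1 < T \<Longrightarrow> x\<^sub>1 \<in> S \<Longrightarrow> \<exists>x\<in>S. \<exists>f. trajectory_rhs \<iota> A p q T L t\<^sub>1 x\<^sub>1 x f \<and>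
        (\<forall>t\<in>{t\<^sub>1..T}. v t\<^sub>1 x\<^sub>1 \<ge> integral\<^sup>L (lebesgue_on {t\<^sub>1..t}) (\<lambda>s. inner (- f s) z + F s x z) + v t x)"
begin

section \<open>Trajectories from the fixed starting point and bounds on the semisolutions\<close>

definition Tr :: "(real \<Rightarrow> 'h) set" where "Tr = Traj L t\<^sub>0 x\<^sub>0 \<inter> S"

lemma Tr_paths: "x \<in> Tr \<Longrightarrow> x \<in> paths T"
  using S_paths by (auto simp: Tr_def)

lemma x\<^sub>0_paths: "x\<^sub>0 \<in> paths T"
  using x\<^sub>0 S_paths by auto

text \<open>The semisolution properties are applied at later times \<open>t\<^sub>1\<close>, and
  gluing returns the result to \<open>Tr\<close>. If \<open>t\<^sub>1 = t\<^sub>0\<close>, there is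
  no first piece, and the starting paths agree up to that time.\<close>

lemma Tr_extend:
  assumes x\<^sub>1: "x\<^sub>1 \<in> Tr" and "t\<^sub>0 \<le> t\<^sub>1" "t\<^sub>1 < T" and x: "trajectory_rhs \<iota> A p q T L t\<^sub>1 x\<^sub>1 x f" "x \<in> S"
  shows "x \<in> Tr"
proof -
  obtain g where g: "trajectory_rhs \<iota> A p q T L t\<^sub>0 x\<^sub>0 x\<^sub>1 g" using x\<^sub>1 by (auto simp: Tr_def trajectories_def)
  have "\<exists>f. trajectory_rhs \<iota> A p q T L t\<^sub>0 x\<^sub>0 x f"
  proof (cases "t\<^sub>0 = t\<^sub>1")
    case True
    have "x\<^sub>1 t = x\<^sub>0 t" if "t \<in> {0..t\<^sub>0}" for t using g that by (simp add: trajectory_rhs_def)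
    then have "trajectory_rhs \<iota> A p q T L t\<^sub>0 x\<^sub>0 x f" using x(1) True by (simp add: trajectory_rhs_def)
    then show ?thesis by blast
  next
    case False
    then show ?thesis using trajectory_rhs_concat[OF g x(1)] p2 q1 t\<^sub>0 assms(2,3) by auto
  qed
  then show ?thesis using x(2) by (auto simp: Tr_def trajectories_def)
qed

text \<open>Along a fixed path, continuity for \<open>d_inf\<close> turns into continuity in time,
  because nearby stopping times cost only the oscillation of the path.\<close>

lemma F_continuous: "x \<in> paths T \<Longrightarrow> continuous_on {0..T} (\<lambda>s. F s x z)"
  unfolding continuous_on_iff
proof (intro ballI allI impI)
  fix t e :: real assume x: "x \<in> paths T" and t: "t \<in> {0..T}" and "e > 0"
  obtain \<delta> where \<delta>: "\<delta> > 0" "\<forall>s\<in>{0..T}. \<forall>y\<in>paths T. \<forall>z'.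
        d_inf T (t, x) (s, y) < \<delta> \<and> norm (z - z') < \<delta> \<longrightarrow> \<bar>F t x z - F s y z'\<bar> < e"
    using F_cont[OF t x \<open>e > 0\<close>, of z] by auto
  obtain d where d: "d > 0" "\<forall>s\<in>{0..T}. \<forall>y. \<bar>t - s\<bar> < d \<and> (\<forall>r\<in>{0..T}. norm (x r - y r) < d) \<longrightarrow> d_inf T (t, x) (s, y) < \<delta>"
    using d_inf_small[OF pathsD[OF x] t \<delta>(1)] by auto
  have "\<bar>F t x z - F s x z\<bar> < e" if "s \<in> {0..T}" "\<bar>t - s\<bar> < d" for s
    using \<delta> d that x by auto
  then show "\<exists>d>0. \<forall>s\<in>{0..T}. dist s t < d \<longrightarrow> dist (F s x z) (F t x z) < e"
    using d(1) by (intro exI[of _ d]) (auto simp: dist_real_def abs_minus_commute)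
qed

lemma running_cost:
  assumes f: "f \<in> Lp_space 2 t\<^sub>1 T" and x: "x \<in> paths T" and t: "0 \<le> t\<^sub>1" "t\<^sub>1 \<le> t" "t \<le> T"
  shows "(\<lambda>s. - (f s \<bullet> z) + F s x z) absolutely_integrable_on {t\<^sub>1..t}"
    and "integral\<^sup>L (lebesgue_on {t\<^sub>1..t}) (\<lambda>s. inner (- f s) z + F s x z) = integral {t\<^sub>1..t} (\<lambda>s. - (f s \<bullet> z) + F s x z)"
proof -
  have "(\<lambda>s. f s \<bullet> z) absolutely_integrable_on {t\<^sub>1..T}"
  proof (rule absolutely_integrable_AE_bound)
    show "(\<lambda>s. f s \<bullet> z) \<in> borel_measurable (lebesgue_on {t\<^sub>1<..<T})"
      by (rule measurable_compose[OF Lp_spaceD(1)[OF f] borel_measurable_continuous_onI])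
         (intro continuous_intros)
    show "(\<lambda>s. norm z * norm (f s)) absolutely_integrable_on {t\<^sub>1..T}"
      by (intro absolutely_integrable_continuous_mult continuous_intros Lp_spaceD(3)[OF f]) simp
    show "AE s in lebesgue_on {t\<^sub>1<..<T}. \<bar>f s \<bullet> z\<bar> \<le> norm z * norm (f s)"
      by (intro AE_I2) (metis Cauchy_Schwarz_ineq2 mult.commute)
  qed
  then have "(\<lambda>s. f s \<bullet> z) absolutely_integrable_on {t\<^sub>1..t}"
    by (rule absolutely_integrable_on_subinterval) (use t in auto)
  moreover have "(\<lambda>s. F s x z) absolutely_integrable_on {t\<^sub>1..t}"
    by (intro absolutely_integrable_continuous_real continuous_on_subset[OF F_continuous[OF x]]) (use t in auto)
  ultimately have "(\<lambda>s. F s x z - f s \<bullet> z) absolutely_integrable_on {t\<^sub>1..t}" by (intro set_integral_diff(1))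
  then show *: "(\<lambda>s. - (f s \<bullet> z) + F s x z) absolutely_integrable_on {t\<^sub>1..t}" by (simp add: algebra_simps)
  then show "integral\<^sup>L (lebesgue_on {t\<^sub>1..t}) (\<lambda>s. inner (- f s) z + F s x z) = integral {t\<^sub>1..t} (\<lambda>s. - (f s \<bullet> z) + F s x z)"
    by (simp add: lebesgue_integral_eq_integral integrable_lebesgue_on_iff)
qed

text \<open>With momentum 0 the Hamiltonian depends on \<open>(t, x)\<close> alone and extends
  continuously to [0,T] times the compact closure of the embedded trajectories.\<close>

lemma F_bounded: "\<exists>C\<ge>0. \<forall>x\<in>Tr. \<forall>t\<in>{0..T}. \<bar>F t x 0\<bar> \<le> C"
proof -
  let ?K = "closure (path_fun ` Traj L t\<^sub>0 x\<^sub>0)"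
  let ?G = "\<lambda>(t, \<phi>). F t (restrict (apply_bcontfun \<phi>) {0..T}) 0"
  have "continuous_on ({0..T} \<times> UNIV) ?G"
    unfolding continuous_on_iff
  proof (intro ballI allI impI)
    fix a :: "real \<times> (real \<Rightarrow>\<^sub>C 'h)" and e :: real assume a: "a \<in> {0..T} \<times> UNIV" and "e > 0"
    obtain t \<phi> where a_eq: "a = (t, \<phi>)" by (cases a)
    have t: "t \<in> {0..T}" using a a_eq by simp
    let ?x = "restrict (apply_bcontfun \<phi>) {0..T}"
    obtain \<delta> where \<delta>: "\<delta> > 0" "\<forall>s\<in>{0..T}. \<forall>y\<in>paths T. \<forall>z'.
        d_inf T (t, ?x) (s, y) < \<delta> \<and> norm (0 - z') < \<delta> \<longrightarrow> \<bar>F t ?x 0 - F s y z'\<bar> < e"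
      using F_cont[OF t restrict_in_paths[of \<phi>] \<open>e > 0\<close>, of 0] by auto
    obtain d where d: "d > 0" "\<forall>s\<in>{0..T}. \<forall>y. \<bar>t - s\<bar> < d \<and> (\<forall>r\<in>{0..T}. norm (?x r - y r) < d) \<longrightarrow> d_inf T (t, ?x) (s, y) < \<delta>"
      using d_inf_small[OF pathsD[OF restrict_in_paths[of \<phi>]] t \<delta>(1)] by auto
    have "dist (?G (s, \<psi>)) (?G (t, \<phi>)) < e" if s: "s \<in> {0..T}" and dist: "dist (s, \<psi>) (t, \<phi>) < d" for s \<psi>
    proof -
      let ?y = "restrict (apply_bcontfun \<psi>) {0..T}"
      have "\<bar>t - s\<bar> < d" using dist dist_fst_le[of "(s, \<psi>)" "(t, \<phi>)"] by (simp add: dist_real_def abs_minus_commute)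
      moreover have "norm (?x r - ?y r) < d" if "r \<in> {0..T}" for r
      proof -
        have "dist (apply_bcontfun \<phi> r) (apply_bcontfun \<psi> r) \<le> dist (s, \<psi>) (t, \<phi>)"
          using dist_bounded[of \<phi> r \<psi>] dist_snd_le[of "(s, \<psi>)" "(t, \<phi>)"] by (simp add: dist_commute)
        then have "dist (apply_bcontfun \<phi> r) (apply_bcontfun \<psi> r) < d" using dist by (rule le_less_trans)
        then show ?thesis using that by (simp add: dist_norm)
      qed
      ultimately have "d_inf T (t, ?x) (s, ?y) < \<delta>" using d(2) s by blast
      moreover have "norm (0 - (0 :: 'h)) < \<delta>" using \<delta>(1) by simp
      ultimately have "\<bar>F t ?x 0 - F s ?y 0\<bar> < e" using \<delta>(2) s restrict_in_paths[of \<psi>] by blast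
      then show ?thesis by (simp add: dist_real_def abs_minus_commute)
    qed
    then show "\<exists>d>0. \<forall>b\<in>{0..T} \<times> UNIV. dist b a < d \<longrightarrow> dist (?G b) (?G a) < e"
      using d(1) unfolding a_eq by (intro exI[of _ d]) blast
  qed
  then have "continuous_on ({0..T} \<times> ?K) ?G" by (rule continuous_on_subset) auto
  moreover have "compact ({0..T} \<times> ?K)"
    by (intro compact_Times compact_Icc compact_trajectories t\<^sub>0 L_nonneg x\<^sub>0_paths)
  ultimately have "bounded (?G ` ({0..T} \<times> ?K))" by (intro compact_imp_bounded compact_continuous_image)
  then obtain C where C: "\<forall>a\<in>{0..T} \<times> ?K. \<bar>?G a\<bar> \<le> C" by (auto simp: bounded_iff)
  have "\<bar>F t x 0\<bar> \<le> C" if "x \<in> Tr" "t \<in> {0..T}" for x t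
  proof -
    have "path_fun x \<in> path_fun ` Traj L t\<^sub>0 x\<^sub>0" using that by (simp add: Tr_def)
    then have "path_fun x \<in> ?K" using closure_subset by (rule rev_subsetD)
    then have "\<bar>?G (t, path_fun x)\<bar> \<le> C" using C that(2) by blast
    then show ?thesis by (simp add: restrict_path_fun[OF Tr_paths[OF that(1)]])
  qed
  then show ?thesis by (intro exI[of _ "max 0 C"]) fastforce
qed

text \<open>The subsolution property is used with momentum 0 up to time \<open>T\<close>, where the
  terminal inequality takes over; the cost reduces to the bounded \<open>F s x 0\<close>.\<close>

lemma u_upper:
  assumes x\<^sub>1: "x\<^sub>1 \<in> Tr" and t\<^sub>1: "t\<^sub>0 \<le> t\<^sub>1" "t\<^sub>1 \<le> T" and C: "\<forall>x\<in>Tr. \<forall>t\<in>{0..T}. \<bar>F t x 0\<bar> \<le> C"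
  shows "\<exists>x\<in>Tr. (\<forall>t\<in>{0..t\<^sub>1}. x t = x\<^sub>1 t) \<and> u t\<^sub>1 x\<^sub>1 \<le> C * (T - t\<^sub>1) + h x"
proof (cases "t\<^sub>1 = T")
  case True
  then show ?thesis using u_T[of x\<^sub>1] x\<^sub>1 by (auto simp: Tr_def)
next
  case False
  then obtain x f where x: "x \<in> S" "trajectory_rhs \<iota> A p q T L t\<^sub>1 x\<^sub>1 x f"
    and le: "\<forall>t\<in>{t\<^sub>1..T}. u t\<^sub>1 x\<^sub>1 \<le> integral\<^sup>L (lebesgue_on {t\<^sub>1..t}) (\<lambda>s. inner (- f s) 0 + F s x 0) + u t x"
    using u_sub[of t\<^sub>1 x\<^sub>1 0] x\<^sub>1 t\<^sub>1 t\<^sub>0 by (auto simp: Tr_def)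
  have xTr: "x \<in> Tr" using Tr_extend[OF x\<^sub>1 t\<^sub>1(1) _ x(2,1)] False t\<^sub>1 by simp
  have f: "f \<in> Lp_space 2 t\<^sub>1 T" using x(2) by (simp add: trajectory_rhs_def)
  have "integral {t\<^sub>1..T} (\<lambda>s. - (f s \<bullet> 0) + F s x 0) \<le> C * (T - t\<^sub>1)"
    using t\<^sub>0 t\<^sub>1 C xTr
    by (intro integral_const_AE_bound running_cost(1)[OF f Tr_paths[OF xTr]] AE_I2) (auto simp: space_restrict_space abs_le_iff)
  moreover have "u t\<^sub>1 x\<^sub>1 \<le> integral\<^sup>L (lebesgue_on {t\<^sub>1..T}) (\<lambda>s. inner (- f s) 0 + F s x 0) + u T x"
    using le t\<^sub>1 by (meson atLeastAtMost_iff order_refl)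
  moreover have "integral\<^sup>L (lebesgue_on {t\<^sub>1..T}) (\<lambda>s. inner (- f s) 0 + F s x 0) = integral {t\<^sub>1..T} (\<lambda>s. - (f s \<bullet> 0) + F s x 0)"
    by (rule running_cost(2)[OF f Tr_paths[OF xTr]]) (use t\<^sub>0 t\<^sub>1 in auto)
  ultimately have "u t\<^sub>1 x\<^sub>1 \<le> C * (T - t\<^sub>1) + h x"
    using u_T[OF x(1)] by linarith
  then show ?thesis using xTr x(2) by (auto simp: trajectory_rhs_def)
qed

lemma v_lower:
  assumes x\<^sub>1: "x\<^sub>1 \<in> Tr" and t\<^sub>1: "t\<^sub>0 \<le> t\<^sub>1" "t\<^sub>1 \<le> T" and C: "\<forall>x\<in>Tr. \<forall>t\<in>{0..T}. \<bar>F t x 0\<bar> \<le> C"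
  shows "\<exists>x\<in>Tr. (\<forall>t\<in>{0..t\<^sub>1}. x t = x\<^sub>1 t) \<and> v t\<^sub>1 x\<^sub>1 \<ge> - (C * (T - t\<^sub>1)) + h x"
proof (cases "t\<^sub>1 = T")
  case True
  then show ?thesis using v_T[of x\<^sub>1] x\<^sub>1 by (auto simp: Tr_def)
next
  case False
  then obtain x f where x: "x \<in> S" "trajectory_rhs \<iota> A p q T L t\<^sub>1 x\<^sub>1 x f"
    and le: "\<forall>t\<in>{t\<^sub>1..T}. v t\<^sub>1 x\<^sub>1 \<ge> integral\<^sup>L (lebesgue_on {t\<^sub>1..t}) (\<lambda>s. inner (- f s) 0 + F s x 0) + v t x"
    using v_sup[of t\<^sub>1 x\<^sub>1 0] x\<^sub>1 t\<^sub>1 t\<^sub>0 by (auto simp: Tr_def)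
  have xTr: "x \<in> Tr" using Tr_extend[OF x\<^sub>1 t\<^sub>1(1) _ x(2,1)] False t\<^sub>1 by simp
  have f: "f \<in> Lp_space 2 t\<^sub>1 T" using x(2) by (simp add: trajectory_rhs_def)
  have "integral {t\<^sub>1..T} (\<lambda>s. - (- (f s \<bullet> 0) + F s x 0)) \<le> C * (T - t\<^sub>1)"
  proof (rule integral_const_AE_bound)
    show "(\<lambda>s. - (- (f s \<bullet> 0) + F s x 0)) absolutely_integrable_on {t\<^sub>1..T}"
      using absolutely_integrable_continuous_mult[OF _ running_cost(1)[OF f Tr_paths[OF xTr], of T 0], of "\<lambda>_. - 1"]
        t\<^sub>0 t\<^sub>1 by simp
  qed (use t\<^sub>0 t\<^sub>1 C xTr in \<open>auto simp: space_restrict_space abs_le_iff intro!: AE_I2\<close>)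
  then have "- (C * (T - t\<^sub>1)) \<le> integral {t\<^sub>1..T} (\<lambda>s. - (f s \<bullet> 0) + F s x 0)"
    unfolding integral_neg by linarith
  moreover have "v t\<^sub>1 x\<^sub>1 \<ge> integral\<^sup>L (lebesgue_on {t\<^sub>1..T}) (\<lambda>s. inner (- f s) 0 + F s x 0) + v T x"
    using le t\<^sub>1 by (meson atLeastAtMost_iff order_refl)
  moreover have "integral\<^sup>L (lebesgue_on {t\<^sub>1..T}) (\<lambda>s. inner (- f s) 0 + F s x 0) = integral {t\<^sub>1..T} (\<lambda>s. - (f s \<bullet> 0) + F s x 0)"
    by (rule running_cost(2)[OF f Tr_paths[OF xTr]]) (use t\<^sub>0 t\<^sub>1 in auto)
  ultimately have "v t\<^sub>1 x\<^sub>1 \<ge> - (C * (T - t\<^sub>1)) + h x"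
    using v_T[OF x(1)] by linarith
  then show ?thesis using xTr x(2) by (auto simp: trajectory_rhs_def)
qed

text \<open>This makes the suprema of the doubling argument finite. Both functions are pushed to
  time \<open>T\<close>, where \<open>h\<close> is bounded on trajectories.\<close>

lemma u_v_bounded: "\<exists>B. \<forall>t\<in>{t\<^sub>0..T}. \<forall>x\<in>Tr. \<forall>y\<in>Tr. u t x - v t y \<le> B"
proof -
  obtain C where C: "C \<ge> 0" "\<forall>x\<in>Tr. \<forall>t\<in>{0..T}. \<bar>F t x 0\<bar> \<le> C" using F_bounded by blast
  obtain H where H: "\<forall>x\<in>Traj L t\<^sub>0 x\<^sub>0. \<bar>h x\<bar> \<le> H"
    using terminal_uniform(1)[OF t\<^sub>0 L_nonneg x\<^sub>0_paths h_cont] by blast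
  have "u t x - v t y \<le> 2 * (C * T + H)" if txy: "t \<in> {t\<^sub>0..T}" "x \<in> Tr" "y \<in> Tr" for t x y
  proof -
    obtain x' where x': "x' \<in> Tr" "u t x \<le> C * (T - t) + h x'" using u_upper[OF txy(2) _ _ C(2)] txy by auto
    obtain y' where y': "y' \<in> Tr" "v t y \<ge> - (C * (T - t)) + h y'" using v_lower[OF txy(3) _ _ C(2)] txy by auto
    have "C * (T - t) \<le> C * T" using C(1) txy t\<^sub>0 by (intro mult_left_mono) auto
    moreover have "\<bar>h x'\<bar> \<le> H" "\<bar>h y'\<bar> \<le> H" using H x' y' by (auto simp: Tr_def)
    ultimately show ?thesis using x' y' by auto
  qed
  then show ?thesis by blast
qed

text \<open>It keeps almost maximal pairs away from the final time. Both paths are continued to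
  \<open>T\<close> with momentum 0; on a short interval the cost is small and equicontinuity keeps
  the continuations close, hence also their values of \<open>h\<close>.\<close>

lemma near_terminal_time:
  assumes "e > 0"
  shows "\<exists>\<rho>>0. \<exists>\<tau><T. t\<^sub>0 \<le> \<tau> \<and> (\<forall>t\<in>{\<tau>..T}. \<forall>x\<in>Tr. \<forall>y\<in>Tr.
    (\<forall>r\<in>{0..t}. norm (x r - y r) \<le> \<rho>) \<longrightarrow> u t x - v t y \<le> e)"
proof -
  obtain C where C: "C \<ge> 0" "\<forall>x\<in>Tr. \<forall>t\<in>{0..T}. \<bar>F t x 0\<bar> \<le> C" using F_bounded by blast
  obtain \<delta> where \<delta>: "\<delta> > 0" "\<forall>x\<in>Traj L t\<^sub>0 x\<^sub>0. \<forall>y\<in>Traj L t\<^sub>0 x\<^sub>0.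
       (\<forall>r\<in>{0..T}. norm (x r - y r) < \<delta>) \<longrightarrow> \<bar>h x - h y\<bar> < e / 2"
    using terminal_uniform(2)[OF t\<^sub>0 L_nonneg x\<^sub>0_paths h_cont, of "e / 2"] \<open>e > 0\<close> by auto
  obtain d where d: "d > 0" "\<forall>x\<in>Traj L t\<^sub>0 x\<^sub>0. \<forall>s\<in>{0..T}. \<forall>t\<in>{0..T}. \<bar>s - t\<bar> < d \<longrightarrow> norm (x s - x t) < \<delta> / 4"
    using equicontinuous_trajectories[OF t\<^sub>0 L_nonneg x\<^sub>0_paths, of "\<delta> / 4"] \<delta>(1) by auto
  \<comment> \<open>Below \<open>d\<close>, so that each path moves by less than
    \<open>\<delta> / 4\<close>, and short enough for each of the two running costs to be at most
    \<open>e / 4\<close>.\<close>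
  define a where "a = min (d / 2) (e / (4 * (C + 1)))"
  have a: "a > 0" "a < d" "C * a \<le> e / 4"
  proof -
    show "a > 0" using d(1) \<open>e > 0\<close> C(1) by (simp add: a_def)
    show "a < d" using d(1) min.cobounded1[of "d / 2" "e / (4 * (C + 1))"] unfolding a_def by linarith
    have "C * a \<le> C * (e / (4 * (C + 1)))" using C(1) by (intro mult_left_mono) (auto simp: a_def)
    also have "\<dots> \<le> e / 4" using C(1) \<open>e > 0\<close> by (simp add: field_simps)
    finally show "C * a \<le> e / 4" .
  qed
  define \<tau> where "\<tau> = max t\<^sub>0 (T - a)"
  have \<tau>: "t\<^sub>0 \<le> \<tau>" "\<tau> < T" using a t\<^sub>0 by (auto simp: \<tau>_def)
  have "u t x - v t y \<le> e" if t: "t \<in> {\<tau>..T}" and xy: "x \<in> Tr" "y \<in> Tr" and close: "\<forall>r\<in>{0..t}. norm (x r - y r) \<le> \<delta> / 4" for t x y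
  proof -
    have t': "t\<^sub>0 \<le> t" "t \<le> T" "T - t \<le> a" using t \<tau> by (auto simp: \<tau>_def)
    obtain x' where x': "x' \<in> Tr" "\<forall>r\<in>{0..t}. x' r = x r" "u t x \<le> C * (T - t) + h x'"
      using u_upper[OF xy(1) t'(1,2) C(2)] by auto
    obtain y' where y': "y' \<in> Tr" "\<forall>r\<in>{0..t}. y' r = y r" "v t y \<ge> - (C * (T - t)) + h y'"
      using v_lower[OF xy(2) t'(1,2) C(2)] by auto
    have tr: "x' \<in> Traj L t\<^sub>0 x\<^sub>0" "y' \<in> Traj L t\<^sub>0 x\<^sub>0" using x' y' by (auto simp: Tr_def)
    have "norm (x' r - y' r) < \<delta>" if r: "r \<in> {0..T}" for r
    proof (cases "r \<le> t")
      case True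
      then have "norm (x' r - y' r) \<le> \<delta> / 4" using close x'(2) y'(2) r by auto
      then show ?thesis using \<delta>(1) by simp
    next
      case False
      then have rt: "\<bar>r - t\<bar> < d" "t \<in> {0..T}" using t' r a(2) t\<^sub>0 by auto
      have "norm (x' r - x' t) < \<delta> / 4" "norm (y' r - y' t) < \<delta> / 4" using d(2) tr r rt by blast+
      moreover have "norm (x' t - y' t) \<le> \<delta> / 4" using close x'(2) y'(2) rt by auto
      moreover have "norm (x' r - y' r) \<le> norm (x' r - x' t) + norm (x' t - y' t) + norm (y' r - y' t)"
        by (rule norm_diff_le_three)
      ultimately show ?thesis using \<delta>(1) by linarith
    qed
    then have "\<bar>h x' - h y'\<bar> < e / 2" using \<delta>(2) tr by blast
    moreover have "C * (T - t) \<le> e / 4" using a(3) mult_left_mono[OF t'(3) C(1)] by linarith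
    ultimately show ?thesis using x'(3) y'(3) by linarith
  qed
  then show ?thesis using \<delta>(1) \<tau> by (intro exI[of _ "\<delta> / 4"] conjI exI[of _ \<tau>]) auto
qed

lemma Tr_bound: "\<exists>R\<ge>1. \<forall>x\<in>Tr. 1 + sup_norm T x \<le> R"
  using a_priori_bound[OF L_nonneg t\<^sub>0 x\<^sub>0_paths] by (metis IntD1 TrajE Tr_def)

text \<open>One Euler step: the momentum \<open>z\<close> is frozen at time \<open>t\<^sub>1\<close> at the value
  \<open>(x(t\<^sub>1) - y(t\<^sub>1)) / \<epsilon>\<close>. The energy inequality makes the terms \<open>(f, z)\<close> cancel against the
  growth of \<open>\<bar>x - y\<bar>\<^sup>2 / (2 \<epsilon>)\<close>, up to the oscillation \<open>\<mu>\<close> of the paths on the step.\<close>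

lemma euler_step:
  assumes xy\<^sub>1: "x\<^sub>1 \<in> Tr" "y\<^sub>1 \<in> Tr" and t: "t\<^sub>0 \<le> t\<^sub>1" "t\<^sub>1 < t\<^sub>2" "t\<^sub>2 \<le> T" and "\<epsilon> > 0"
    and R: "\<forall>x\<in>Tr. 1 + sup_norm T x \<le> R"
    and osc: "\<And>x s. x \<in> Tr \<Longrightarrow> s \<in> {t\<^sub>1..t\<^sub>2} \<Longrightarrow> norm (x s - x t\<^sub>1) \<le> \<mu> / 2"
    and small: "(2 * L + 2 * L\<^sub>0) * R * (\<mu> / \<epsilon>) \<le> c"
    and mod: "\<And>x y s. x \<in> Tr \<Longrightarrow> y \<in> Tr \<Longrightarrow> s \<in> {t\<^sub>1..t\<^sub>2} \<Longrightarrow> \<forall>r\<in>{0..t\<^sub>1}. x r = x\<^sub>1 r \<Longrightarrow> \<forall>r\<in>{0..t\<^sub>1}. y r = y\<^sub>1 r \<Longrightarrow>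
       m ((1 / \<epsilon>) * (norm (x s - y s))\<^sup>2 + sup_norm s (\<lambda>r. x r - y r)) \<le> c"
  shows "\<exists>x\<in>Tr. \<exists>y\<in>Tr. (\<forall>r\<in>{0..t\<^sub>1}. x r = x\<^sub>1 r) \<and> (\<forall>r\<in>{0..t\<^sub>1}. y r = y\<^sub>1 r) \<and>
    u t\<^sub>1 x\<^sub>1 - v t\<^sub>1 y\<^sub>1 - (norm (x\<^sub>1 t\<^sub>1 - y\<^sub>1 t\<^sub>1))\<^sup>2 / (2 * \<epsilon>)
      \<le> u t\<^sub>2 x - v t\<^sub>2 y - (norm (x t\<^sub>2 - y t\<^sub>2))\<^sup>2 / (2 * \<epsilon>) + 2 * c * (t\<^sub>2 - t\<^sub>1)"
proof -
  define z where "z = (1 / \<epsilon>) *\<^sub>R (x\<^sub>1 t\<^sub>1 - y\<^sub>1 t\<^sub>1)"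
  have t\<^sub>1: "0 \<le> t\<^sub>1" "t\<^sub>1 < T" using t t\<^sub>0 by auto
  obtain x f where x: "x \<in> S" "trajectory_rhs \<iota> A p q T L t\<^sub>1 x\<^sub>1 x f"
    and ux: "\<forall>t\<in>{t\<^sub>1..T}. u t\<^sub>1 x\<^sub>1 \<le> integral\<^sup>L (lebesgue_on {t\<^sub>1..t}) (\<lambda>s. inner (- f s) z + F s x z) + u t x"
    using u_sub[OF t\<^sub>1, of x\<^sub>1 z] xy\<^sub>1 by (auto simp: Tr_def)
  obtain y g where y: "y \<in> S" "trajectory_rhs \<iota> A p q T L t\<^sub>1 y\<^sub>1 y g"
    and vy: "\<forall>t\<in>{t\<^sub>1..T}. v t\<^sub>1 y\<^sub>1 \<ge> integral\<^sup>L (lebesgue_on {t\<^sub>1..t}) (\<lambda>s. inner (- g s) z + F s y z) + v t y"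
    using v_sup[OF t\<^sub>1, of y\<^sub>1 z] xy\<^sub>1 by (auto simp: Tr_def)
  have xTr: "x \<in> Tr" by (rule Tr_extend[OF xy\<^sub>1(1) t(1) t\<^sub>1(2) x(2,1)])
  have yTr: "y \<in> Tr" by (rule Tr_extend[OF xy\<^sub>1(2) t(1) t\<^sub>1(2) y(2,1)])
  have fg: "f \<in> Lp_space 2 t\<^sub>1 T" "g \<in> Lp_space 2 t\<^sub>1 T"
    and eq: "\<forall>r\<in>{0..t\<^sub>1}. x r = x\<^sub>1 r" "\<forall>r\<in>{0..t\<^sub>1}. y r = y\<^sub>1 r"
    using x(2) y(2) by (auto simp: trajectory_rhs_def)
  have z: "z = (1 / \<epsilon>) *\<^sub>R (x t\<^sub>1 - y t\<^sub>1)" using eq t\<^sub>1 by (simp add: z_def)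
  let ?w = "\<lambda>s. x s - y s"
  have cost: "(\<lambda>s. - (f s \<bullet> z) + F s x z) absolutely_integrable_on {t\<^sub>1..t\<^sub>2}"
     "(\<lambda>s. - (g s \<bullet> z) + F s y z) absolutely_integrable_on {t\<^sub>1..t\<^sub>2}"
    by (rule running_cost(1)[OF fg(1) Tr_paths[OF xTr]] running_cost(1)[OF fg(2) Tr_paths[OF yTr]]; use t t\<^sub>1 in simp)+
  have ener: "(\<lambda>s. (1 / \<epsilon>) * ((f s - g s) \<bullet> ?w s)) absolutely_integrable_on {t\<^sub>1..t\<^sub>2}"
    by (intro absolutely_integrable_continuous_mult continuous_intros
        absolutely_integrable_on_subinterval[OF energy_difference(1)[OF x(2) y(2) t\<^sub>1]]) (use t in auto)
  have u_le: "u t\<^sub>1 x\<^sub>1 \<le> integral {t\<^sub>1..t\<^sub>2} (\<lambda>s. - (f s \<bullet> z) + F s x z) + u t\<^sub>2 x"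
    using bspec[OF ux, of t\<^sub>2] running_cost(2)[OF fg(1) Tr_paths[OF xTr], of t\<^sub>2 z] t t\<^sub>1 by simp
  have v_ge: "v t\<^sub>1 y\<^sub>1 \<ge> integral {t\<^sub>1..t\<^sub>2} (\<lambda>s. - (g s \<bullet> z) + F s y z) + v t\<^sub>2 y"
    using bspec[OF vy, of t\<^sub>2] running_cost(2)[OF fg(2) Tr_paths[OF yTr], of t\<^sub>2 z] t t\<^sub>1 by simp
  have "(norm (?w t\<^sub>2))\<^sup>2 - (norm (?w t\<^sub>1))\<^sup>2 \<le> 2 * integral {t\<^sub>1..t\<^sub>2} (\<lambda>s. (f s - g s) \<bullet> ?w s)"
    using t by (intro energy_difference(2)[OF x(2) y(2) t\<^sub>1]) auto
  then have "((norm (?w t\<^sub>2))\<^sup>2 - (norm (?w t\<^sub>1))\<^sup>2) / (2 * \<epsilon>) \<le> (2 * integral {t\<^sub>1..t\<^sub>2} (\<lambda>s. (f s - g s) \<bullet> ?w s)) / (2 * \<epsilon>)"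
    using \<open>\<epsilon> > 0\<close> by (intro divide_right_mono) auto
  then have w_le: "(norm (?w t\<^sub>2))\<^sup>2 / (2 * \<epsilon>) - (norm (?w t\<^sub>1))\<^sup>2 / (2 * \<epsilon>) \<le> integral {t\<^sub>1..t\<^sub>2} (\<lambda>s. (1 / \<epsilon>) * ((f s - g s) \<bullet> ?w s))"
    by (simp add: diff_divide_distrib)
  \<comment> \<open>The energy term and the difference of the running costs are put under one
    integral, so that they can cancel pointwise.\<close>
  let ?I = "\<lambda>s. (1 / \<epsilon>) * ((f s - g s) \<bullet> ?w s) + ((- (f s \<bullet> z) + F s x z) - (- (g s \<bullet> z) + F s y z))"
  have int: "?I absolutely_integrable_on {t\<^sub>1..t\<^sub>2}"
    by (intro set_integral_add(1) set_integral_diff(1) cost ener)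
  have "integral {t\<^sub>1..t\<^sub>2} ?I \<le> 2 * c * (t\<^sub>2 - t\<^sub>1)"
  proof (rule integral_const_AE_bound[OF int])
    have Rx: "1 + sup_norm T x \<le> R" "1 + sup_norm T y \<le> R" using R xTr yTr by auto
    have "AE s in lebesgue_on {t\<^sub>1<..<T}. norm (f s) \<le> L * R \<and> norm (g s) \<le> L * R"
      using rhs_bound[OF x(2) t\<^sub>1(1) L_nonneg Rx(1)] rhs_bound[OF y(2) t\<^sub>1(1) L_nonneg Rx(2)]
      by eventually_elim simp
    then have "AE s in lebesgue_on {t\<^sub>1<..<t\<^sub>2}. norm (f s) \<le> L * R \<and> norm (g s) \<le> L * R"
      by (rule AE_lebesgue_on_subset) (use t in auto)
    moreover have "AE s in lebesgue_on {t\<^sub>1<..<t\<^sub>2}. s \<in> {t\<^sub>1..t\<^sub>2}"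
      by (intro AE_I2) (auto simp: space_restrict_space)
    ultimately show "AE s in lebesgue_on {t\<^sub>1<..<t\<^sub>2}. ?I s \<le> 2 * c"
    proof eventually_elim
      case (elim s)
      let ?z = "(1 / \<epsilon>) *\<^sub>R (x s - y s)"
      have s: "s \<in> {0..T}" "s \<in> {t\<^sub>0..T}" using elim(2) t t\<^sub>1 by auto
      have "norm (?w s - ?w t\<^sub>1) \<le> norm (x s - x t\<^sub>1) + norm (y s - y t\<^sub>1)"
        using norm_triangle_ineq4[of "x s - x t\<^sub>1" "y s - y t\<^sub>1"] by (simp add: algebra_simps)
      also have "\<dots> \<le> \<mu>" using osc[OF xTr elim(2)] osc[OF yTr elim(2)] by simp
      finally have "norm (?w s - ?w t\<^sub>1) / \<epsilon> \<le> \<mu> / \<epsilon>" using \<open>\<epsilon> > 0\<close> by (intro divide_right_mono) auto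
      moreover have "?z - z = (1 / \<epsilon>) *\<^sub>R (?w s - ?w t\<^sub>1)" by (simp add: z scaleR_diff_right)
      ultimately have zz: "norm (?z - z) \<le> \<mu> / \<epsilon>" using \<open>\<epsilon> > 0\<close> by simp
      have "R \<ge> 0" using Rx sup_norm_nonneg[OF pathsD[OF Tr_paths[OF xTr]], of T] T_pos by simp
      have "(1 / \<epsilon>) * ((f s - g s) \<bullet> ?w s) - (f s \<bullet> z - g s \<bullet> z) = (f s - g s) \<bullet> (?z - z)"
        by (simp add: inner_diff_left inner_diff_right algebra_simps)
      also have "\<dots> \<le> norm (f s - g s) * norm (?z - z)" by (rule norm_cauchy_schwarz)
      also have "\<dots> \<le> (2 * L * R) * (\<mu> / \<epsilon>)"
      proof (rule mult_mono[OF _ zz])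
        show "norm (f s - g s) \<le> 2 * L * R" using norm_triangle_ineq4[of "f s" "g s"] elim(1) by linarith
        show "0 \<le> 2 * L * R" using L_nonneg \<open>R \<ge> 0\<close> by simp
      qed simp
      finally have 1: "(1 / \<epsilon>) * ((f s - g s) \<bullet> ?w s) - (f s \<bullet> z - g s \<bullet> z) \<le> (2 * L * R) * (\<mu> / \<epsilon>)" .
      have lip: "\<bar>F s a z - F s a ?z\<bar> \<le> L\<^sub>0 * R * (\<mu> / \<epsilon>)" if a: "a \<in> Tr" for a
      proof -
        have "\<bar>F s a z - F s a ?z\<bar> \<le> L\<^sub>0 * (1 + sup_norm s a) * norm (z - ?z)"
          by (rule F_lip[OF s(1) Tr_paths[OF a]])
        also have "\<dots> \<le> L\<^sub>0 * R * (\<mu> / \<epsilon>)"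
        proof (intro mult_mono)
          show "1 + sup_norm s a \<le> R"
            using sup_norm_mono[OF pathsD[OF Tr_paths[OF a]], of s T] s R a by auto
          show "norm (z - ?z) \<le> \<mu> / \<epsilon>" using zz by (simp add: norm_minus_commute)
          show "0 \<le> 1 + sup_norm s a" using sup_norm_nonneg[OF pathsD[OF Tr_paths[OF a]], of s] s by simp
        qed (use L\<^sub>0_nonneg \<open>R \<ge> 0\<close> in auto)
        finally show ?thesis .
      qed
      \<comment> \<open>The modulus condition speaks of the current momentum, hence the two
        Lipschitz corrections from \<open>z\<close> to \<open>?z\<close>.\<close>
      have "F s x ?z - F s y ?z \<le> m ((1 / \<epsilon>) * (norm (x s - y s))\<^sup>2 + sup_norm s (\<lambda>r. x r - y r))"
        using xTr yTr by (intro F_mod[OF \<open>\<epsilon> > 0\<close> s(2)]) (auto simp: Tr_def)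
      also have "\<dots> \<le> c" by (rule mod[OF xTr yTr elim(2) eq])
      finally have "F s x z - F s y z \<le> c + 2 * (L\<^sub>0 * R * (\<mu> / \<epsilon>))"
        using lip[OF xTr] lip[OF yTr] by linarith
      moreover have "(2 * L + 2 * L\<^sub>0) * R * (\<mu> / \<epsilon>) = (2 * L * R) * (\<mu> / \<epsilon>) + 2 * (L\<^sub>0 * R * (\<mu> / \<epsilon>))"
        by (simp add: algebra_simps)
      ultimately show ?case using 1 small by linarith
    qed
  qed (use t in auto)
  moreover have "integral {t\<^sub>1..t\<^sub>2} ?I = integral {t\<^sub>1..t\<^sub>2} (\<lambda>s. (1 / \<epsilon>) * ((f s - g s) \<bullet> ?w s))
      + (integral {t\<^sub>1..t\<^sub>2} (\<lambda>s. - (f s \<bullet> z) + F s x z) - integral {t\<^sub>1..t\<^sub>2} (\<lambda>s. - (g s \<bullet> z) + F s y z))"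
  proof -
    have "integral {t\<^sub>1..t\<^sub>2} ?I = integral {t\<^sub>1..t\<^sub>2} (\<lambda>s. (1 / \<epsilon>) * ((f s - g s) \<bullet> ?w s))
      + integral {t\<^sub>1..t\<^sub>2} (\<lambda>s. (- (f s \<bullet> z) + F s x z) - (- (g s \<bullet> z) + F s y z))"
      using ener set_integral_diff(1)[OF cost] by (intro integral_add) (simp_all only: absolutely_integrable_on_def)
    moreover have "integral {t\<^sub>1..t\<^sub>2} (\<lambda>s. (- (f s \<bullet> z) + F s x z) - (- (g s \<bullet> z) + F s y z))
      = integral {t\<^sub>1..t\<^sub>2} (\<lambda>s. - (f s \<bullet> z) + F s x z) - integral {t\<^sub>1..t\<^sub>2} (\<lambda>s. - (g s \<bullet> z) + F s y z)"
      using cost by (intro integral_diff) (simp_all only: absolutely_integrable_on_def)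
    ultimately show ?thesis by simp
  qed
  moreover have "?w t\<^sub>1 = x\<^sub>1 t\<^sub>1 - y\<^sub>1 t\<^sub>1" using eq t\<^sub>1 by simp
  ultimately have "u t\<^sub>1 x\<^sub>1 - v t\<^sub>1 y\<^sub>1 - (norm (x\<^sub>1 t\<^sub>1 - y\<^sub>1 t\<^sub>1))\<^sup>2 / (2 * \<epsilon>)
      \<le> u t\<^sub>2 x - v t\<^sub>2 y - (norm (x t\<^sub>2 - y t\<^sub>2))\<^sup>2 / (2 * \<epsilon>) + 2 * c * (t\<^sub>2 - t\<^sub>1)"
    using u_le v_ge w_le by simp
  with xTr yTr eq show ?thesis by blast
qed

section \<open>The doubling argument\<close>

lemma modulus_small:
  assumes "c > 0"
  shows "\<exists>\<eta>>0. \<forall>r. 0 \<le> r \<and> r \<le> \<eta> \<longrightarrow> m r \<le> c"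
proof -
  have "\<forall>\<^sub>F r in at_right 0. m r < c"
    using m \<open>c > 0\<close> unfolding modulus_of_continuity_def by (auto dest: order_tendstoD(2))
  then obtain b where b: "b > 0" "\<And>r. 0 < r \<Longrightarrow> r < b \<Longrightarrow> m r < c"
    by (auto simp: eventually_at_right_field)
  have "m r \<le> c" if "0 \<le> r" "r \<le> b / 2" for r
    using b that m \<open>c > 0\<close> unfolding modulus_of_continuity_def by (cases "r = 0") (auto intro!: less_imp_le b(2))
  then show ?thesis using b(1) by (intro exI[of _ "b / 2"]) auto
qed

lemma comparison: "u t\<^sub>0 x\<^sub>0 \<le> v t\<^sub>0 x\<^sub>0"
proof (rule ccontr)
  assume neg: "\<not> u t\<^sub>0 x\<^sub>0 \<le> v t\<^sub>0 x\<^sub>0"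
  define \<kappa> where "\<kappa> = u t\<^sub>0 x\<^sub>0 - v t\<^sub>0 x\<^sub>0"
  have "\<kappa> > 0" using neg by (simp add: \<kappa>_def)
  \<comment> \<open>The reward for time is then at most \<open>\<kappa> / 2\<close> and cannot by
    itself account for \<kappa>.\<close>
  define \<theta> where "\<theta> = \<kappa> / (2 * T)"
  have \<theta>: "\<theta> > 0" "\<theta> * T = \<kappa> / 2" using \<open>\<kappa> > 0\<close> T_pos by (auto simp: \<theta>_def)
  define val where "val t x y = u t x - v t y + \<theta> * (t - t\<^sub>0)" for t x y
  define V where "V \<rho> = {val t x y |t x y. t \<in> {t\<^sub>0..T} \<and> x \<in> Tr \<and> y \<in> Tr \<and> (\<forall>r\<in>{0..t}. norm (x r - y r) \<le> \<rho>)}" for \<rho>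
  obtain B where B: "\<forall>t\<in>{t\<^sub>0..T}. \<forall>x\<in>Tr. \<forall>y\<in>Tr. u t x - v t y \<le> B" using u_v_bounded by blast
  have V_bdd: "bdd_above (V \<rho>)" for \<rho>
  proof (rule bdd_aboveI)
    fix a assume "a \<in> V \<rho>"
    then obtain t x y where txy: "a = val t x y" "t \<in> {t\<^sub>0..T}" "x \<in> Tr" "y \<in> Tr" by (auto simp: V_def)
    have "\<theta> * (t - t\<^sub>0) \<le> \<theta> * T" using txy t\<^sub>0 \<theta> by (intro mult_left_mono) auto
    then show "a \<le> B + \<theta> * T" using B txy by (auto simp: val_def intro: add_mono)
  qed
  \<comment> \<open>\<open>x\<^sub>0\<close> need not be a trajectory after
    \<open>t\<^sub>0\<close>; the semisolution properties at \<open>t = t\<^sub>0\<close> pass from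
    it to members of \<open>Tr\<close> without loss.\<close>
  have V_start: "\<exists>a\<in>V \<rho>. a \<ge> \<kappa>" if "\<rho> > 0" for \<rho>
  proof -
    obtain x f where x: "x \<in> S" "trajectory_rhs \<iota> A p q T L t\<^sub>0 x\<^sub>0 x f"
      and ux: "\<forall>t\<in>{t\<^sub>0..T}. u t\<^sub>0 x\<^sub>0 \<le> integral\<^sup>L (lebesgue_on {t\<^sub>0..t}) (\<lambda>s. inner (- f s) 0 + F s x 0) + u t x"
      using u_sub[OF t\<^sub>0 x\<^sub>0, of 0] by auto
    obtain y g where y: "y \<in> S" "trajectory_rhs \<iota> A p q T L t\<^sub>0 x\<^sub>0 y g"
      and vy: "\<forall>t\<in>{t\<^sub>0..T}. v t\<^sub>0 x\<^sub>0 \<ge> integral\<^sup>L (lebesgue_on {t\<^sub>0..t}) (\<lambda>s. inner (- g s) 0 + F s y 0) + v t y"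
      using v_sup[OF t\<^sub>0 x\<^sub>0, of 0] by auto
    have fg: "f \<in> Lp_space 2 t\<^sub>0 T" "g \<in> Lp_space 2 t\<^sub>0 T" "x \<in> paths T" "y \<in> paths T"
      and eq: "\<forall>r\<in>{0..t\<^sub>0}. x r = x\<^sub>0 r" "\<forall>r\<in>{0..t\<^sub>0}. y r = x\<^sub>0 r"
      using x(2) y(2) by (auto simp: trajectory_rhs_def)
    have "u t\<^sub>0 x\<^sub>0 \<le> u t\<^sub>0 x"
      using bspec[OF ux, of t\<^sub>0] running_cost(2)[OF fg(1,3), of t\<^sub>0 0] t\<^sub>0 by simp
    moreover have "v t\<^sub>0 x\<^sub>0 \<ge> v t\<^sub>0 y"
      using bspec[OF vy, of t\<^sub>0] running_cost(2)[OF fg(2,4), of t\<^sub>0 0] t\<^sub>0 by simp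
    ultimately have "\<kappa> \<le> val t\<^sub>0 x y" by (simp add: val_def \<kappa>_def)
    moreover have "x \<in> Tr" "y \<in> Tr" using x y by (auto simp: Tr_def trajectories_def)
    then have "val t\<^sub>0 x y \<in> V \<rho>" using t\<^sub>0 eq \<open>\<rho> > 0\<close> unfolding V_def by fastforce
    ultimately show ?thesis by blast
  qed
  \<comment> \<open>\<open>V \<rho>\<close> shrinks with \<rho>, so this infimum is the limit of the
    suprema as \<rho> tends to 0.\<close>
  define \<kappa>' where "\<kappa>' = (INF \<rho>\<in>{0<..}. Sup (V \<rho>))"
  have Sup_ge: "\<kappa> \<le> Sup (V \<rho>)" if "\<rho> > 0" for \<rho>
    using V_start[OF that] V_bdd[of \<rho>] by (meson cSup_upper order_trans)
  then have bdd: "bdd_below ((\<lambda>\<rho>. Sup (V \<rho>)) ` {0<..})" by (intro bdd_belowI2[of _ \<kappa>]) auto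
  have \<kappa>'_ge: "\<kappa> \<le> \<kappa>'" unfolding \<kappa>'_def using Sup_ge by (intro cINF_greatest) auto
  have \<kappa>'_le: "\<kappa>' \<le> Sup (V \<rho>)" if "\<rho> > 0" for \<rho> unfolding \<kappa>'_def using bdd that by (intro cINF_lower) auto

  \<comment> \<open>The argument of the modulus has two parts, each of which will be at most
    \<eta>.\<close>
  obtain \<eta> where \<eta>: "\<eta> > 0" "\<And>r. 0 \<le> r \<Longrightarrow> r \<le> 2 * \<eta> \<Longrightarrow> m r \<le> \<theta> / 4"
  proof -
    obtain \<eta>' where "\<eta>' > 0" "\<forall>r. 0 \<le> r \<and> r \<le> \<eta>' \<longrightarrow> m r \<le> \<theta> / 4"
      using modulus_small[of "\<theta> / 4"] \<theta> by auto
    then show ?thesis by (intro that[of "\<eta>' / 2"]) auto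
  qed
  have "\<kappa> / 4 > 0" using \<open>\<kappa> > 0\<close> by simp
  from near_terminal_time[OF this] obtain \<rho>\<^sub>0 \<tau> where \<rho>\<^sub>0: "\<rho>\<^sub>0 > 0" and \<tau>: "\<tau> < T" "t\<^sub>0 \<le> \<tau>"
    and near: "\<And>t x y. t \<in> {\<tau>..T} \<Longrightarrow> x \<in> Tr \<Longrightarrow> y \<in> Tr \<Longrightarrow> (\<forall>r\<in>{0..t}. norm (x r - y r) \<le> \<rho>\<^sub>0) \<Longrightarrow> u t x - v t y \<le> \<kappa> / 4"
    by metis
  \<comment> \<open>The three bounds serve to force \<open>t\<^sub>1 < \<tau>\<close>, to keep
    \<open>5 * \<gamma> * \<epsilon>\<close> at most half of \<open>\<rho>\<^sub>1\<^sup>2\<close>,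
    and to contradict \<open>\<theta> * (T - t\<^sub>1) \<le> 5 * \<gamma>\<close> at the
    end.\<close>
  define \<gamma> where "\<gamma> = min (\<kappa> / 8) (min (\<eta> / 10) (\<theta> * (T - \<tau>) / 10))"
  have \<gamma>: "\<gamma> > 0" "\<gamma> \<le> \<kappa> / 8" "\<gamma> \<le> \<eta> / 10" "\<gamma> \<le> \<theta> * (T - \<tau>) / 10"
    using \<open>\<kappa> > 0\<close> \<eta>(1) \<theta>(1) \<tau>(1) by (auto simp: \<gamma>_def)
  have "\<exists>\<rho>\<in>{0<..}. Sup (V \<rho>) < \<kappa>' + \<gamma>"
    using \<gamma>(1) bdd unfolding \<kappa>'_def by (subst cINF_less_iff[symmetric]) auto
  then obtain \<rho>' where \<rho>': "\<rho>' > 0" "Sup (V \<rho>') < \<kappa>' + \<gamma>" by auto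
  \<comment> \<open>Within this distance almost maximality, the terminal estimate and the modulus
    are all available.\<close>
  define \<rho>\<^sub>1 where "\<rho>\<^sub>1 = min \<rho>' (min \<rho>\<^sub>0 \<eta>)"
  have \<rho>\<^sub>1: "\<rho>\<^sub>1 > 0" "\<rho>\<^sub>1 \<le> \<rho>'" "\<rho>\<^sub>1 \<le> \<rho>\<^sub>0" "\<rho>\<^sub>1 \<le> \<eta>" using \<rho>' \<rho>\<^sub>0 \<eta> by (auto simp: \<rho>\<^sub>1_def)
  have val_le: "val t x y \<le> \<kappa>' + \<gamma>" if "t \<in> {t\<^sub>0..T}" "x \<in> Tr" "y \<in> Tr" "\<forall>r\<in>{0..t}. norm (x r - y r) \<le> \<rho>\<^sub>1" for t x y
  proof -
    have "\<forall>r\<in>{0..t}. norm (x r - y r) \<le> \<rho>'" using that(4) \<rho>\<^sub>1(2) by fastforce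
    then have "val t x y \<in> V \<rho>'" using that unfolding V_def by blast
    then have "val t x y \<le> Sup (V \<rho>')" by (intro cSup_upper V_bdd)
    then show ?thesis using \<rho>'(2) by linarith
  qed
  \<comment> \<open>A pair at distance \<open>\<rho>\<^sub>1\<close> then contributes
    \<open>\<rho>\<^sub>1\<^sup>2 / \<epsilon> = \<eta>\<close> to the argument of the
    modulus.\<close>
  define \<epsilon> where "\<epsilon> = \<rho>\<^sub>1\<^sup>2 / \<eta>"
  have \<epsilon>: "\<epsilon> > 0" "\<epsilon> * \<eta> = \<rho>\<^sub>1\<^sup>2" using \<rho>\<^sub>1 \<eta> by (auto simp: \<epsilon>_def)
  \<comment> \<open>The starting pair is taken so close that its penalty is at most
    \<open>\<gamma> / 2\<close>.\<close>
  define \<rho>\<^sub>2 where "\<rho>\<^sub>2 = min \<rho>\<^sub>1 (sqrt (\<gamma> * \<epsilon>))"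
  have \<rho>\<^sub>2: "\<rho>\<^sub>2 > 0" "\<rho>\<^sub>2 \<le> \<rho>\<^sub>1" "\<rho>\<^sub>2 \<le> sqrt (\<gamma> * \<epsilon>)" using \<rho>\<^sub>1 \<gamma> \<epsilon> by (auto simp: \<rho>\<^sub>2_def)
  have \<rho>\<^sub>2_sq: "\<rho>\<^sub>2\<^sup>2 \<le> \<gamma> * \<epsilon>"
  proof -
    have "\<rho>\<^sub>2\<^sup>2 \<le> (sqrt (\<gamma> * \<epsilon>))\<^sup>2" using \<rho>\<^sub>2 by (intro power_mono) auto
    then show ?thesis using \<gamma> \<epsilon> by simp
  qed
  have "\<kappa>' - \<gamma> < Sup (V \<rho>\<^sub>2)" using \<kappa>'_le[OF \<rho>\<^sub>2(1)] \<gamma>(1) by linarith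
  moreover have "V \<rho>\<^sub>2 \<noteq> {}" using V_start[OF \<rho>\<^sub>2(1)] by auto
  ultimately obtain a where "a \<in> V \<rho>\<^sub>2" "\<kappa>' - \<gamma> < a" using less_cSupD by blast
  then obtain t\<^sub>1 x\<^sub>1 y\<^sub>1 where t\<^sub>1: "t\<^sub>1 \<in> {t\<^sub>0..T}" and xy\<^sub>1: "x\<^sub>1 \<in> Tr" "y\<^sub>1 \<in> Tr"
    and close\<^sub>1: "\<forall>r\<in>{0..t\<^sub>1}. norm (x\<^sub>1 r - y\<^sub>1 r) \<le> \<rho>\<^sub>2" and val\<^sub>1: "\<kappa>' - \<gamma> < val t\<^sub>1 x\<^sub>1 y\<^sub>1"
    by (auto simp: V_def)
  \<comment> \<open>Otherwise \<open>val\<close> would be at most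
    \<open>\<kappa> / 4 + \<kappa> / 2\<close>, which is below
    \<open>\<kappa> - \<gamma>\<close>.\<close>
  have "t\<^sub>1 < \<tau>"
  proof (rule ccontr)
    assume "\<not> t\<^sub>1 < \<tau>"
    have "\<forall>r\<in>{0..t\<^sub>1}. norm (x\<^sub>1 r - y\<^sub>1 r) \<le> \<rho>\<^sub>0" using close\<^sub>1 \<rho>\<^sub>1(3) \<rho>\<^sub>2(2) by fastforce
    then have "u t\<^sub>1 x\<^sub>1 - v t\<^sub>1 y\<^sub>1 \<le> \<kappa> / 4" using near[OF _ xy\<^sub>1] t\<^sub>1 \<open>\<not> t\<^sub>1 < \<tau>\<close> by simp
    moreover have "\<theta> * (t\<^sub>1 - t\<^sub>0) \<le> \<theta> * T" using t\<^sub>1 t\<^sub>0 \<theta> by (intro mult_left_mono) auto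
    ultimately show False using val\<^sub>1 \<kappa>'_ge \<gamma>(2) \<theta>(2) \<open>\<kappa> > 0\<close> unfolding val_def by linarith
  qed
  define E where "E t x y = u t x - v t y - (norm (x t - y t))\<^sup>2 / (2 * \<epsilon>)" for t and x y :: "real \<Rightarrow> 'h"
  have w\<^sub>1: "(norm (x\<^sub>1 t\<^sub>1 - y\<^sub>1 t\<^sub>1))\<^sup>2 \<le> \<gamma> * \<epsilon>"
  proof -
    have "norm (x\<^sub>1 t\<^sub>1 - y\<^sub>1 t\<^sub>1) \<le> \<rho>\<^sub>2" using close\<^sub>1 t\<^sub>1 t\<^sub>0 by auto
    then have "(norm (x\<^sub>1 t\<^sub>1 - y\<^sub>1 t\<^sub>1))\<^sup>2 \<le> \<rho>\<^sub>2\<^sup>2" by (intro power_mono) auto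
    then show ?thesis using \<rho>\<^sub>2_sq by linarith
  qed
  have E\<^sub>1: "E t\<^sub>1 x\<^sub>1 y\<^sub>1 \<ge> \<kappa>' - \<gamma> - \<theta> * (t\<^sub>1 - t\<^sub>0) - \<gamma> / 2"
  proof -
    have "(norm (x\<^sub>1 t\<^sub>1 - y\<^sub>1 t\<^sub>1))\<^sup>2 / (2 * \<epsilon>) \<le> \<gamma> / 2" using w\<^sub>1 \<epsilon>(1) by (simp add: pos_divide_le_eq mult_ac)
    then show ?thesis using val\<^sub>1 unfolding val_def E_def by linarith
  qed
  \<comment> \<open>\<open>5 / 2 * \<gamma>\<close> adds up \<gamma> from \<open>val_le\<close>,
    \<gamma> from the almost maximal start and \<open>\<gamma> / 2\<close> from its penalty. Half of
    the reward \<theta> pays for the loss of \<open>E\<close>; the other half is the gain.\<close>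
  have growth: "(norm (x t - y t))\<^sup>2 / (2 * \<epsilon>) \<le> 5 / 2 * \<gamma> - \<theta> / 2 * (t - t\<^sub>1)"
    if "t \<in> {t\<^sub>1..T}" "x \<in> Tr" "y \<in> Tr" "\<forall>r\<in>{0..t}. norm (x r - y r) \<le> \<rho>\<^sub>1" "E t x y \<ge> E t\<^sub>1 x\<^sub>1 y\<^sub>1 - \<theta> / 2 * (t - t\<^sub>1)" for t x y
  proof -
    have "val t x y \<le> \<kappa>' + \<gamma>" using that t\<^sub>1 by (intro val_le) auto
    then have "(norm (x t - y t))\<^sup>2 / (2 * \<epsilon>) \<le> 5 / 2 * \<gamma> - \<theta> * (t - t\<^sub>0) + \<theta> * (t\<^sub>1 - t\<^sub>0) + \<theta> / 2 * (t - t\<^sub>1)"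
      using that(5) E\<^sub>1 unfolding val_def E_def by linarith
    also have "\<dots> = 5 / 2 * \<gamma> - \<theta> / 2 * (t - t\<^sub>1)" by (simp add: field_simps)
    finally show ?thesis .
  qed

  obtain R where R: "R \<ge> 1" "\<forall>x\<in>Tr. 1 + sup_norm T x \<le> R" using Tr_bound by blast
  define D where "D = (2 * L + 2 * L\<^sub>0) * R + 1"
  have "D \<ge> 1" using L_nonneg L\<^sub>0_nonneg R(1) by (simp add: D_def)
  define \<mu> where "\<mu> = min (\<rho>\<^sub>1 / 4) (\<epsilon> * \<theta> / (4 * D))"
  have \<mu>: "\<mu> > 0" "\<mu> \<le> \<rho>\<^sub>1 / 4" "\<mu> \<le> \<epsilon> * \<theta> / (4 * D)" using \<rho>\<^sub>1 \<epsilon> \<theta> \<open>D \<ge> 1\<close> by (auto simp: \<mu>_def)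
  have small: "(2 * L + 2 * L\<^sub>0) * R * (\<mu> / \<epsilon>) \<le> \<theta> / 4"
  proof -
    have "(2 * L + 2 * L\<^sub>0) * R * (\<mu> / \<epsilon>) \<le> D * (\<mu> / \<epsilon>)" using \<mu>(1) \<epsilon>(1) by (intro mult_right_mono) (auto simp: D_def)
    also have "\<dots> \<le> D * (\<epsilon> * \<theta> / (4 * D) / \<epsilon>)" using \<mu>(3) \<epsilon>(1) \<open>D \<ge> 1\<close> by (intro mult_left_mono divide_right_mono) auto
    also have "\<dots> = \<theta> / 4" using \<epsilon>(1) \<open>D \<ge> 1\<close> by simp
    finally show ?thesis .
  qed
  obtain \<delta> where \<delta>: "\<delta> > 0" "\<And>x s t. x \<in> Tr \<Longrightarrow> s \<in> {0..T} \<Longrightarrow> t \<in> {0..T} \<Longrightarrow> \<bar>s - t\<bar> < \<delta> \<Longrightarrow> norm (x s - x t) < \<mu> / 2"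
    using equicontinuous_trajectories[OF t\<^sub>0 L_nonneg x\<^sub>0_paths, of "\<mu> / 2"] \<mu>(1) unfolding Tr_def by auto
  obtain N :: nat where N: "(T - t\<^sub>1) / \<delta> < N" using reals_Archimedean2 by blast
  have "(T - t\<^sub>1) / \<delta> > 0" using \<open>t\<^sub>1 < \<tau>\<close> \<tau> \<delta>(1) by simp
  then have "N > 0" using N by (metis of_nat_0_less_iff order_less_trans)
  define d where "d = (T - t\<^sub>1) / N"
  have d: "d > 0" "d < \<delta>" "N * d = T - t\<^sub>1"
    using \<open>N > 0\<close> \<open>t\<^sub>1 < \<tau>\<close> \<tau> N \<delta>(1) by (auto simp: d_def field_simps)
  define s where "s k = t\<^sub>1 + real k * d" for k :: nat
  have s0: "s 0 = t\<^sub>1" and s_Suc: "s (Suc k) = s k + d" and s_N: "s N = T" for k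
    using d(3) by (simp_all add: s_def algebra_simps)
  have s_le: "t\<^sub>1 \<le> s k" "k \<le> N \<Longrightarrow> s k \<le> T" for k
  proof -
    show "t\<^sub>1 \<le> s k" using d(1) by (simp add: s_def)
    assume "k \<le> N"
    then have "real k * d \<le> real N * d" using d(1) by (intro mult_right_mono) auto
    then show "s k \<le> T" using d(3) by (simp add: s_def)
  qed
  \<comment> \<open>The bound at the present time is sharper than the one on the history: it
    restores the room that the oscillation on the next step uses up.\<close>
  have "k \<le> N \<Longrightarrow> \<exists>x\<in>Tr. \<exists>y\<in>Tr. (\<forall>r\<in>{0..s k}. norm (x r - y r) \<le> \<rho>\<^sub>1) \<and>
      (norm (x (s k) - y (s k)))\<^sup>2 \<le> 5 * \<gamma> * \<epsilon> \<and> E (s k) x y \<ge> E t\<^sub>1 x\<^sub>1 y\<^sub>1 - \<theta> / 2 * (s k - t\<^sub>1)" for k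
  proof (induction k)
    case 0
    have "\<forall>r\<in>{0..t\<^sub>1}. norm (x\<^sub>1 r - y\<^sub>1 r) \<le> \<rho>\<^sub>1" using close\<^sub>1 \<rho>\<^sub>2(2) by fastforce
    moreover have "(norm (x\<^sub>1 t\<^sub>1 - y\<^sub>1 t\<^sub>1))\<^sup>2 \<le> 5 * \<gamma> * \<epsilon>" using w\<^sub>1 mult_pos_pos[OF \<gamma>(1) \<epsilon>(1)] by linarith
    moreover have "E t\<^sub>1 x\<^sub>1 y\<^sub>1 \<ge> E t\<^sub>1 x\<^sub>1 y\<^sub>1 - \<theta> / 2 * (t\<^sub>1 - t\<^sub>1)" by simp
    ultimately show ?case using xy\<^sub>1 unfolding s0 by blast
  next
    case (Suc k)
    then obtain x y where xy: "x \<in> Tr" "y \<in> Tr" "\<forall>r\<in>{0..s k}. norm (x r - y r) \<le> \<rho>\<^sub>1"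
      "(norm (x (s k) - y (s k)))\<^sup>2 \<le> 5 * \<gamma> * \<epsilon>" "E (s k) x y \<ge> E t\<^sub>1 x\<^sub>1 y\<^sub>1 - \<theta> / 2 * (s k - t\<^sub>1)"
      by auto
    have sk: "t\<^sub>0 \<le> s k" "s k < s (Suc k)" "s (Suc k) \<le> T" "0 \<le> s k"
      using s_le[of k] s_le(2)[OF Suc.prems] t\<^sub>1 t\<^sub>0 d(1) s_Suc by auto
    have osc: "norm (a r - a (s k)) \<le> \<mu> / 2" if "a \<in> Tr" "r \<in> {s k..s (Suc k)}" for a r
      using that sk d(2) s_Suc[of k] by (intro less_imp_le \<delta>) auto
    \<comment> \<open>\<open>\<rho>\<^sub>1\<^sup>2 / 2\<close> is below the square of
      \<open>3 / 4 * \<rho>\<^sub>1\<close>; the remaining quarter is for the movement on the next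
      step.\<close>
    have w_k: "norm (x (s k) - y (s k)) \<le> 3 / 4 * \<rho>\<^sub>1"
    proof (rule power2_le_imp_le)
      have "5 * \<gamma> * \<epsilon> \<le> \<eta> / 2 * \<epsilon>" using \<gamma>(3) \<epsilon>(1) by (intro mult_right_mono) auto
      also have "\<dots> = \<rho>\<^sub>1\<^sup>2 / 2" using \<epsilon>(2) by (simp add: mult.commute)
      also have "\<dots> \<le> (3 / 4 * \<rho>\<^sub>1)\<^sup>2" by (simp add: power2_eq_square)
      finally show "(norm (x (s k) - y (s k)))\<^sup>2 \<le> (3 / 4 * \<rho>\<^sub>1)\<^sup>2" using xy(4) by linarith
    qed (use \<rho>\<^sub>1 in simp)
    have close: "norm (a r - b r) \<le> \<rho>\<^sub>1" if ab: "a \<in> Tr" "b \<in> Tr" "\<forall>r\<in>{0..s k}. a r = x r" "\<forall>r\<in>{0..s k}. b r = y r"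
      and r: "r \<in> {0..s (Suc k)}" for a b r
    proof (cases "r \<le> s k")
      case True
      then show ?thesis using ab xy(3) r by auto
    next
      case False
      then have r': "r \<in> {s k..s (Suc k)}" using r by simp
      have "norm (a r - a (s k)) \<le> \<mu> / 2" "norm (b r - b (s k)) \<le> \<mu> / 2" using osc ab r' by blast+
      moreover have "norm (a (s k) - b (s k)) \<le> 3 / 4 * \<rho>\<^sub>1" using w_k ab sk by simp
      moreover have "norm (a r - b r) \<le> norm (a r - a (s k)) + norm (a (s k) - b (s k)) + norm (b r - b (s k))"
        by (rule norm_diff_le_three)
      ultimately show ?thesis using \<mu>(2) by linarith
    qed
    have mod: "m ((1 / \<epsilon>) * (norm (a r - b r))\<^sup>2 + sup_norm r (\<lambda>r. a r - b r)) \<le> \<theta> / 4"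
      if ab: "a \<in> Tr" "b \<in> Tr" "r \<in> {s k..s (Suc k)}" "\<forall>r\<in>{0..s k}. a r = x r" "\<forall>r\<in>{0..s k}. b r = y r" for a b r
    proof (rule \<eta>(2))
      have ab_close: "norm (a r' - b r') \<le> \<rho>\<^sub>1" if "r' \<in> {0..r}" for r'
        using that ab(3) by (intro close[OF ab(1,2,4,5)]) auto
      have r0: "0 \<le> r" "r \<le> T" using ab(3) sk by auto
      have cab: "continuous_on {0..T} (\<lambda>r. a r - b r)"
        by (intro continuous_intros pathsD Tr_paths ab)
      have "sup_norm r (\<lambda>r. a r - b r) \<le> \<eta>"
        using ab_close \<rho>\<^sub>1(4) r0 by (intro sup_norm_least) (auto intro: order_trans)
      moreover have "(1 / \<epsilon>) * (norm (a r - b r))\<^sup>2 \<le> \<eta>"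
      proof -
        have "(norm (a r - b r))\<^sup>2 \<le> \<rho>\<^sub>1\<^sup>2" using ab_close[of r] r0 by (intro power_mono) auto
        then show ?thesis using \<epsilon> by (simp add: pos_divide_le_eq mult.commute)
      qed
      ultimately show "(1 / \<epsilon>) * (norm (a r - b r))\<^sup>2 + sup_norm r (\<lambda>r. a r - b r) \<le> 2 * \<eta>" by linarith
      show "0 \<le> (1 / \<epsilon>) * (norm (a r - b r))\<^sup>2 + sup_norm r (\<lambda>r. a r - b r)"
        using sup_norm_nonneg[OF cab r0(2,1)] \<epsilon>(1) by (intro add_nonneg_nonneg) auto
    qed
    obtain a b where ab: "a \<in> Tr" "b \<in> Tr" "\<forall>r\<in>{0..s k}. a r = x r" "\<forall>r\<in>{0..s k}. b r = y r"
      and step: "E (s k) x y \<le> E (s (Suc k)) a b + 2 * (\<theta> / 4) * (s (Suc k) - s k)"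
      using euler_step[OF xy(1,2) sk(1-3) \<epsilon>(1) R(2) osc small mod] unfolding E_def by blast
    have c: "\<forall>r\<in>{0..s (Suc k)}. norm (a r - b r) \<le> \<rho>\<^sub>1" using close[OF ab] by blast
    have "\<theta> / 2 * (s (Suc k) - t\<^sub>1) = \<theta> / 2 * (s k - t\<^sub>1) + 2 * (\<theta> / 4) * (s (Suc k) - s k)"
      by (simp add: field_simps)
    then have e: "E (s (Suc k)) a b \<ge> E t\<^sub>1 x\<^sub>1 y\<^sub>1 - \<theta> / 2 * (s (Suc k) - t\<^sub>1)"
      using step xy(5) by linarith
    have "(norm (a (s (Suc k)) - b (s (Suc k))))\<^sup>2 / (2 * \<epsilon>) \<le> 5 / 2 * \<gamma> - \<theta> / 2 * (s (Suc k) - t\<^sub>1)"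
      using s_le[of "Suc k"] Suc.prems by (intro growth ab c e) auto
    \<comment> \<open>Between the grid times the negative term is dropped; it is exploited at time
      \<open>T\<close> alone.\<close>
    also have "\<dots> \<le> 5 / 2 * \<gamma>" using s_le(1)[of "Suc k"] \<theta>(1) by simp
    finally have "(norm (a (s (Suc k)) - b (s (Suc k))))\<^sup>2 \<le> 5 * \<gamma> * \<epsilon>"
      using \<epsilon>(1) by (simp add: pos_divide_le_eq mult_ac)
    with ab(1,2) c e show ?case by blast
  qed
  from this[of N] obtain x y where xy: "x \<in> Tr" "y \<in> Tr" "\<forall>r\<in>{0..T}. norm (x r - y r) \<le> \<rho>\<^sub>1"
    "E T x y \<ge> E t\<^sub>1 x\<^sub>1 y\<^sub>1 - \<theta> / 2 * (T - t\<^sub>1)" unfolding s_N by blast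
  \<comment> \<open>A penalty cannot be negative, so \<open>\<theta> * (T - t\<^sub>1)\<close> is at
    most \<open>5 * \<gamma>\<close>, which the choice of \<gamma> excludes.\<close>
  have "0 \<le> (norm (x T - y T))\<^sup>2 / (2 * \<epsilon>)" using \<epsilon>(1) by simp
  also have "\<dots> \<le> 5 / 2 * \<gamma> - \<theta> / 2 * (T - t\<^sub>1)" using t\<^sub>1 by (intro growth xy) auto
  finally have "\<theta> * (T - t\<^sub>1) \<le> 5 * \<gamma>" by simp
  moreover have "\<theta> * (T - \<tau>) < \<theta> * (T - t\<^sub>1)" using \<open>t\<^sub>1 < \<tau>\<close> \<theta>(1) by (intro mult_strict_left_mono) auto
  moreover have "10 * \<gamma> \<le> \<theta> * (T - \<tau>)" using \<gamma>(4) by simp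
  ultimately show False using \<gamma>(1) by linarith
qed

end

section \<open>Reduction of the theorem to one starting point and one growth constant\<close>

lemma trajectory_rhs_mono:
  fixes \<iota> :: "'v::{banach, second_countable_topology} \<Rightarrow>\<^sub>L 'h::{real_inner, complete_space}"
  assumes x: "trajectory_rhs \<iota> A p q T L t\<^sub>0 x\<^sub>0 x f" and "L \<le> L'" "0 \<le> t\<^sub>0"
  shows "trajectory_rhs \<iota> A p q T L' t\<^sub>0 x\<^sub>0 x f"
proof -
  have px: "x \<in> paths T" and b: "AE t in lebesgue_on {t\<^sub>0<..<T}. norm (f t) \<le> L * (1 + sup_norm t x)"
    using x by (auto simp: trajectory_rhs_def)
  have "AE t in lebesgue_on {t\<^sub>0<..<T}. t \<in> {t\<^sub>0<..<T}"
    by (intro AE_I2) (simp add: space_restrict_space)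
  with b have "AE t in lebesgue_on {t\<^sub>0<..<T}. norm (f t) \<le> L' * (1 + sup_norm t x)"
  proof eventually_elim
    case (elim t)
    have "0 \<le> sup_norm t x" using px elim(2) \<open>0 \<le> t\<^sub>0\<close> by (intro sup_norm_nonneg[of T]) (auto simp: paths_def)
    then have "L * (1 + sup_norm t x) \<le> L' * (1 + sup_norm t x)" using \<open>L \<le> L'\<close> by (intro mult_right_mono) auto
    with elim(1) show ?case by linarith
  qed
  then show ?thesis using x unfolding trajectory_rhs_def by blast
qed

theorem theorem4p5:
  fixes T p q :: real
    and \<iota> :: "'v::{banach, second_countable_topology} \<Rightarrow>\<^sub>L 'h::{real_inner, complete_space}"
    and A :: "real \<Rightarrow> 'v \<Rightarrow> ('v \<Rightarrow>\<^sub>L real)"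
    and h :: "(real \<Rightarrow> 'h) \<Rightarrow> real"
    and F :: "real \<Rightarrow> (real \<Rightarrow> 'h) \<Rightarrow> 'h \<Rightarrow> real"
    and xstar :: 'h
    and \<Omega>' :: "(real \<Rightarrow> 'h) set"
    and u v :: "real \<Rightarrow> (real \<Rightarrow> 'h) \<Rightarrow> real"
  assumes "T > 0" and "p \<ge> 2" and "q > 1" and "1 / p + 1 / q = 1"
    and "reflexive_space TYPE('v)"
    and "compact_dense_embedding \<iota>"
    and "monotone_coercive_operator T p q A"
    and "continuous_terminal T h"
    and "admissible_hamiltonian \<iota> A p q T F"
    and "Omega \<iota> A p q T xstar \<subseteq> \<Omega>'" and "\<Omega>' \<subseteq> paths T"
    and "minimax_subsolution \<iota> A p q T h F \<Omega>' u"
    and "minimax_supersolution \<iota> A p q T h F \<Omega>' v"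
  shows "\<forall>t\<in>{0..T}. \<forall>x\<in>\<Omega>'. u t x \<le> v t x"
proof (intro ballI)
  fix t x assume t: "t \<in> {0..T}" and x: "x \<in> \<Omega>'"
  obtain Lu where Lu: "Lu \<ge> 0" "minimax_L_subsolution \<iota> A p q T h F Lu \<Omega>' u"
    using assms(12) by (auto simp: minimax_subsolution_def)
  obtain Lv where Lv: "Lv \<ge> 0" "minimax_L_supersolution \<iota> A p q T h F Lv \<Omega>' v"
    using assms(13) by (auto simp: minimax_supersolution_def)
  have uT: "\<forall>x\<in>\<Omega>'. u T x \<le> h x" and vT: "\<forall>x\<in>\<Omega>'. v T x \<ge> h x"
    using Lu(2) Lv(2) unfolding minimax_L_subsolution_def minimax_L_supersolution_def by blast+
  show "u t x \<le> v t x"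
  proof (cases "t = T")
    case True
    then show ?thesis using uT vT x by fastforce
  next
    case False
    then have t': "0 \<le> t" "t < T" using t by auto
    \<comment> \<open>A larger constant admits more trajectories, so the maximum serves both
      semisolutions.\<close>
    define L where "L = max Lu Lv"
    obtain c\<^sub>2 where c\<^sub>2: "c\<^sub>2 > 0" "AE t in lebesgue_on {0..T}. \<forall>x. blinfun_apply (A t x) x \<ge> c\<^sub>2 * norm x powr p"
      using assms(7) unfolding monotone_coercive_operator_def by blast
    interpret evolution T p q c\<^sub>2 \<iota> A
    proof
      show "AE t in lebesgue_on {0..T}. \<forall>x y. blinfun_apply (A t x - A t y) (x - y) \<ge> 0"
        using assms(7) unfolding monotone_coercive_operator_def by blast
      show "compact (closure (\<iota> ` B))" if "bounded B" for B
        using assms(6) that unfolding compact_dense_embedding_def by blast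
    qed (use assms c\<^sub>2 in auto)
    have F1: "\<forall>t\<in>{0..T}. \<forall>x\<in>paths T. \<forall>z. \<forall>\<epsilon>>0. \<exists>\<delta>>0. \<forall>s\<in>{0..T}. \<forall>y\<in>paths T. \<forall>z'.
        d_inf T (t, x) (s, y) < \<delta> \<and> norm (z - z') < \<delta> \<longrightarrow> \<bar>F t x z - F s y z'\<bar> < \<epsilon>"
      and F2: "\<exists>L\<^sub>0\<ge>0. \<forall>t\<in>{0..T}. \<forall>x\<in>paths T. \<forall>z z'.
        \<bar>F t x z - F t x z'\<bar> \<le> L\<^sub>0 * (1 + sup_norm t x) * norm (z - z')"
      and F3: "\<forall>L\<ge>0. \<forall>t\<^sub>0\<in>{0..<T}. \<forall>x\<^sub>0\<in>paths T. \<exists>m. modulus_of_continuity m \<and>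
        (\<forall>\<epsilon>>0. \<forall>t\<in>{t\<^sub>0..T}. \<forall>x\<in>Traj L t\<^sub>0 x\<^sub>0. \<forall>y\<in>Traj L t\<^sub>0 x\<^sub>0.
             F t x ((1 / \<epsilon>) *\<^sub>R (x t - y t)) - F t y ((1 / \<epsilon>) *\<^sub>R (x t - y t))
               \<le> m ((1 / \<epsilon>) * (norm (x t - y t))\<^sup>2 + sup_norm t (\<lambda>s. x s - y s)))"
      using assms(9) unfolding admissible_hamiltonian_def by (blast, blast, blast)
    obtain L\<^sub>0 where L\<^sub>0: "L\<^sub>0 \<ge> 0" "\<forall>t\<in>{0..T}. \<forall>x\<in>paths T. \<forall>z z'.
        \<bar>F t x z - F t x z'\<bar> \<le> L\<^sub>0 * (1 + sup_norm t x) * norm (z - z')"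
      using F2 by blast
    have "L \<ge> 0" "t \<in> {0..<T}" "x \<in> paths T" using Lu(1) t' x assms(11) by (auto simp: L_def)
    with F3 obtain m where m: "modulus_of_continuity m"
      "\<forall>\<epsilon>>0. \<forall>s\<in>{t..T}. \<forall>x'\<in>Traj L t x. \<forall>y\<in>Traj L t x.
             F s x' ((1 / \<epsilon>) *\<^sub>R (x' s - y s)) - F s y ((1 / \<epsilon>) *\<^sub>R (x' s - y s))
               \<le> m ((1 / \<epsilon>) * (norm (x' s - y s))\<^sup>2 + sup_norm s (\<lambda>r. x' r - y r))"
      by blast
    interpret doubling T p q c\<^sub>2 \<iota> A h F L\<^sub>0 L t m x \<Omega>' u v
    proof
      fix t\<^sub>1 x\<^sub>1 z assume tx: "0 \<le> t\<^sub>1" "t\<^sub>1 < T" "x\<^sub>1 \<in> \<Omega>'"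
      have "\<exists>x\<in>\<Omega>'. \<exists>f. trajectory_rhs \<iota> A p q T Lu t\<^sub>1 x\<^sub>1 x f \<and>
        (\<forall>t\<in>{t\<^sub>1..T}. u t\<^sub>1 x\<^sub>1 \<le> integral\<^sup>L (lebesgue_on {t\<^sub>1..t}) (\<lambda>s. inner (- f s) z + F s x z) + u t x)"
        using Lu(2) tx unfolding minimax_L_subsolution_def by simp
      then show "\<exists>x\<in>\<Omega>'. \<exists>f. trajectory_rhs \<iota> A p q T L t\<^sub>1 x\<^sub>1 x f \<and>
        (\<forall>t\<in>{t\<^sub>1..T}. u t\<^sub>1 x\<^sub>1 \<le> integral\<^sup>L (lebesgue_on {t\<^sub>1..t}) (\<lambda>s. inner (- f s) z + F s x z) + u t x)"
        using trajectory_rhs_mono[OF _ max.cobounded1[of Lu Lv] tx(1), folded L_def] by blast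
      have "\<exists>x\<in>\<Omega>'. \<exists>f. trajectory_rhs \<iota> A p q T Lv t\<^sub>1 x\<^sub>1 x f \<and>
        (\<forall>t\<in>{t\<^sub>1..T}. v t\<^sub>1 x\<^sub>1 \<ge> integral\<^sup>L (lebesgue_on {t\<^sub>1..t}) (\<lambda>s. inner (- f s) z + F s x z) + v t x)"
        using Lv(2) tx unfolding minimax_L_supersolution_def by simp
      then show "\<exists>x\<in>\<Omega>'. \<exists>f. trajectory_rhs \<iota> A p q T L t\<^sub>1 x\<^sub>1 x f \<and>
        (\<forall>t\<in>{t\<^sub>1..T}. v t\<^sub>1 x\<^sub>1 \<ge> integral\<^sup>L (lebesgue_on {t\<^sub>1..t}) (\<lambda>s. inner (- f s) z + F s x z) + v t x)"
        using trajectory_rhs_mono[OF _ max.cobounded2[of Lv Lu] tx(1), folded L_def] by blast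
    next
      show "\<exists>\<delta>>0. \<forall>s\<in>{0..T}. \<forall>y\<in>paths T. \<forall>z'.
        d_inf T (t, x) (s, y) < \<delta> \<and> norm (z - z') < \<delta> \<longrightarrow> \<bar>F t x z - F s y z'\<bar> < \<epsilon>"
        if "t \<in> {0..T}" "x \<in> paths T" "\<epsilon> > 0" for t x z \<epsilon> using F1 that by blast
    qed (use t' x assms(8,11) uT vT L\<^sub>0 m \<open>L \<ge> 0\<close> in auto)
    show ?thesis by (rule comparison)
  qed
qed

end
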